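(* Let $n\in\mathbb N_+$, $\varepsilon,\gamma\in\mathbb N^{-1}$ and $\tilde\varepsilon=2\ln\bigl(1+2^{-\lceil\log(2/\varepsilon)\rceil}\bigr)\in(\tfrac49\varepsilon,\varepsilon]$. Then there is a deterministic algorithm ${\tt FastSample}_{n,\varepsilon,\gamma}:[n]\times[d]_+\to[n]$ with $\log d=\tilde O(1/\varepsilon)\cdot\log(n/\gamma)$ having the following properties: (i) ${\tt FastSample}_{n,\varepsilon,\gamma}$ is $(\varepsilon/2,0)$-differentially private for counting queries; (ii) for every $\beta>\gamma$, ${\tt FastSample}_{n,\varepsilon,\gamma}$ has $(a,\beta)$-accuracy with $a=\lceil\frac{2}{\tilde\varepsilon}\ln\frac{1}{\beta-\gamma}\rceil$; (iii) ${\tt FastSample}_{n,\varepsilon,\gamma}$ has running time $\tilde O\bigl(\frac1\varepsilon\log^2n+\frac1\varepsilon\log n\cdot\log\frac1\gamma\bigr)$; (iv) for all $z\in[n]$, $F_{{\tt FastSample}_{n,\varepsilon,\gamma}}(z)$ can be computed in time $\tilde O\bigl(\frac1\varepsilon\log\frac n\gamma\bigr)$; (v) for each $c$, ${\tt FastSample}_{n,\varepsilon,\gamma}(c,u)$ is a non-decreasing function of $u$.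
   Context: Notation: $\mathbb N_+=\{1,2,\dots\}$, $\mathbb N^{-1}=\{1/k:k\in\mathbb N_+\}$; $[n]=\{0,\dots,n\}$, $[n]_+=\{1,\dots,n\}$; $\log$ is base 2. A randomized algorithm on datasets in $\mathcal X^n$ is $(\varepsilon,\delta)$-differentially private if for all datasets $D,D'$ differing in exactly one row and all output sets $S$, $\Pr[\mathcal M(D)\in S]\le e^\varepsilon\Pr[\mathcal M(D')\in S]+\delta$. A map $\mathcal M:[n]\times[d]_+\to[n]$ is $(\varepsilon,\delta)$-differentially private for counting queries if the algorithm $D\in\{0,1\}^n\mapsto\mathcal M(\sum_iD_i,U)$ with $U\sim\mathrm{Unif}([d]_+)$ is $(\varepsilon,\delta)$-differentially private; it has $(a,\beta)$-accuracy if $\Pr[|\mathcal M(c,U)-c|\le a]\ge1-\beta$ for all $c\in[n]$. For deterministic $\mathcal M$, $F_{\mathcal M}(z)=d\cdot\Pr[\mathcal M(0,U)\le z]$ for $z\in[n]$. Running times are in the $w$-bit word RAM model with $w$ logarithmic in the input length, with unit-cost access to an oracle returning a uniform element of $[d]_+$, and multiplication of two $x$-bit integers costing $\tilde O(x)$. *)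

theory Defs
  imports "HOL-Probability.Probability" "HOL-Library.Log_Nat"
begin

definition inv_nats :: "real set" where
  "inv_nats = {1 / real k | k. k \<ge> 1}"

definition params :: "(nat \<times> real \<times> real) set" where
  "params = {(n, \<epsilon>, \<gamma>). n \<ge> 1 \<and> \<epsilon> \<in> inv_nats \<and> \<gamma> \<in> inv_nats}"

definition eps_tilde :: "real \<Rightarrow> real" where
  "eps_tilde \<epsilon> = 2 * ln (1 + 2 powr (- real_of_int \<lceil>log 2 (2 / \<epsilon>)\<rceil>))"

text \<open>Soft-O in several parameters, with constants uniform over the whole parameter set. The
  summands 1 and 2 only matter where \<open>g\<close> is close to 0 (for instance \<open>g = log n\<close> at \<open>n = 1\<close>).\<close>

definition soft_O :: "'p set \<Rightarrow> ('p \<Rightarrow> real) \<Rightarrow> ('p \<Rightarrow> real) set" where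
  "soft_O A g = {f. \<exists>C k. \<forall>p\<in>A. \<bar>f p\<bar> \<le> C * (1 + \<bar>g p\<bar>) * log 2 (2 + \<bar>g p\<bar>) ^ k}"


section \<open>Differential privacy\<close>

definition differ_in_one_row :: "'x list \<Rightarrow> 'x list \<Rightarrow> bool" where
  "differ_in_one_row D D' \<longleftrightarrow>
     length D = length D' \<and> card {i. i < length D \<and> D ! i \<noteq> D' ! i} = 1"

definition diff_private :: "nat \<Rightarrow> real \<Rightarrow> real \<Rightarrow> ('x list \<Rightarrow> 'y pmf) \<Rightarrow> bool" where
  "diff_private n \<epsilon> \<delta> M \<longleftrightarrow>
     (\<forall>D D' S. length D = n \<and> length D' = n \<and> differ_in_one_row D D' \<longrightarrow>
        measure_pmf.prob (M D) S \<le> exp \<epsilon> * measure_pmf.prob (M D') S + \<delta>)"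

text \<open>A map \<open>[n] \<times> [d]\<^sub>+ \<rightarrow> [n]\<close> is a function \<open>nat \<Rightarrow> nat \<Rightarrow> nat\<close> used only on that domain; a row
  in \<open>{0,1}\<close> is a boolean.\<close>

definition diff_private_counting ::
    "nat \<Rightarrow> nat \<Rightarrow> real \<Rightarrow> real \<Rightarrow> (nat \<Rightarrow> nat \<Rightarrow> nat) \<Rightarrow> bool" where
  "diff_private_counting n d \<epsilon> \<delta> M \<longleftrightarrow>
     diff_private n \<epsilon> \<delta>
       (\<lambda>D :: bool list. map_pmf (M (\<Sum>b\<leftarrow>D. of_bool b)) (pmf_of_set {1..d}))"

definition accurate :: "nat \<Rightarrow> nat \<Rightarrow> int \<Rightarrow> real \<Rightarrow> (nat \<Rightarrow> nat \<Rightarrow> nat) \<Rightarrow> bool" where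
  "accurate n d a \<beta> M \<longleftrightarrow>
     (\<forall>c\<le>n. measure_pmf.prob (pmf_of_set {1..d}) {u. \<bar>int (M c u) - int c\<bar> \<le> a} \<ge> 1 - \<beta>)"

definition scaled_cdf :: "nat \<Rightarrow> (nat \<Rightarrow> nat \<Rightarrow> nat) \<Rightarrow> nat \<Rightarrow> real" where
  "scaled_cdf d M z = real d * measure_pmf.prob (pmf_of_set {1..d}) {u. M 0 u \<le> z}"


section \<open>Word RAM\<close>

text \<open>A program is a structured program over registers and an addressable memory, both holding
  \<open>w\<close>-bit words; it is a finite text not depending on \<open>w\<close> or on the input. Every operation on
  words costs one step. \<open>BigMul\<close> multiplies two integers stored in memory with the same number
  \<open>l\<close> of words, i.e. two \<open>(l * w)\<close>-bit integers, and costs \<open>mulcost (l * w)\<close> (plus one step),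
  where the function \<open>mulcost\<close> is a parameter of the machine.\<close>

datatype binop = Add | Sub | Mul | Div | Mod | And | Or | Xor | Shl | Shr | Lt | Eq

type_synonym reg = nat

datatype com =
    Skip
  | Const reg nat              \<comment> \<open>\<open>Const r k\<close>: r := k\<close>
  | Op binop reg reg reg       \<comment> \<open>\<open>Op f r s t\<close>: r := f s t\<close>
  | Load reg reg               \<comment> \<open>\<open>Load r s\<close>: r := mem[s]\<close>
  | Store reg reg              \<comment> \<open>\<open>Store r s\<close>: mem[r] := s\<close>
  | BigMul reg reg reg reg     \<comment> \<open>\<open>BigMul r s t l\<close>: mem[r..<r+2l] := mem[s..<s+l] * mem[t..<t+l]\<close>
  | Seq com com
  | If reg com com             \<comment> \<open>tests whether the register is nonzero\<close>
  | While reg com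

text \<open>Results are reduced modulo \<open>2 ^ w\<close>; division by 0 follows the conventions of HOL.\<close>

fun binop_val :: "nat \<Rightarrow> binop \<Rightarrow> nat \<Rightarrow> nat \<Rightarrow> nat" where
  "binop_val w Add a b = (a + b) mod 2 ^ w"
| "binop_val w Sub a b = (a + 2 ^ w - b) mod 2 ^ w"
| "binop_val w Mul a b = (a * b) mod 2 ^ w"
| "binop_val w Div a b = a div b"
| "binop_val w Mod a b = a mod b"
| "binop_val w And a b = Bit_Operations.and a b"
| "binop_val w Or a b = Bit_Operations.or a b"
| "binop_val w Xor a b = Bit_Operations.xor a b"
| "binop_val w Shl a b = (a * 2 ^ b) mod 2 ^ w"
| "binop_val w Shr a b = a div 2 ^ b"
| "binop_val w Lt a b = of_bool (a < b)"
| "binop_val w Eq a b = of_bool (a = b)"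

text \<open>Integers are stored in base \<open>2 ^ w\<close>, least significant word first; address arithmetic is
  modulo \<open>2 ^ w\<close>.\<close>

definition digit :: "nat \<Rightarrow> nat \<Rightarrow> nat \<Rightarrow> nat" where
  "digit w x i = x div 2 ^ (w * i) mod 2 ^ w"

definition stored_int :: "nat \<Rightarrow> (nat \<Rightarrow> nat) \<Rightarrow> nat \<Rightarrow> nat \<Rightarrow> nat" where
  "stored_int w m a l = (\<Sum>i<l. m ((a + i) mod 2 ^ w) * 2 ^ (w * i))"

definition store_int :: "nat \<Rightarrow> nat \<Rightarrow> nat \<Rightarrow> nat \<Rightarrow> (nat \<Rightarrow> nat) \<Rightarrow> (nat \<Rightarrow> nat)" where
  "store_int w a l x m =
     (\<lambda>b. let i = (b + 2 ^ w - a) mod 2 ^ w in if b < 2 ^ w \<and> i < l then digit w x i else m b)"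

type_synonym state = "(reg \<Rightarrow> nat) \<times> (nat \<Rightarrow> nat)"

inductive run :: "nat \<Rightarrow> (nat \<Rightarrow> nat) \<Rightarrow> com \<Rightarrow> state \<Rightarrow> nat \<Rightarrow> state \<Rightarrow> bool"
  for w :: nat and mulcost :: "nat \<Rightarrow> nat" where
  Skip: "run w mulcost Skip s 1 s"
| Const: "run w mulcost (Const r k) (R, m) 1 (R(r := k mod 2 ^ w), m)"
| Op: "run w mulcost (Op f r s t) (R, m) 1 (R(r := binop_val w f (R s) (R t)), m)"
| Load: "run w mulcost (Load r s) (R, m) 1 (R(r := m (R s)), m)"
| Store: "run w mulcost (Store r s) (R, m) 1 (R, m(R r := R s))"
| BigMul: "run w mulcost (BigMul r s t l) (R, m) (1 + mulcost (R l * w))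
     (R, store_int w (R r) (2 * R l)
           (stored_int w m (R s) (R l) * stored_int w m (R t) (R l)) m)"
| Seq: "run w mulcost p s\<^sub>1 t\<^sub>1 s\<^sub>2 \<Longrightarrow> run w mulcost q s\<^sub>2 t\<^sub>2 s\<^sub>3 \<Longrightarrow>
     run w mulcost (Seq p q) s\<^sub>1 (t\<^sub>1 + t\<^sub>2) s\<^sub>3"
| IfTrue: "R r \<noteq> 0 \<Longrightarrow> run w mulcost p (R, m) t s \<Longrightarrow>
     run w mulcost (If r p q) (R, m) (1 + t) s"
| IfFalse: "R r = 0 \<Longrightarrow> run w mulcost q (R, m) t s \<Longrightarrow>
     run w mulcost (If r p q) (R, m) (1 + t) s"
| WhileFalse: "R r = 0 \<Longrightarrow> run w mulcost (While r p) (R, m) 1 (R, m)"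
| WhileTrue: "R r \<noteq> 0 \<Longrightarrow> run w mulcost p (R, m) t\<^sub>1 s\<^sub>2 \<Longrightarrow>
     run w mulcost (While r p) s\<^sub>2 t\<^sub>2 s\<^sub>3 \<Longrightarrow>
     run w mulcost (While r p) (R, m) (1 + t\<^sub>1 + t\<^sub>2) s\<^sub>3"

text \<open>The inputs are stored one after the other from address 0 on, without leading zero words;
  registers \<open>2 * i\<close> and \<open>2 * i + 1\<close> hold the address and the number of words of the \<open>i\<close>-th
  input. The output is the integer stored at the address in register 0 with the number of words
  in register 1.\<close>

definition num_words :: "nat \<Rightarrow> nat \<Rightarrow> nat" where
  "num_words w x = floorlog (2 ^ w) x"

definition input_memory :: "nat \<Rightarrow> nat list \<Rightarrow> nat \<Rightarrow> nat" where
  "input_memory w xs =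
     (let ds = concat (map (\<lambda>x. map (digit w x) [0..<num_words w x]) xs)
      in (\<lambda>a. if a < length ds then ds ! a else 0))"

definition input_registers :: "nat \<Rightarrow> nat list \<Rightarrow> reg \<Rightarrow> nat" where
  "input_registers w xs r =
     (if r div 2 < length xs
      then if even r then (\<Sum>x\<leftarrow>take (r div 2) xs. num_words w x)
           else num_words w (xs ! (r div 2))
      else 0)"

definition outputs_within ::
    "nat \<Rightarrow> (nat \<Rightarrow> nat) \<Rightarrow> com \<Rightarrow> nat list \<Rightarrow> nat \<Rightarrow> real \<Rightarrow> bool" where
  "outputs_within w mulcost p xs y T \<longleftrightarrow>
     (\<exists>t R m. run w mulcost p (input_registers w xs, input_memory w xs) t (R, m) \<and>
        stored_int w m (R 0) (R 1) = y \<and> real t \<le> T)"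

text \<open>The parameters of \<open>\<epsilon> = 1 / k\<close> and \<open>\<gamma>\<close> are passed to a program as the integer \<open>k\<close>.\<close>

definition denom :: "real \<Rightarrow> nat" where
  "denom x = nat \<lfloor>1 / x\<rfloor>"

text \<open>Number of bits of an input \<open>(n, \<epsilon>, \<gamma>, c, u)\<close>. The arguments \<open>c \<in> [n]\<close> and \<open>u \<in> [d]\<^sub>+\<close> are
  counted with the fixed number of bits needed for elements of these ranges, so that the length
  depends only on the parameters. The argument \<open>u\<close> is the answer of the oracle returning a uniform element of \<open>[d]\<^sub>+\<close>.\<close>

definition input_length :: "nat \<Rightarrow> real \<Rightarrow> real \<Rightarrow> nat \<Rightarrow> nat" where
  "input_length n \<epsilon> \<gamma> d =
     floorlog 2 n + floorlog 2 (denom \<epsilon>) + floorlog 2 (denom \<gamma>) + floorlog 2 n + floorlog 2 d"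

text \<open>Word length \<open>\<Theta>(log L)\<close> for inputs of \<open>L\<close> bits.\<close>

definition word_length :: "nat \<Rightarrow> nat \<Rightarrow> nat" where
  "word_length \<kappa> L = \<kappa> * floorlog 2 L"

end

theory Submission
  imports Defs
begin

text \<open>The output is the count plus a symmetric integer noise, clamped to \<open>[n]\<close>. The noise is drawn by inverting
  its tail \<open>G\<close>, an integer-valued function with \<open>2 * G 0 \<le> D\<close>. The mechanism is private as soon as neighbouring tails and
  neighbouring masses have ratios at most \<open>exp (\<epsilon> / 2)\<close>, and accuracy only concerns the size of the tail. We
  take a geometric tail computed by a recursion on floating-point numbers with mantissas of one word, plus a small
  linear tail of total mass below \<open>\<gamma>\<close>. The recursion has \<open>O(1 / \<epsilon>)\<close> steps per bit of the exponent, hence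
  about \<open>(1 / \<epsilon>) log (n / \<gamma>)\<close> steps of constant cost; one long subtraction then yields the distribution function, and a
  bitwise search with \<open>O(log n)\<close> evaluations of the tail inverts it. No long multiplication is needed.\<close>

section \<open>Clamped noise with given tails\<close>

text \<open>Rounding is affordable because privacy and accuracy refer to different rates. With
  \<epsilon> = 1/K and \<open>s\<close> the least power of two that is at least 2K,
  \<open>eps_tilde\<close> is 2 ln(1 + 1/s). Accuracy thus asks only for a decay by s/(s+1) per
  step, whereas privacy tolerates exp(\<epsilon>/2) >= exp(1/s) >= 1 + 1/s + 1/(2s^2). The gap of
  order 1/s^2 is spent on rounding, and words with more than 4 log s bits keep the errors below it.
  The delicate quantities are the masses, being differences of tails: tails rounded independently of
  each other would leave them uncontrolled. The recursion therefore rounds the decrement and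
  subtracts it exactly, so that each mass of the geometric part is itself a rounded quotient with a
  known relative error. Two places need separate care: the noise 0, where both tails meet and the
  start value has to fit, and the point where the mantissas run out, where the linear part must take
  over without a jump in the mass.\<close>

text \<open>\<open>G k\<close> is the number of noise values \<open>u\<close> on one side whose noise exceeds \<open>k\<close>; small \<open>u\<close> move the count
  down and large \<open>u\<close> move it up, which makes the output monotone in \<open>u\<close>.\<close>

definition rank :: "nat \<Rightarrow> (nat \<Rightarrow> nat) \<Rightarrow> nat \<Rightarrow> nat" where
  "rank n G v = card {i. i < n \<and> v \<le> G i}"

definition clamped_noise :: "nat \<Rightarrow> nat \<Rightarrow> (nat \<Rightarrow> nat) \<Rightarrow> nat \<Rightarrow> nat \<Rightarrow> nat" where
  "clamped_noise n D G c u =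
     (if 2 * u \<le> D then c - rank n G u else min n (c + rank n G (D + 1 - u)))"

lemma downset_eq_lessThan:
  fixes n :: nat
  assumes "\<And>i j. i \<le> j \<Longrightarrow> j < n \<Longrightarrow> P j \<Longrightarrow> P i"
  shows "{i. i < n \<and> P i} = {..<card {i. i < n \<and> P i}}"
  using assms
proof (induction n)
  case (Suc n)
  show ?case
  proof (cases "P n")
    case True
    then have "{i. i < Suc n \<and> P i} = {..<Suc n}"
      using Suc.prems[of _ n] by auto
    then show ?thesis by simp
  next
    case False
    then have "{i. i < Suc n \<and> P i} = {i. i < n \<and> P i}"
      by (auto simp: less_Suc_eq)
    then show ?thesis using Suc by auto
  qed
qed simp

lemma count_differ_in_one_row:
  assumes "differ_in_one_row B B'"
  shows "(\<Sum>b\<leftarrow>B'. of_bool b :: nat) = Suc (\<Sum>b\<leftarrow>B. of_bool b) \<or>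
    (\<Sum>b\<leftarrow>B. of_bool b :: nat) = Suc (\<Sum>b\<leftarrow>B'. of_bool b)"
proof -
  from assms have len: "length B = length B'" and "card {i. i < length B \<and> B ! i \<noteq> B' ! i} = 1"
    by (auto simp: differ_in_one_row_def)
  then obtain j where j: "{i. i < length B \<and> B ! i \<noteq> B' ! i} = {j}"
    by (auto simp: card_1_singleton_iff)
  define S :: "bool list \<Rightarrow> nat" where "S L = (\<Sum>i\<in>{0..<length L} - {j}. of_bool (L ! i))" for L
  have jl: "j < length B" "B ! j \<noteq> B' ! j" using j by auto
  have sum: "(\<Sum>b\<leftarrow>L. of_bool b :: nat) = of_bool (L ! j) + S L" if "j < length L" for L
    unfolding S_def using that
    by (subst sum_list_sum_nth, subst sum.remove[of _ j]) auto
  have "S B = S B'"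
    unfolding S_def using j len by (intro sum.cong) auto
  then show ?thesis
    using sum[of B] sum[of B'] jl len by (cases "B ! j"; cases "B' ! j") auto
qed

lemma sum_list_of_bool_le: "(\<Sum>b\<leftarrow>B. of_bool b :: nat) \<le> length B"
  by (induction B) auto

text \<open>By \<open>half\<close>, the values \<open>u <= G 0\<close> of nonzero downward noise and
  their mirror images lie on different sides of the split \<open>2 * u <= D\<close> in
  \<open>clamped_noise\<close>, so the split never cuts through a nonzero noise.\<close>

locale tails =
  fixes n D :: nat and G :: "nat \<Rightarrow> nat"
  assumes n: "2 \<le> n" and D: "0 < D" and half: "2 * G 0 \<le> D"
    and antimono: "i \<le> j \<Longrightarrow> j < n \<Longrightarrow> G j \<le> G i"
begin

text \<open>Antitone tails make the counted indices an initial segment, so their number reaches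
  \<open>k\<close> exactly when index \<open>k - 1\<close> is among them. Through this equivalence
  \<open>rank\<close> inverts \<open>G\<close>.\<close>

lemma rank_ge: "0 < k \<Longrightarrow> k \<le> n \<Longrightarrow> k \<le> rank n G v \<longleftrightarrow> v \<le> G (k - 1)"
proof -
  assume k: "0 < k" "k \<le> n"
  have "{i. i < n \<and> v \<le> G i} = {..<rank n G v}"
    unfolding rank_def by (rule downset_eq_lessThan) (meson antimono le_trans)
  then have "k - 1 < n \<and> v \<le> G (k - 1) \<longleftrightarrow> k - 1 < rank n G v" by blast
  then show ?thesis using k by auto
qed

lemma rank_antimono: "v \<le> v' \<Longrightarrow> rank n G v' \<le> rank n G v"
  unfolding rank_def by (intro card_mono) auto

lemma G_le: "k < n \<Longrightarrow> 2 * G k \<le> D"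
  using antimono[of 0 k] half by auto

abbreviation "M \<equiv> clamped_noise n D G"

definition "F c z = (if z < c then G (c - z - 1) else if z < n then D - G (z - c) else D)"

lemma M_le: "c \<le> n \<Longrightarrow> M c u \<le> n"
  by (auto simp: clamped_noise_def intro: le_trans[OF diff_le_self])

text \<open>Below the count, an output of at most \<open>z\<close> means downward noise exceeding
  \<open>c - z - 1\<close>; from the count on, it is the complement of upward noise exceeding
  \<open>z - c\<close>. Clamping at 0 is done by the truncated subtraction, clamping at
  \<open>n\<close> by the last case of \<open>F\<close>.\<close>

lemma card_M_le:
  assumes c: "c \<le> n"
  shows "card {u \<in> {1..D}. M c u \<le> z} = F c z"
proof -
  consider "z < c" | "c \<le> z" "z < n" | "n \<le> z" by linarith
  then show ?thesis
  proof cases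
    case 1
    then have "2 * G (c - z - 1) \<le> D" using c by (intro G_le) auto
    have "M c u \<le> z \<longleftrightarrow> u \<le> G (c - z - 1)" if "u \<in> {1..D}" for u
    proof (cases "2 * u \<le> D")
      case True
      have "c - rank n G u \<le> z \<longleftrightarrow> c - z \<le> rank n G u" by linarith
      then show ?thesis
        using 1 c True rank_ge[of "c - z" u] by (simp add: clamped_noise_def)
    next
      case False
      then show ?thesis
        using 1 c \<open>2 * G (c - z - 1) \<le> D\<close> by (auto simp: clamped_noise_def)
    qed
    then have "{u \<in> {1..D}. M c u \<le> z} = {1..G (c - z - 1)}"
      using \<open>2 * G (c - z - 1) \<le> D\<close> by auto
    then show ?thesis using 1 by (simp add: F_def)
  next
    case 2
    then have "2 * G (z - c) \<le> D" by (intro G_le) auto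
    have "M c u \<le> z \<longleftrightarrow> u \<le> D - G (z - c)" if "u \<in> {1..D}" for u
    proof (cases "2 * u \<le> D")
      case True
      then show ?thesis
        using 2 \<open>2 * G (z - c) \<le> D\<close> by (auto simp: clamped_noise_def)
    next
      case False
      have "min n (c + rank n G (D + 1 - u)) \<le> z \<longleftrightarrow> \<not> z - c + 1 \<le> rank n G (D + 1 - u)"
        using 2 by auto
      also have "\<dots> \<longleftrightarrow> \<not> D + 1 - u \<le> G (z - c)"
        using 2 rank_ge[of "z - c + 1" "D + 1 - u"] by simp
      finally show ?thesis
        using False that by (auto simp: clamped_noise_def)
    qed
    then have "{u \<in> {1..D}. M c u \<le> z} = {1..D - G (z - c)}"
      by auto
    then show ?thesis using 2 by (simp add: F_def)
  next
    case 3
    then have "{u \<in> {1..D}. M c u \<le> z} = {1..D}"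
      using M_le[OF c] by (auto intro: le_trans)
    then show ?thesis using 3 c by (simp add: F_def)
  qed
qed

text \<open>For a fixed direction, these count the values of \<open>u\<close> whose noise is at
  least \<open>k\<close>, respectively exactly \<open>k\<close>.\<close>

definition "tail k = (if k = 0 then D - G 0 else G (k - 1))"
definition "mass k = (if k = 0 then D - 2 * G 0 else G (k - 1) - G k)"

text \<open>Clamping collects a whole tail at the outputs 0 and \<open>n\<close>; every interior
  output receives a single mass, obtained as a difference of consecutive values of
  \<open>F\<close>.\<close>

lemma card_M_eq:
  assumes c: "c \<le> n" and z: "z \<le> n"
  shows "card {u \<in> {1..D}. M c u = z} =
    (if z = 0 then tail c else if z = n then tail (n - c)
     else mass (if c \<le> z then z - c else c - z))"
proof (cases z)
  case 0
  then have "{u \<in> {1..D}. M c u = z} = {u \<in> {1..D}. M c u \<le> 0}" by auto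
  then show ?thesis
    using card_M_le[OF c, of 0] 0 n by (auto simp: F_def tail_def)
next
  case (Suc y)
  have "{u \<in> {1..D}. M c u \<le> Suc y} = {u \<in> {1..D}. M c u \<le> y} \<union> {u \<in> {1..D}. M c u = z}"
    using Suc by auto
  then have "card {u \<in> {1..D}. M c u \<le> Suc y} =
      card {u \<in> {1..D}. M c u \<le> y} + card {u \<in> {1..D}. M c u = z}"
    using Suc by (simp, subst card_Un_disjoint) auto
  then have eq: "F c (Suc y) = F c y + card {u \<in> {1..D}. M c u = z}"
    unfolding card_M_le[OF c] .
  consider "z = n" "c < n" | "z = n" "c = n" | "z < n" "c < z" | "z < n" "c = z" | "z < n" "z < c"
    using c z by linarith
  then show ?thesis
  proof cases
    case 1
    then have "F c (Suc y) = D" "F c y = D - G (n - c - 1)" "2 * G (n - c - 1) \<le> D"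
      using Suc G_le[of "n - c - 1"] by (auto simp: F_def)
    then show ?thesis using eq 1 n by (simp add: tail_def)
  next
    case 2
    then have "F c (Suc y) = D" "F c y = G 0"
      using Suc by (auto simp: F_def)
    then show ?thesis using eq 2 n half by (simp add: tail_def)
  next
    case 3
    then have "F c (Suc y) = D - G (z - c)" "F c y = D - G (z - c - 1)"
      "G (z - c) \<le> G (z - c - 1)" "2 * G (z - c - 1) \<le> D"
      using Suc antimono[of "z - c - 1" "z - c"] G_le[of "z - c - 1"] by (auto simp: F_def)
    then have "card {u \<in> {1..D}. M c u = z} = G (z - c - 1) - G (z - c)" using eq by linarith
    then show ?thesis using 3 Suc by (simp add: mass_def)
  next
    case 4
    then have "F c (Suc y) = D - G 0" "F c y = G 0"
      using Suc by (auto simp: F_def)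
    then have "card {u \<in> {1..D}. M c u = z} = D - 2 * G 0" using eq half by linarith
    then show ?thesis using 4 Suc by (simp add: mass_def)
  next
    case 5
    then have "F c (Suc y) = G (c - z - 1)" "F c y = G (c - z)" "G (c - z) \<le> G (c - z - 1)"
      using Suc c antimono[of "c - z - 1" "c - z"] by (auto simp: F_def intro!: arg_cong[where f = G])
    then have "card {u \<in> {1..D}. M c u = z} = G (c - z - 1) - G (c - z)" using eq by linarith
    then show ?thesis using 5 Suc by (simp add: mass_def)
  qed
qed

text \<open>Moving the count by one shifts the index of the tail or mass by one, up or down
  depending on the side of \<open>z\<close> on which the count lies. This is why both directions of
  each ratio are assumed.\<close>

lemma card_M_close:
  fixes E :: real
  assumes tail: "\<And>k. k < n \<Longrightarrow> tail k \<le> E * tail (Suc k) \<and> tail (Suc k) \<le> E * tail k"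
    and mass: "\<And>k. Suc k < n \<Longrightarrow> mass k \<le> E * mass (Suc k) \<and> mass (Suc k) \<le> E * mass k"
    and c: "c \<le> n" "c' \<le> n" "c' = Suc c \<or> c = Suc c'" and z: "z \<le> n"
  shows "card {u \<in> {1..D}. M c u = z} \<le> E * card {u \<in> {1..D}. M c' u = z}"
proof -
  have t: "tail k \<le> E * tail k'" if "k \<le> n" "k' \<le> n" "k' = Suc k \<or> k = Suc k'" for k k'
    using tail[of k] tail[of k'] that by auto
  have m: "mass k \<le> E * mass k'" if "k < n" "k' < n" "k' = Suc k \<or> k = Suc k'" for k k'
    using mass[of k] mass[of k'] that by auto
  show ?thesis
    unfolding card_M_eq[OF c(1) z] card_M_eq[OF c(2) z]
    using c z n by (auto intro!: t m)
qed

section \<open>From counts to probabilities: privacy, accuracy and monotonicity\<close>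

lemma prob_eq_card:
  "measure_pmf.prob (pmf_of_set {1..D}) A = card {u \<in> {1..D}. u \<in> A} / D"
  using D by (subst measure_pmf_of_set) (auto simp: Int_def)

lemma card_preimage: 
  assumes "c \<le> n"
  shows "card {u \<in> {1..D}. M c u \<in> S} = (\<Sum>z\<in>S \<inter> {0..n}. card {u \<in> {1..D}. M c u = z})"
proof -
  have "{u \<in> {1..D}. M c u \<in> S} = (\<Union>z\<in>S \<inter> {0..n}. {u \<in> {1..D}. M c u = z})"
    using M_le[OF assms] by auto
  then show ?thesis
    by (simp only:) (subst card_UN_disjoint, auto)
qed

theorem diff_private_clamped_noise:
  assumes tail: "\<And>k. k < n \<Longrightarrow> tail k \<le> exp \<epsilon> * tail (Suc k) \<and> tail (Suc k) \<le> exp \<epsilon> * tail k"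
    and mass: "\<And>k. Suc k < n \<Longrightarrow> mass k \<le> exp \<epsilon> * mass (Suc k) \<and> mass (Suc k) \<le> exp \<epsilon> * mass k"
  shows "diff_private_counting n D \<epsilon> 0 M"
  unfolding diff_private_counting_def diff_private_def
proof (intro allI impI)
  fix B B' :: "bool list" and S :: "nat set"
  assume B: "length B = n \<and> length B' = n \<and> differ_in_one_row B B'"
  define c c' :: nat where "c = (\<Sum>b\<leftarrow>B. of_bool b)" and "c' = (\<Sum>b\<leftarrow>B'. of_bool b)"
  have c: "c \<le> n" "c' \<le> n"
    using sum_list_of_bool_le[of B] sum_list_of_bool_le[of B'] B by (auto simp: c_def c'_def)
  have "c' = Suc c \<or> c = Suc c'"
    using count_differ_in_one_row[of B B'] B by (auto simp: c_def c'_def)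
  \<comment> \<open>With additive error 0, privacy may be checked output by output and summed over
    the event.\<close>
  then have "(\<Sum>z\<in>S \<inter> {0..n}. real (card {u \<in> {1..D}. M c u = z})) \<le>
      (\<Sum>z\<in>S \<inter> {0..n}. exp \<epsilon> * real (card {u \<in> {1..D}. M c' u = z}))"
    using c tail mass by (intro sum_mono card_M_close) auto
  then have "real (card {u \<in> {1..D}. M c u \<in> S}) \<le> exp \<epsilon> * real (card {u \<in> {1..D}. M c' u \<in> S})"
    by (simp only: card_preimage[OF c(1)] card_preimage[OF c(2)] of_nat_sum sum_distrib_left)
  then have "card {u \<in> {1..D}. M c u \<in> S} / D \<le> exp \<epsilon> * (card {u \<in> {1..D}. M c' u \<in> S} / D)"
    using D by (simp add: field_simps)
  then show "measure_pmf.prob (map_pmf (M (\<Sum>b\<leftarrow>B. of_bool b)) (pmf_of_set {1..D})) S \<le>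
      exp \<epsilon> * measure_pmf.prob (map_pmf (M (\<Sum>b\<leftarrow>B'. of_bool b)) (pmf_of_set {1..D})) S + 0"
    unfolding c_def[symmetric] c'_def[symmetric] measure_map_pmf prob_eq_card by simp
qed

lemma scaled_cdf_clamped_noise: "scaled_cdf D M z = F 0 z"
  using card_M_le[of 0 z] D by (simp only: scaled_cdf_def prob_eq_card mem_Collect_eq) simp

text \<open>Noise larger than \<open>a\<close> occurs for at most \<open>G a\<close> values of
  \<open>u\<close> on each side, and clamping can only bring the output closer to the count. For
  \<open>a >= n\<close> no output in the range is too far away.\<close>

lemma prob_clamped_noise_ge:
  fixes \<beta> :: real
  assumes c: "c \<le> n" and tail: "a < n \<Longrightarrow> 2 * real (G a) \<le> \<beta> * D" and "0 \<le> \<beta>"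
  shows "measure_pmf.prob (pmf_of_set {1..D}) {u. \<bar>int (M c u) - int c\<bar> \<le> int a} \<ge> 1 - \<beta>"
proof -
  define A where "A = {u. \<bar>int (M c u) - int c\<bar> \<le> int a}"
  define B where "B = {u \<in> {1..D}. u \<notin> A}"
  have "card {u \<in> {1..D}. u \<in> A} + card B = card {1..D}"
  proof -
    have "{u \<in> {1..D}. u \<in> A} \<union> B = {1..D}" by (auto simp: B_def)
    moreover have "{u \<in> {1..D}. u \<in> A} \<inter> B = {}" by (auto simp: B_def)
    moreover have "finite B" by (simp add: B_def)
    ultimately show ?thesis
      using card_Un_disjoint[of "{u \<in> {1..D}. u \<in> A}" B] by simp
  qed
  moreover have "real (card B) \<le> \<beta> * D"
  proof (cases "a < n")
    case True
    have "B \<subseteq> {1..G a} \<union> {D + 1 - G a..D}"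
    proof
      fix u assume u: "u \<in> B"
      have "Suc a \<le> rank n G u" if "2 * u \<le> D"
        using u that c by (auto simp: B_def A_def clamped_noise_def)
      moreover have "Suc a \<le> rank n G (D + 1 - u)" if "\<not> 2 * u \<le> D"
        using u that c by (auto simp: B_def A_def clamped_noise_def min_def split: if_splits)
      ultimately show "u \<in> {1..G a} \<union> {D + 1 - G a..D}"
        using u True rank_ge[of "Suc a" u] rank_ge[of "Suc a" "D + 1 - u"]
        by (cases "2 * u \<le> D") (auto simp: B_def)
    qed
    then have "card B \<le> card ({1..G a} \<union> {D + 1 - G a..D})"
      by (intro card_mono) auto
    also have "\<dots> \<le> G a + G a"
      using G_le[OF True] by (intro le_trans[OF card_Un_le]) auto
    finally show ?thesis using tail[OF True] by linarith
  next
    case False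
    have "u \<in> A" for u
      using False c M_le[OF c, of u] by (auto simp: A_def)
    then have "B = {}" by (auto simp: B_def)
    then show ?thesis using assms by simp
  qed
  ultimately have "real D - \<beta> * D \<le> card {u \<in> {1..D}. u \<in> A}"
    by simp
  then show ?thesis
    unfolding A_def[symmetric] prob_eq_card using D by (simp add: field_simps)
qed

lemma mono_clamped_noise:
  assumes "c \<le> n"
  shows "mono_on {1..D} (M c)"
proof (rule mono_onI)
  fix u u' assume "u \<in> {1..D}" "u' \<in> {1..D}" "u \<le> u'"
  then have "rank n G u' \<le> rank n G u" "rank n G (D + 1 - u) \<le> rank n G (D + 1 - u')"
    by (auto intro!: rank_antimono)
  then show "M c u \<le> M c u'"
    using assms \<open>u \<le> u'\<close> by (auto simp: clamped_noise_def intro: diff_le_mono2)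
qed

end

section \<open>Word RAM programs with time bounds\<close>

definition wf_state :: "nat \<Rightarrow> state \<Rightarrow> bool" where
  "wf_state w s \<longleftrightarrow> (\<forall>r. fst s r < 2 ^ w) \<and> (\<forall>a. snd s a < 2 ^ w)"

lemma wf_state_reg: "wf_state w (R, m) \<Longrightarrow> R r < 2 ^ w"
  by (auto simp: wf_state_def)

lemma binop_val_less:
  assumes "w > 0" "a < 2 ^ w" "b < 2 ^ w"
  shows "binop_val w f a b < 2 ^ w"
proof -
  \<comment> \<open>Words are fixed by \<open>take_bit w\<close>, which commutes with the bitwise
    operations; hence their results are words again.\<close>
  have *: "take_bit w a = a" "take_bit w b = b"
    using assms by (simp_all add: take_bit_nat_eq_self)
  have "Bit_Operations.and a b < 2 ^ w" "Bit_Operations.or a b < 2 ^ w"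
      "Bit_Operations.xor a b < 2 ^ w"
    by (metis * take_bit_and take_bit_nat_less_exp, metis * take_bit_or take_bit_nat_less_exp,
        metis * take_bit_xor take_bit_nat_less_exp)
  moreover have "a div x < 2 ^ w" "a mod x < 2 ^ w" for x
    using assms(2) div_le_dividend le_less_trans mod_less_eq_dividend by blast+
  moreover have "of_bool P < (2::nat) ^ w" for P
    using one_less_power[of "2::nat" w] assms(1) by (cases P) auto
  ultimately show ?thesis
    by (cases f) auto
qed

lemma wf_state_run:
  "run w mulcost p s t s' \<Longrightarrow> w > 0 \<Longrightarrow> wf_state w s \<Longrightarrow> wf_state w s'"
proof (induction rule: run.induct)
  case (BigMul r s t l R m)
  then show ?case
    by (auto simp: wf_state_def store_int_def Let_def digit_def)
qed (auto simp: wf_state_def binop_val_less simp del: binop_val.simps)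

text \<open>A total-correctness judgement with a time bound. That registers and memory hold \<open>w\<close>-bit words is
  built in, since the address arithmetic of every program relies on it.\<close>

definition tr :: "nat \<Rightarrow> (nat \<Rightarrow> nat) \<Rightarrow> com \<Rightarrow> state \<Rightarrow> nat \<Rightarrow> (state \<Rightarrow> bool) \<Rightarrow> bool" where
  "tr w mulcost p s T Q \<longleftrightarrow> (\<exists>t s'. run w mulcost p s t s' \<and> t \<le> T \<and> wf_state w s' \<and> Q s')"

lemma tr_weaken:
  "tr w mc p s T Q \<Longrightarrow> (\<And>s'. wf_state w s' \<Longrightarrow> Q s' \<Longrightarrow> Q' s') \<Longrightarrow> T \<le> T' \<Longrightarrow> tr w mc p s T' Q'"
  unfolding tr_def by (meson le_trans)

lemma tr_Seq:
  assumes "tr w mc p s T1 Q1" "\<And>s'. wf_state w s' \<Longrightarrow> Q1 s' \<Longrightarrow> tr w mc q s' T2 Q" "T1 + T2 \<le> T"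
  shows "tr w mc (Seq p q) s T Q"
proof -
  from assms(1) obtain t1 s1 where 1: "run w mc p s t1 s1" "t1 \<le> T1" "wf_state w s1" "Q1 s1"
    unfolding tr_def by blast
  from assms(2)[OF 1(3,4)] obtain t2 s2
    where 2: "run w mc q s1 t2 s2" "t2 \<le> T2" "wf_state w s2" "Q s2"
    unfolding tr_def by blast
  show ?thesis
    unfolding tr_def using 1 2 assms(3) run.Seq[OF 1(1) 2(1)]
    by (metis add_le_mono le_trans)
qed

lemma tr_If:
  assumes "R r \<noteq> 0 \<Longrightarrow> tr w mc p (R, m) T Q" "R r = 0 \<Longrightarrow> tr w mc q (R, m) T Q" "T < T'"
  shows "tr w mc (If r p q) (R, m) T' Q"
proof (cases "R r = 0")
  case True
  from assms(2)[OF this] obtain t s' where "run w mc q (R, m) t s'" "t \<le> T" "wf_state w s'" "Q s'"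
    unfolding tr_def by blast
  with run.IfFalse[of R r, OF True this(1)] assms(3) show ?thesis
    unfolding tr_def by (intro exI[of _ "1 + t"] exI[of _ s']) auto
next
  case False
  from assms(1)[OF this] obtain t s' where "run w mc p (R, m) t s'" "t \<le> T" "wf_state w s'" "Q s'"
    unfolding tr_def by blast
  with run.IfTrue[of R r, OF False this(1)] assms(3) show ?thesis
    unfolding tr_def by (intro exI[of _ "1 + t"] exI[of _ s']) auto
qed

text \<open>The variant bounds the number of rounds by \<open>k\<close>. Each round costs
  \<open>B\<close> and one test, and the failing test at the end costs one more step.\<close>

lemma tr_While:
  assumes step: "\<And>R m. wf_state w (R, m) \<Longrightarrow> I (R, m) \<Longrightarrow> R r \<noteq> 0 \<Longrightarrow>
      tr w mc p (R, m) B (\<lambda>s'. I s' \<and> \<mu> s' < \<mu> (R, m))"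
    and "wf_state w s" "I s" "\<mu> s \<le> k" "k * (B + 1) + 1 \<le> T"
  shows "tr w mc (While r p) s T (\<lambda>s'. I s' \<and> fst s' r = 0)"
proof -
  have "tr w mc (While r p) s (\<mu> s * (B + 1) + 1) (\<lambda>s'. I s' \<and> fst s' r = 0)"
    using assms(2,3)
  proof (induction "\<mu> s" arbitrary: s rule: less_induct)
    case less
    obtain R m where s: "s = (R, m)" by fastforce
    show ?case
    proof (cases "R r = 0")
      case True
      then show ?thesis
        unfolding tr_def s using less.prems s run.WhileFalse[of R r, OF True]
        by (intro exI[of _ 1] exI[of _ "(R, m)"]) auto
    next
      case False
      from step[of R m] False less.prems s obtain t1 s1 where
        1: "run w mc p (R, m) t1 s1" "t1 \<le> B" "wf_state w s1" "I s1" "\<mu> s1 < \<mu> s"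
        unfolding tr_def by blast
      from less.hyps[OF 1(5,3,4)] obtain t2 s2 where
        2: "run w mc (While r p) s1 t2 s2" "t2 \<le> \<mu> s1 * (B + 1) + 1" "wf_state w s2" "I s2"
          "fst s2 r = 0"
        unfolding tr_def by blast
      have "\<mu> s1 * (B + 1) + (B + 1) \<le> \<mu> s * (B + 1)"
        using 1(5) by (metis Suc_leI add.commute mult_Suc mult_le_mono1)
      then have "1 + t1 + t2 \<le> \<mu> s * (B + 1) + 1"
        using 1 2 by linarith
      with run.WhileTrue[OF False 1(1) 2(1)] 2 show ?thesis
        unfolding tr_def s by blast
    qed
  qed
  moreover have "\<mu> s * (B + 1) + 1 \<le> T"
    using assms(4,5) by (meson add_le_mono1 le_trans mult_le_mono1)
  ultimately show ?thesis
    by (auto elim: tr_weaken)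
qed

text \<open>Loop-free programs are executed symbolically by the function \<open>ex\<close> below. \<open>BigMul\<close> is excluded because
  the algorithm never multiplies long integers; the time bounds therefore do not involve its cost.\<close>

fun straight :: "com \<Rightarrow> bool" where
  "straight (Seq p q) = (straight p \<and> straight q)"
| "straight (If r p q) = (straight p \<and> straight q)"
| "straight (While r p) = False"
| "straight (BigMul r s t l) = False"
| "straight _ = True"

text \<open>Both branches of an \<open>If\<close> are charged, an overestimate that keeps the bound
  free of maxima.\<close>

fun straight_cost :: "com \<Rightarrow> nat" where
  "straight_cost (Seq p q) = straight_cost p + straight_cost q"
| "straight_cost (If r p q) = 1 + straight_cost p + straight_cost q"
| "straight_cost _ = 1"

fun ex :: "nat \<Rightarrow> com \<Rightarrow> state \<Rightarrow> state" where
  "ex w (Const r k) (R, m) = (R(r := k mod 2 ^ w), m)"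
| "ex w (Op f r s t) (R, m) = (R(r := binop_val w f (R s) (R t)), m)"
| "ex w (Load r s) (R, m) = (R(r := m (R s)), m)"
| "ex w (Store r s) (R, m) = (R, m(R r := R s))"
| "ex w (Seq p q) s = ex w q (ex w p s)"
| "ex w (If r p q) (R, m) = (if R r \<noteq> 0 then ex w p (R, m) else ex w q (R, m))"
| "ex w _ s = s"

lemma run_ex: "straight p \<Longrightarrow> \<exists>t \<le> straight_cost p. run w mc p s t (ex w p s)"
proof (induction p arbitrary: s)
  case (Seq p q)
  then obtain t1 t2 where "t1 \<le> straight_cost p" "run w mc p s t1 (ex w p s)"
    "t2 \<le> straight_cost q" "run w mc q (ex w p s) t2 (ex w q (ex w p s))"
    by (meson straight.simps(1))
  then show ?case
    by (intro exI[of _ "t1 + t2"]) (auto intro: run.Seq)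
next
  case (If r p q)
  obtain R m where s: "s = (R, m)" by fastforce
  from If obtain t1 t2 where "t1 \<le> straight_cost p" "run w mc p s t1 (ex w p s)"
    "t2 \<le> straight_cost q" "run w mc q s t2 (ex w q s)"
    by (meson straight.simps(2))
  then show ?case
  proof (cases "R r = 0")
    case True
    with run.IfFalse[of R r w mc q m t2 _ p, OF True] show ?thesis
      using \<open>t2 \<le> straight_cost q\<close> \<open>run w mc q s t2 (ex w q s)\<close>
      unfolding s by (intro exI[of _ "1 + t2"]) auto
  next
    case False
    with run.IfTrue[of R r w mc p m t1 _ q, OF False] show ?thesis
      using \<open>t1 \<le> straight_cost p\<close> \<open>run w mc p s t1 (ex w p s)\<close>
      unfolding s by (intro exI[of _ "1 + t1"]) auto
  qed
next
  case (Op f r1 r2 r3)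
  show ?case using run.Op[of w mc f r1 r2 r3 "fst s" "snd s"] by (cases s) auto
next
  case (Const r k)
  show ?case using run.Const[of w mc r k "fst s" "snd s"] by (cases s) auto
next
  case (Load r1 r2)
  show ?case using run.Load[of w mc r1 r2 "fst s" "snd s"] by (cases s) auto
next
  case (Store r1 r2)
  show ?case using run.Store[of w mc r1 r2 "fst s" "snd s"] by (cases s) auto
next
  case Skip
  show ?case using run.Skip[of w mc s] by (cases s) auto
qed auto

lemma tr_straight:
  assumes "straight p" "w > 0" "wf_state w s" "straight_cost p \<le> T" "Q (ex w p s)"
  shows "tr w mc p s T Q"
  using run_ex[OF assms(1), of w mc s] assms wf_state_run unfolding tr_def
  by (meson le_trans)

section \<open>Long integers in memory: subtraction, comparison and copying\<close>

abbreviation (input) seq_com :: "com \<Rightarrow> com \<Rightarrow> com" (infixr ";;" 60) where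
  "p ;; q \<equiv> Seq p q"

text \<open>The machine has no move instruction; the bitwise or of a word with itself copies
  it.\<close>

abbreviation (input) Mov :: "reg \<Rightarrow> reg \<Rightarrow> com" where
  "Mov r s \<equiv> Op Or r s s"

text \<open>This is \<open>stored_int\<close> without reduction of the addresses, valid for arrays
  that do not wrap around the end of memory.\<close>

definition val :: "nat \<Rightarrow> (nat \<Rightarrow> nat) \<Rightarrow> nat \<Rightarrow> nat \<Rightarrow> nat" where
  "val w m a l = (\<Sum>i<l. m (a + i) * 2 ^ (w * i))"

lemma val_0 [simp]: "val w m a 0 = 0"
  by (simp add: val_def)

lemma val_Suc: "val w m a (Suc l) = val w m a l + m (a + l) * 2 ^ (w * l)"
  by (simp add: val_def)

lemma val_add: "val w m a (k + l) = val w m a k + 2 ^ (w * k) * val w m (a + k) l"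
  by (induction l) (simp_all add: val_Suc algebra_simps power_add)

lemma val_cong:
  "(\<And>x. a \<le> x \<Longrightarrow> x < a + l \<Longrightarrow> m' x = m x) \<Longrightarrow> val w m' a l = val w m a l"
  unfolding val_def by (intro sum.cong) auto

lemma val_zero: "(\<And>x. a \<le> x \<Longrightarrow> x < a + l \<Longrightarrow> m x = 0) \<Longrightarrow> val w m a l = 0"
  unfolding val_def by (intro sum.neutral) auto

lemma val_less:
  assumes "\<And>x. m x < 2 ^ w"
  shows "val w m a l < 2 ^ (w * l)"
proof (induction l)
  case (Suc l)
  have "(m (a + l) + 1) * 2 ^ (w * l) \<le> 2 ^ w * 2 ^ (w * l)"
    using assms[of "a + l"] by (intro mult_le_mono1) simp
  with Suc show ?case
    by (simp add: val_Suc power_add algebra_simps)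
qed simp

lemma stored_int_eq_val:
  assumes "a + l \<le> 2 ^ w"
  shows "stored_int w m a l = val w m a l"
  unfolding stored_int_def val_def using assms by (intro sum.cong) auto

text \<open>\<open>sub_com a b d l\<close> subtracts the \<open>l\<close>-word integer at \<open>b\<close> from the one at \<open>a\<close> (all four are registers) and stores
  the difference at \<open>d\<close>. It uses registers 20 to 29 and leaves the final borrow in register 25, so
  it also serves as the comparison and, with 0 at \<open>b\<close>, as the copying routine.\<close>

definition sub_body :: com where
  "sub_body = Load 26 20 ;; Load 27 21 ;; Op Sub 28 26 27 ;; Op Sub 29 28 25 ;; Store 22 29 ;;
     Op Lt 26 26 27 ;; Op Lt 28 28 25 ;; Op Or 25 26 28 ;;
     Op Add 20 20 24 ;; Op Add 21 21 24 ;; Op Add 22 22 24 ;; Op Sub 23 23 24"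

definition sub_com :: "reg \<Rightarrow> reg \<Rightarrow> reg \<Rightarrow> reg \<Rightarrow> com" where
  "sub_com a b d l = (Mov 20 a ;; Mov 21 b ;; Mov 22 d ;; Mov 23 l ;; Const 24 1 ;; Const 25 0) ;;
     While 23 sub_body"

text \<open>At most one of the two modular subtractions borrows: if \<open>x < y\<close>, then
  \<open>d = x + W - y\<close> is at least 1 and subtracting \<open>b\<close> cannot underflow. So
  the bitwise or of the two flags is their sum.\<close>

lemma sub_word:
  fixes x y b W :: nat
  assumes xy: "x < W" "y < W" and b: "b \<le> 1" and d_eq: "d = (x + W - y) mod W"
  shows "(d + W - b) mod W + y + b = x + Bit_Operations.or (of_bool (x < y)) (of_bool (d < b)) * W"
proof -
  have W: "d < W"
    using xy d_eq by simp
  have borrow: "(d + W - b) mod W = d - b" if "b \<le> d"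
  proof -
    from that have "d + W - b = (d - b) + W" "d - b < W" using W by linarith+
    then show ?thesis by (simp only: mod_add_self2 mod_less)
  qed
  show ?thesis
  proof (cases "x < y")
    case True
    then have d: "d = x + W - y"
      unfolding d_eq using xy by simp
    then have "b \<le> d" using xy b by simp
    then show ?thesis
      using borrow d True xy by simp
  next
    case False
    then have "x + W - y = (x - y) + W" "x - y < W" using xy by linarith+
    then have d: "d = x - y"
      by (simp only: d_eq mod_add_self2 mod_less)
    show ?thesis
    proof (cases "d < b")
      case True
      then have "d = 0" "b = 1" using b by auto
      then show ?thesis using d False W by simp
    next
      case f: False
      then show ?thesis
        using borrow d False by simp
    qed
  qed
qed

text \<open>The invariant is the subtraction identity for the lowest \<open>i\<close> digits with
  the pending borrow. At the end both integers are below \<open>2 ^ (w * R l)\<close>, which forces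
  the last borrow to be the outcome of the comparison. The target must avoid both operands, whereas
  the operands may overlap each other.\<close>

lemma tr_sub:
  assumes w: "w > 0" and wf: "wf_state w (R, m)"
    and regs: "a \<notin> {20..29}" "b \<notin> {20..29}" "d \<notin> {20..29}" "l \<notin> {20..29}"
    and bnd: "R a + R l < 2 ^ w" "R b + R l < 2 ^ w" "R d + R l < 2 ^ w"
    and dis: "R a + R l \<le> R d \<or> R d + R l \<le> R a" "R b + R l \<le> R d \<or> R d + R l \<le> R b"
    and T: "13 * R l + 8 \<le> T"
    and Q: "\<And>R' m'. wf_state w (R', m') \<Longrightarrow>
        (\<And>r. r \<notin> {20..29} \<Longrightarrow> R' r = R r) \<Longrightarrow>
        (\<And>x. \<not> (R d \<le> x \<and> x < R d + R l) \<Longrightarrow> m' x = m x) \<Longrightarrow>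
        R' 25 = of_bool (val w m (R a) (R l) < val w m (R b) (R l)) \<Longrightarrow>
        val w m' (R d) (R l) + val w m (R b) (R l) =
          val w m (R a) (R l) + R' 25 * 2 ^ (w * R l) \<Longrightarrow> Q (R', m')"
  shows "tr w mc (sub_com a b d l) (R, m) T Q"
proof -
  define A B DD n where [simp]: "A = R a" "B = R b" "DD = R d" "n = R l"
  have w1: "1 < (2::nat) ^ w"
    using w by (metis one_less_numeral_iff one_less_power semiring_norm(76))
  define I where "I = (\<lambda>(R', m'). \<exists>i\<le>n. R' 20 = A + i \<and> R' 21 = B + i \<and> R' 22 = DD + i \<and>
      R' 23 = n - i \<and> R' 24 = 1 \<and> R' 25 \<le> 1 \<and>
      (\<forall>r. r \<notin> {20..29} \<longrightarrow> R' r = R r) \<and>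
      (\<forall>x. \<not> (DD \<le> x \<and> x < DD + i) \<longrightarrow> m' x = m x) \<and>
      val w m' DD i + val w m B i = val w m A i + R' 25 * 2 ^ (w * i))"
  have step: "tr w mc sub_body (R', m') 12 (\<lambda>s'. I s' \<and> fst s' 23 < fst (R', m') 23)"
    if wf': "wf_state w (R', m')" and inv: "I (R', m')" and ne: "R' 23 \<noteq> 0" for R' m'
  proof (rule tr_straight)
    from inv obtain i where i: "i \<le> n" "R' 20 = A + i" "R' 21 = B + i" "R' 22 = DD + i"
      "R' 23 = n - i" "R' 24 = 1" "R' 25 \<le> 1" "\<And>r. r \<notin> {20..29} \<Longrightarrow> R' r = R r"
      "\<And>x. \<not> (DD \<le> x \<and> x < DD + i) \<Longrightarrow> m' x = m x"
      "val w m' DD i + val w m B i = val w m A i + R' 25 * 2 ^ (w * i)"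
      unfolding I_def by auto
    have "i < n" using i(5) ne by simp
    have mA: "m' (A + i) = m (A + i)" and mB: "m' (B + i) = m (B + i)"
      using dis \<open>i < n\<close> by (intro i(9); auto)+
    define x y c where "x = m (A + i)" "y = m (B + i)" "c = R' 25"
    have xy: "x < 2 ^ w" "y < 2 ^ w" "c \<le> 1"
      using wf i(7) by (auto simp: x_y_c_def wf_state_def)
    define e where "e = (x + 2 ^ w - y) mod 2 ^ w"
    define z where "z = (e + 2 ^ w - c) mod 2 ^ w"
    define c' where "c' = Bit_Operations.or (of_bool (x < y)) (of_bool (e < c) :: nat)"
    have word: "z + y + c = x + c' * 2 ^ w"
      using sub_word[OF xy e_def] by (simp add: z_def c'_def)
    have c': "c' \<le> 1"
      by (auto simp: c'_def)
    have mods: "(A + i + 1) mod 2 ^ w = A + (i + 1)" "(B + i + 1) mod 2 ^ w = B + (i + 1)"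
      "(DD + i + 1) mod 2 ^ w = DD + (i + 1)"
      using bnd \<open>i < n\<close> by auto
    have dec: "(n - i + 2 ^ w - 1) mod 2 ^ w = n - (i + 1)"
    proof -
      have "n - i + 2 ^ w - 1 = (n - (i + 1)) + 2 ^ w"
        using \<open>i < n\<close> by auto
      moreover have "n - (i + 1) < 2 ^ w" using bnd by auto
      ultimately show ?thesis by (simp only: mod_add_self2 mod_less)
    qed
    obtain R'' m'' where exb: "ex w sub_body (R', m') = (R'', m'')" by fastforce
    have m'': "m'' = m'(DD + i := z)"
      and R'': "R'' 20 = A + (i + 1)" "R'' 21 = B + (i + 1)" "R'' 22 = DD + (i + 1)"
      "R'' 23 = n - (i + 1)" "R'' 24 = 1" "R'' 25 = c'" "\<And>r. r \<notin> {20..29} \<Longrightarrow> R'' r = R' r"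
      using exb mods dec
      by (auto simp: sub_body_def i(2-6) mA mB x_y_c_def[symmetric] e_def[symmetric]
          z_def[symmetric] c'_def[symmetric] simp del: A_B_DD_n_def One_nat_def)
    have "val w m'' DD i = val w m' DD i"
      by (intro val_cong) (auto simp: m'')
    then have "val w m'' DD (i + 1) + val w m B (i + 1)
        = val w m' DD i + z * 2 ^ (w * i) + (val w m B i + y * 2 ^ (w * i))"
      by (simp add: val_Suc m'' x_y_c_def)
    also have "\<dots> = val w m A i + (z + y + c) * 2 ^ (w * i)"
      using i(10) by (simp add: algebra_simps x_y_c_def)
    also have "\<dots> = val w m A (i + 1) + c' * 2 ^ (w * (i + 1))"
      unfolding word by (simp add: val_Suc x_y_c_def algebra_simps power_add)
    finally have "I (R'', m'')"
      unfolding I_def using R'' c' i(8,9) \<open>i < n\<close> by (auto simp: m'' intro!: exI[of _ "i + 1"])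
    moreover have "R'' 23 < R' 23" using R''(4) i(5) \<open>i < n\<close> by simp
    ultimately show "I (ex w sub_body (R', m')) \<and> fst (ex w sub_body (R', m')) 23 < fst (R', m') 23"
      by (simp add: exb)
  qed (use w wf' in \<open>simp_all add: sub_body_def\<close>)
  show ?thesis
    unfolding sub_com_def
  proof (rule tr_Seq)
    show "tr w mc (Mov 20 a ;; Mov 21 b ;; Mov 22 d ;; Mov 23 l ;; Const 24 1 ;; Const 25 0) (R, m)
        6 (\<lambda>s'. I s' \<and> fst s' 23 = n)"
      by (rule tr_straight) (use w wf regs w1 in \<open>auto simp: I_def intro!: exI[of _ 0]\<close>)
  next
    fix s' assume s': "wf_state w s'" "I s' \<and> fst s' 23 = n"
    have "tr w mc (While 23 sub_body) s' (13 * n + 1) (\<lambda>s'. I s' \<and> fst s' 23 = 0)"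
      by (rule tr_While[where \<mu> = "\<lambda>s. fst s 23" and k = n, OF step]) (use s' in auto)
    then show "tr w mc (While 23 sub_body) s' (13 * n + 1) Q"
    proof (rule tr_weaken)
      fix s1 assume s1: "wf_state w s1" "I s1 \<and> fst s1 23 = 0"
      obtain R' m' where s1': "s1 = (R', m')" by fastforce
      from s1 s1' have *: "R' 25 \<le> 1" "\<And>r. r \<notin> {20..29} \<Longrightarrow> R' r = R r"
        "\<And>x. \<not> (DD \<le> x \<and> x < DD + n) \<Longrightarrow> m' x = m x"
        and v: "val w m' DD n + val w m B n = val w m A n + R' 25 * 2 ^ (w * n)"
        unfolding I_def by auto
      have lt: "val w m' DD n < 2 ^ (w * n)" "val w m B n < 2 ^ (w * n)"
        using wf s1 s1' by (auto intro!: val_less simp: wf_state_def)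
      have "R' 25 = of_bool (val w m A n < val w m B n)"
      proof (cases "R' 25 = 0")
        case True
        then show ?thesis using v by auto
      next
        case False
        then have "R' 25 = 1" using *(1) by simp
        then show ?thesis using v lt by simp
      qed
      with * v s1 show "Q s1"
        unfolding s1' by (intro Q) auto
    qed simp
  qed (use T in simp)
qed

section \<open>Geometric tails in floating-point arithmetic\<close>

text \<open>A pair \<open>(m, e)\<close> represents \<open>m * 2 ^ e\<close> with a mantissa of one word. The exact ratio of consecutive values
  would be \<open>1 - 4 / (4 * s + 3) = (4 * s - 1) / (4 * s + 3)\<close>, whose inverse lies strictly between
  \<open>1 + 1 / s\<close> and \<open>1 + 1 / s + 1 / (2 * s\<^sup>2)\<close>; the margins absorb the rounding.\<close>

definition fstep :: "nat \<Rightarrow> nat \<Rightarrow> nat \<times> nat \<Rightarrow> nat \<times> nat" where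
  "fstep w s = (\<lambda>(m, e).
     if 2 ^ (w - 2) \<le> m then (m - 4 * (m div (4 * s + 3)), e)
     else if e = 0 then (m, e)
     else (2 * m - 4 * (2 * m div (4 * s + 3)), e - 1))"

definition fval :: "nat \<times> nat \<Rightarrow> nat" where
  "fval = (\<lambda>(m, e). m * 2 ^ e)"

definition exhausted :: "nat \<Rightarrow> nat \<times> nat \<Rightarrow> bool" where
  "exhausted w = (\<lambda>(m, e). m < 2 ^ (w - 2) \<and> e = 0)"

lemma fstep_exhausted: "exhausted w p \<Longrightarrow> fstep w s p = p"
  by (auto simp: exhausted_def fstep_def)

lemma fstep_funpow_exhausted: "exhausted w p \<Longrightarrow> (fstep w s ^^ i) p = p"
  by (induction i) (auto simp: fstep_exhausted)

text \<open>The power \<open>s ^ 4\<close> makes the quotient of a mantissa by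
  \<open>4 * s + 3\<close> at least of order \<open>s ^ 3\<close>. Rounding then costs a relative
  error of order \<open>1 / s ^ 3\<close>, small against the slack of order \<open>1 / s ^ 2\<close>
  in the admissible ratios.\<close>

locale geom =
  fixes w s nw gw :: nat
  assumes s: "2 \<le> s" and big: "2 ^ 12 * s ^ 4 \<le> 2 ^ w"
begin

text \<open>\<open>nw\<close> and \<open>gw\<close> are the numbers of words of \<open>n\<close> and \<open>1 / \<gamma>\<close>. The summand \<open>W ^ (nw + 2) - W * i\<close> of the tail \<open>\<Gamma> i\<close> takes
  over where the geometric part can no longer be represented: it keeps all probability masses positive
  with ratios close to 1, at a cost in accuracy of less than \<open>\<gamma>\<close>. The start value \<open>m0\<close> leaves about
  \<open>m0 / s\<close> for the probability of the noise 0.\<close>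

definition "\<sigma> = 4 * s + 3"
definition "thr = (2::nat) ^ (w - 2)"
definition "W = (2::nat) ^ w"
definition "y0 = (W - 1) div (2 * s + 1)"
definition "m0 = s * y0"
text \<open>The distribution will have total weight \<open>W ^ \<mu>\<close> (before padding). This
  exponent exceeds that of the linear part, \<open>nw + 2\<close>, by \<open>gw + 1\<close>; the
  linear part thus has probability at most \<open>1 / W ^ (gw + 1)\<close> on each side, well below
  \<gamma>.\<close>

definition "\<mu> = nw + gw + 3"
definition "e0 = (\<mu> - 1) * w"
definition "fst0 i = (fstep w s ^^ i) (m0, e0)"
definition "v i = fval (fst0 i)"
definition "\<Gamma> i = v i + W ^ (nw + 2) - W * i"

lemma w: "16 \<le> w"
proof -
  have "(2::nat) ^ 12 * 2 ^ 4 \<le> 2 ^ 12 * s ^ 4"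
    using s by (intro mult_le_mono2 power_mono) auto
  with big have "(2::nat) ^ 16 \<le> 2 ^ w" by simp
  then show ?thesis
    by (rule power_le_imp_le_exp[rotated]) simp
qed

lemma W_thr: "W = 4 * thr"
proof -
  have "w = 2 + (w - 2)" using w by simp
  then have "W = 2 ^ (2 + (w - 2))"
    by (simp only: W_def)
  then show ?thesis by (simp add: thr_def power_add)
qed

lemma thr_big: "2 ^ 10 * s ^ 4 \<le> thr"
  using big W_thr by (simp add: W_def)

lemma \<sigma>_le: "\<sigma> \<le> 6 * s"
  using s by (simp add: \<sigma>_def)

lemma div_\<sigma>_big: "thr \<le> M \<Longrightarrow> 100 * s ^ 3 \<le> M div \<sigma>"
proof -
  assume M: "thr \<le> M"
  have "100 * s ^ 3 * \<sigma> \<le> 100 * s ^ 3 * (6 * s)"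
    by (intro mult_le_mono2 \<sigma>_le)
  also have "\<dots> \<le> 2 ^ 10 * s ^ 4" by (simp add: power4_eq_xxxx power3_eq_cube)
  finally show ?thesis
    using M thr_big by (simp add: less_eq_div_iff_mult_less_eq \<sigma>_def)
qed

lemma s_pows: "s \<le> s ^ 2" "2 * s \<le> s ^ 2" "2 * s ^ 2 \<le> s ^ 3" "4 * s \<le> s ^ 3" "8 \<le> s ^ 3"
proof -
  show "s \<le> s ^ 2" using s by (simp add: power2_eq_square)
  show 1: "2 * s ^ 2 \<le> s ^ 3" using s by (simp add: power2_eq_square power3_eq_cube)
  show "2 * s \<le> s ^ 2" using s by (simp add: power2_eq_square)
  then show "4 * s \<le> s ^ 3" using 1 by linarith
  then show "8 \<le> s ^ 3" using s by linarith
qed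

lemma \<sigma>_less_big: "\<sigma> \<le> 2 * s ^ 3"
  using s_pows \<sigma>_le by linarith

text \<open>The factor \<open>1 + 1 / s + 1 / (2 * s\<^sup>2)\<close> is at most \<open>exp (1 / s)\<close>.\<close>

definition rel :: "nat \<Rightarrow> nat \<Rightarrow> bool" where
  "rel a b \<longleftrightarrow> 2 * s ^ 2 * a \<le> (2 * s ^ 2 + 2 * s + 1) * b"

lemma rel_le: "a \<le> b \<Longrightarrow> rel a b"
  unfolding rel_def by (intro mult_le_mono) auto

lemma rel_mono: "rel a b \<Longrightarrow> a' \<le> a \<Longrightarrow> b \<le> b' \<Longrightarrow> rel a' b'"
  unfolding rel_def by (meson le_trans mult_le_mono2)

lemma rel_add: "rel a b \<Longrightarrow> rel a' b' \<Longrightarrow> rel (a + a') (b + b')"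
  unfolding rel_def by (simp add: algebra_simps)

lemma rel_mult: "rel a b \<Longrightarrow> rel (a * c) (b * c)"
  unfolding rel_def using mult_le_mono1[of _ _ c] by (metis mult.assoc)

text \<open>A step subtracts at most half of a mantissa that is at least \<open>thr\<close>, so
  \<open>thr / 2\<close> is the lower bound that persists. The upper bound is half the word range,
  so a mantissa can be doubled without overflow.\<close>

definition normal :: "nat \<times> nat \<Rightarrow> bool" where
  "normal = (\<lambda>(m, e). thr \<le> 2 * m \<and> m < 2 * thr)"

text \<open>Both moving branches of \<open>fstep\<close> take one form here: a mantissa
  \<open>M\<close> in \<open>[thr, 2 * thr)\<close> that represents the same value, doubled
  beforehand where necessary. Later estimates need only this form.\<close>

lemma step_cases:
  assumes "normal p"
  obtains (exh) "exhausted w p" "fstep w s p = p" "fval p < thr"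
  | (step) M E where "\<not> exhausted w p" "thr \<le> M" "M < 2 * thr" "fval p = M * 2 ^ E"
      "fstep w s p = (M - 4 * (M div \<sigma>), E)"
      "thr \<le> fst p \<and> M = fst p \<and> E = snd p \<or> fst p < thr \<and> M = 2 * fst p \<and> snd p = Suc E"
proof -
  obtain m e where p: "p = (m, e)" by fastforce
  have m: "thr \<le> 2 * m" "m < 2 * thr" using assms by (auto simp: normal_def p)
  show thesis
  proof (cases "thr \<le> m")
    case True
    then show thesis using m step[of m e]
      by (auto simp: p exhausted_def fstep_def fval_def thr_def[symmetric] \<sigma>_def[symmetric])
  next
    case False
    show thesis
    proof (cases e)
      case 0
      then show thesis using False exh
        by (auto simp: p exhausted_def fstep_def fval_def thr_def[symmetric])
    next
      case (Suc E)
      then show thesis using False m step[of "2 * m" E]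
        by (auto simp: p exhausted_def fstep_def fval_def thr_def[symmetric] \<sigma>_def[symmetric])
    qed
  qed
qed

lemma \<sigma>_div_le: "\<sigma> * (M div \<sigma>) \<le> M"
  by simp

lemma \<sigma>_div_gt: "M < \<sigma> * (M div \<sigma>) + \<sigma>"
  using dividend_less_div_times[of \<sigma> M] by (simp add: \<sigma>_def algebra_simps)

lemma sub_half: "8 * (M div \<sigma>) \<le> M"
proof -
  have "8 * (M div \<sigma>) \<le> \<sigma> * (M div \<sigma>)"
    using s by (intro mult_le_mono1) (simp add: \<sigma>_def)
  then show ?thesis using \<sigma>_div_le le_trans by blast
qed

lemma normal_fstep: "normal p \<Longrightarrow> normal (fstep w s p)"
proof -
  assume p: "normal p"
  then show ?thesis
  proof (cases rule: step_cases)
    case (step M E)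
    then show ?thesis using sub_half[of M] by (auto simp: normal_def)
  qed (use p in auto)
qed

lemma y0_le: "(2 * s + 1) * y0 \<le> W - 1"
  unfolding y0_def by (rule times_div_less_eq_dividend)

lemma W_pos: "W > 0" by (simp add: W_def)

lemma y0_gt: "W \<le> (2 * s + 1) * y0 + (2 * s + 1)"
proof -
  have "W - 1 < (2 * s + 1) * y0 + (2 * s + 1)"
    using dividend_less_div_times[of "2 * s + 1" "W - 1"] by (simp add: y0_def algebra_simps)
  then show ?thesis by simp
qed

lemma y0_big: "1000 * s ^ 3 \<le> y0"
proof -
  have "1000 * s ^ 3 * (2 * s + 1) \<le> 1000 * s ^ 3 * (3 * s)"
    using s by (intro mult_le_mono2) simp
  also have "\<dots> = 3000 * s ^ 4" by (simp add: power4_eq_xxxx power3_eq_cube)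
  also have "\<dots> \<le> W - 1"
  proof -
    have "s ^ 4 > 0" "4096 * s ^ 4 \<le> W" using s big by (simp_all add: W_def)
    then show ?thesis by linarith
  qed
  finally show ?thesis
    unfolding y0_def by (simp add: less_eq_div_iff_mult_less_eq)
qed

text \<open>The word range is divided into \<open>2 * s + 1\<close> shares of size
  \<open>y0\<close>: \<open>s\<close> shares for either direction and one for the noise 0, with a
  remainder of at most \<open>2 * s + 1\<close>.\<close>

lemma m0: "thr \<le> m0" "m0 < 2 * thr" "2 * m0 + y0 < W" "W \<le> 2 * m0 + y0 + 2 * s + 1"
proof -
  show 1: "2 * m0 + y0 < W" "W \<le> 2 * m0 + y0 + 2 * s + 1"
    using y0_le y0_gt W_pos by (auto simp: m0_def algebra_simps)
  then show "m0 < 2 * thr" using W_thr by linarith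
  have "2 * y0 \<le> m0" unfolding m0_def using s by (rule mult_le_mono1)
  moreover have "2 * s + 1 \<le> y0" using y0_big s_pows by linarith
  ultimately show "thr \<le> m0" using 1 W_thr by linarith
qed

lemma normal_fst0: "normal (fst0 i)"
proof (induction i)
  case 0
  then show ?case using m0 by (auto simp: fst0_def normal_def)
qed (simp add: fst0_def normal_fstep)

lemma fst0_Suc: "fst0 (Suc i) = fstep w s (fst0 i)"
  by (simp add: fst0_def)

lemma v_cases:
  obtains (exh) "exhausted w (fst0 i)" "v i < thr" "fst0 (Suc i) = fst0 i" "v (Suc i) = v i"
  | (step) M E where "thr \<le> M" "M < 2 * thr" "v i = M * 2 ^ E"
    "v (Suc i) = (M - 4 * (M div \<sigma>)) * 2 ^ E" "fst0 (Suc i) = (M - 4 * (M div \<sigma>), E)"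
  using normal_fst0[of i]
proof (cases rule: step_cases)
  case exh
  then show thesis using that(1) by (simp add: v_def fst0_Suc)
next
  case (step M E)
  then show thesis using that(2)[of M E] by (simp add: v_def fst0_Suc) (simp add: fval_def)
qed

lemma v_antimono: "v (Suc i) \<le> v i"
  by (cases rule: v_cases[of i]) auto

text \<open>Because \<open>\<sigma> + 1 = 4 * (s + 1)\<close>, the unrounded decrement
  \<open>4 * M / \<sigma>\<close> exceeds \<open>M / (s + 1)\<close>. After clearing denominators
  the surplus is \<open>M\<close>, which pays for the rounding loss of at most
  \<open>4 * (s + 1) * \<sigma>\<close>.\<close>

lemma v_decay: "v (Suc i) * (s + 1) \<le> s * v i \<or> exhausted w (fst0 i)"
proof (cases rule: v_cases[of i])
  case (step M E)
  define x where "x = M div \<sigma>"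
  have "(s + 1) * \<sigma> * 4 \<le> M"
  proof -
    have "(s + 1) * \<sigma> * 4 \<le> (2 * s) * (6 * s) * 4"
      using s \<sigma>_le by (intro mult_le_mono) auto
    also have "\<dots> = 48 * s ^ 2" by (simp add: power2_eq_square)
    also have "\<dots> \<le> 2 ^ 10 * s ^ 4"
      using s by (auto intro!: mult_le_mono power_increasing)
    finally show ?thesis using thr_big step(1) by linarith
  qed
  moreover have "M < \<sigma> * x + \<sigma>"
    unfolding x_def by (rule \<sigma>_div_gt)
  then have "M * ((s + 1) * 4) \<le> (\<sigma> * x + \<sigma>) * ((s + 1) * 4)"
    by (intro mult_le_mono1) simp
  ultimately have "M * ((s + 1) * 4) \<le> \<sigma> * (x * (s + 1) * 4) + M"
    by (simp add: algebra_simps)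
  then have "M * \<sigma> \<le> \<sigma> * (x * (s + 1) * 4)"
    by (simp add: \<sigma>_def algebra_simps)
  then have "M \<le> x * (s + 1) * 4"
    by (simp add: \<sigma>_def)
  then have "(M - 4 * x) * (s + 1) \<le> s * M"
    using sub_half[of M] by (simp add: x_def algebra_simps diff_mult_distrib)
  then have "(M - 4 * x) * (s + 1) * 2 ^ E \<le> s * M * 2 ^ E"
    by (rule mult_le_mono1)
  then have "v (Suc i) * (s + 1) \<le> s * v i"
    unfolding step x_def[symmetric] by (simp only: mult_ac)
  then show ?thesis ..
qed auto

lemma exh_v: "exhausted w (fst0 i) \<Longrightarrow> v i < thr"
  by (auto simp: exhausted_def v_def fval_def thr_def)

text \<open>The decay holds until exhaustion, and from then on the value stays below
  \<open>thr\<close>; the additive \<open>thr\<close> covers that phase.\<close>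

lemma v_le_geometric: "real (v i) \<le> (s / (s + 1)) ^ i * v 0 + thr"
proof (induction i)
  case (Suc i)
  show ?case
  proof (cases rule: v_cases[of i])
    case exh
    then have "v (Suc i) < thr" by simp
    moreover have "0 \<le> (s / (s + 1)) ^ Suc i * v 0" by simp
    ultimately show ?thesis by linarith
  next
    case (step M E)
    have "\<not> exhausted w (fst0 i) \<or> v (Suc i) < thr"
      using exh_v[of i] v_antimono[of i] by linarith
    then show ?thesis
    proof
      assume "\<not> exhausted w (fst0 i)"
      then have "real (v (Suc i) * (s + 1)) \<le> real (s * v i)"
        using v_decay by (metis of_nat_le_iff)
      then have "real (v (Suc i)) \<le> s / (s + 1) * v i"
        by (simp add: field_simps)
      also have "\<dots> \<le> s / (s + 1) * ((s / (s + 1)) ^ i * v 0 + thr)"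
        by (intro mult_left_mono Suc) auto
      also have "\<dots> = (s / (s + 1)) ^ Suc i * v 0 + s / (s + 1) * thr"
        by (simp add: algebra_simps)
      also have "s / (s + 1) * thr \<le> 1 * real thr"
        by (rule mult_right_mono) auto
      finally show ?thesis by simp
    next
      assume "v (Suc i) < thr"
      moreover have "0 \<le> (s / (s + 1)) ^ Suc i * v 0" by simp
      ultimately show ?thesis by linarith
    qed
  qed
qed simp

text \<open>Rounding is harmless in this direction, since a smaller decrement brings consecutive
  values closer. What remains is
  \<open>(2 * s^2 + 2 * s + 1) * 4 <= (2 * s + 1) * \<sigma>\<close>.\<close>

lemma rel_v: "rel (v i) (v (Suc i))"
proof (cases rule: v_cases[of i])
  case exh
  then show ?thesis by (simp add: rel_le)
next
  case (step M E)
  define x where "x = M div \<sigma>"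
  have x: "\<sigma> * x \<le> M" "4 * x \<le> M"
    using \<sigma>_div_le sub_half[of M] by (auto simp: x_def)
  have "2 * s\<^sup>2 * M + (2 * s\<^sup>2 + 2 * s + 1) * (4 * x) \<le> (2 * s\<^sup>2 + 2 * s + 1) * M"
  proof -
    have "(2 * s\<^sup>2 + 2 * s + 1) * (4 * x) \<le> (2 * s + 1) * (\<sigma> * x)"
    proof -
      have "(2 * s\<^sup>2 + 2 * s + 1) * 4 \<le> (2 * s + 1) * \<sigma>"
        using s by (simp add: \<sigma>_def algebra_simps power2_eq_square)
      then have "(2 * s\<^sup>2 + 2 * s + 1) * 4 * x \<le> (2 * s + 1) * \<sigma> * x"
        by (rule mult_le_mono1)
      then show ?thesis by (simp only: mult.assoc)
    qed
    also have "\<dots> \<le> (2 * s + 1) * M" using x by (intro mult_le_mono2)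
    finally show ?thesis by (simp add: algebra_simps)
  qed
  then have "rel M (M - 4 * x)"
    using x by (simp add: rel_def diff_mult_distrib2)
  then show ?thesis
    unfolding step x_def[symmetric] by (rule rel_mult)
qed

section \<open>Ratios of neighbouring masses\<close>

definition "dec i = v i - v (Suc i)"

text \<open>The next quotient \<open>x'\<close> satisfies
  \<open>\<sigma> * x' > \<sigma> * x - 4 * x - \<sigma>\<close>. Without the rounding term the
  claim holds with a slack of \<open>(2 * s - 1) * x\<close>, and \<open>x\<close> is large enough
  for this to cover the rounding term multiplied by \<open>2 * s^2 + 2 * s + 1\<close>.\<close>

lemma dec_rel_aux:
  assumes "thr \<le> M"
  shows "rel (M div \<sigma>) ((M - 4 * (M div \<sigma>)) div \<sigma>)"
proof -
  define x x' where "x = M div \<sigma>" and "x' = (M - 4 * x) div \<sigma>"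
  have "M - 4 * x < \<sigma> * x' + \<sigma>"
    unfolding x'_def by (rule \<sigma>_div_gt)
  moreover have "\<sigma> * x \<le> M"
    unfolding x_def by (rule \<sigma>_div_le)
  moreover have "4 * x \<le> \<sigma> * x"
    using s by (intro mult_le_mono1) (simp add: \<sigma>_def)
  ultimately have "\<sigma> * x \<le> \<sigma> * x' + \<sigma> + 4 * x"
    by linarith
  then have "int \<sigma> * x - \<sigma> - 4 * x \<le> int \<sigma> * x'"
    by (smt (verit) of_nat_add of_nat_le_iff of_nat_mult of_nat_numeral)
  then have 1: "(2 * int s ^ 2 + 2 * s + 1) * (int \<sigma> * x - \<sigma> - 4 * x) \<le>
      (2 * int s ^ 2 + 2 * s + 1) * (int \<sigma> * x')"
    by (intro mult_left_mono) auto
  have "(2 * s ^ 2 + 2 * s + 1) * \<sigma> \<le> (4 * s ^ 2) * (6 * s)"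
    using s_pows s \<sigma>_le by (intro mult_le_mono) auto
  also have "\<dots> \<le> 100 * s ^ 3" by (simp add: power2_eq_square power3_eq_cube)
  also have "\<dots> \<le> x"
    using div_\<sigma>_big assms by (simp add: x_def)
  also have "\<dots> \<le> (2 * s - 1) * x"
  proof -
    have "1 \<le> 2 * s - 1" using s by linarith
    from mult_le_mono1[OF this, of x] show ?thesis by (simp only: mult_1)
  qed
  finally have "int ((2 * s ^ 2 + 2 * s + 1) * \<sigma>) \<le> int ((2 * s - 1) * x)"
    by (simp only: of_nat_le_iff)
  then have "(2 * int s ^ 2 + 2 * s + 1) * \<sigma> \<le> (2 * int s - 1) * x"
    using s by (simp add: of_nat_diff algebra_simps)
  then have "2 * int s ^ 2 * int \<sigma> * x \<le> (2 * int s ^ 2 + 2 * s + 1) * (int \<sigma> * x - \<sigma> - 4 * x)"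
    by (simp add: \<sigma>_def algebra_simps power2_eq_square)
  with 1 have "int \<sigma> * (2 * int s ^ 2 * x) \<le> int \<sigma> * ((2 * int s ^ 2 + 2 * s + 1) * x')"
    by (simp add: algebra_simps)
  then have "2 * int s ^ 2 * x \<le> (2 * int s ^ 2 + 2 * s + 1) * x'"
    by (subst (asm) mult_le_cancel_left_pos) (auto simp: \<sigma>_def)
  then have "int (2 * s ^ 2 * x) \<le> int ((2 * s ^ 2 + 2 * s + 1) * x')"
    by (simp add: algebra_simps)
  then show ?thesis
    unfolding rel_def x_def[symmetric] x'_def[symmetric] by (simp only: of_nat_le_iff)
qed

text \<open>Decrements never grow, so only their shrinking needs a bound. When exhaustion follows,
  the decrement drops to 0 from less than \<open>2 * W / \<sigma>\<close>, and the slope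
  \<open>W\<close> of the linear part absorbs the drop. Otherwise \<open>dec_rel_aux\<close>
  applies; doubling the mantissa only refines the rounding of the next quotient.\<close>

lemma dec_rel: "rel (dec i + W) (dec (Suc i) + W)" "rel (dec (Suc i) + W) (dec i + W)"
proof -
  have "rel (dec i + W) (dec (Suc i) + W) \<and> dec (Suc i) \<le> dec i"
  proof (cases rule: v_cases[of i])
    case exh
    then have "dec (Suc i) = 0" "dec i = 0"
      by (auto simp: dec_def v_def fst0_Suc)
    then show ?thesis by (simp add: rel_le)
  next
    case (step M E)
    define x where "x = M div \<sigma>"
    define M' where "M' = M - 4 * x"
    have x: "\<sigma> * x \<le> M" "8 * x \<le> M" "M < \<sigma> * x + \<sigma>"
      using \<sigma>_div_le sub_half[of M] \<sigma>_div_gt[of M] by (auto simp: x_def)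
    have dec: "dec i = 4 * x * 2 ^ E"
      using x(2) by (simp add: dec_def step x_def[symmetric] diff_mult_distrib)
    have relx: "rel x (M' div \<sigma>)"
      unfolding x_def M'_def using step(1) by (rule dec_rel_aux)
    have nxt: "fst0 (Suc i) = (M', E)"
      using step by (simp add: M'_def x_def)
    show ?thesis
      using normal_fst0[of "Suc i"]
    proof (cases rule: step_cases)
      case exh
      then have dec': "dec (Suc i) = 0" and E: "E = 0"
        using nxt by (auto simp: dec_def v_def fst0_Suc[of "Suc i"] exhausted_def)
      have "\<sigma> * (2 * s\<^sup>2 * (4 * x)) \<le> 2 * s\<^sup>2 * 4 * M"
        using mult_le_mono2[OF x(1), of "2 * s\<^sup>2 * 4"] by (simp add: algebra_simps)
      also have "\<dots> \<le> 2 * s\<^sup>2 * 4 * (2 * thr)"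
        using step(2) by (intro mult_le_mono2) simp
      also have "\<dots> = (4 * s\<^sup>2) * W" by (simp add: W_thr)
      also have "\<dots> \<le> (\<sigma> * (2 * s + 1)) * W"
        by (intro mult_le_mono1) (simp add: \<sigma>_def algebra_simps power2_eq_square)
      finally have "\<sigma> * (2 * s\<^sup>2 * (4 * x)) \<le> \<sigma> * ((2 * s + 1) * W)"
        by (simp only: mult.assoc)
      then have "2 * s\<^sup>2 * (4 * x) \<le> (2 * s + 1) * W"
        by (subst (asm) nat_mult_le_cancel1) (simp_all add: \<sigma>_def)
      then show ?thesis
        unfolding dec dec' E rel_def by (simp add: algebra_simps)
    next
      case step2: (step N F)
      define z where "z = N div \<sigma>"
      have z: "8 * z \<le> N" "\<sigma> * z \<le> N"
        using sub_half[of N] \<sigma>_div_le by (auto simp: z_def)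
      have vS: "v (Suc i) = N * 2 ^ F"
        using step2 by (simp add: v_def)
      have "v (Suc (Suc i)) = (N - 4 * z) * 2 ^ F"
        using step2 by (simp add: v_def fst0_Suc[of "Suc i"] z_def fval_def)
      then have dec': "dec (Suc i) = 4 * z * 2 ^ F"
        using z vS by (simp add: dec_def diff_mult_distrib)
      have "M' div \<sigma> * 2 ^ E \<le> z * 2 ^ F \<and> z * 2 ^ F \<le> x * 2 ^ E"
        using step2(6) unfolding nxt
      proof
        assume *: "thr \<le> fst (M', E) \<and> N = fst (M', E) \<and> F = snd (M', E)"
        then have "z = M' div \<sigma>" "F = E" by (auto simp: z_def)
        moreover have "M' div \<sigma> \<le> x"
          by (simp add: M'_def x_def div_le_mono)
        ultimately show ?thesis by simp
      next
        assume "fst (M', E) < thr \<and> N = 2 * fst (M', E) \<and> snd (M', E) = Suc F"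
        then have N: "N = 2 * M'" and E: "E = Suc F" by auto
        have "\<sigma> * (2 * (M' div \<sigma>)) \<le> N"
          using mult_le_mono2[OF \<sigma>_div_le[of M'], of 2] unfolding N by (simp only: mult.left_commute)
        then have "2 * (M' div \<sigma>) \<le> z"
          unfolding z_def by (simp add: less_eq_div_iff_mult_less_eq \<sigma>_def mult.commute)
        \<comment> \<open>The subtraction of \<open>4 * x\<close> from the mantissa outweighs the
          rounding error, which keeps \<open>z\<close> below \<open>2 * x + 1\<close>.\<close>
        moreover have "\<sigma> \<le> x"
          using div_\<sigma>_big[OF step(1)] \<sigma>_less_big by (simp add: x_def)
        then have "\<sigma> * z < \<sigma> * (2 * x + 1)"
          using z(2) x(2,3) unfolding N M'_def by simp
        then have "z \<le> 2 * x"
          unfolding mult_less_cancel1 by linarith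
        ultimately show ?thesis
          unfolding E by simp
      qed
      then have "dec (Suc i) \<le> dec i" "4 * (M' div \<sigma>) * 2 ^ E \<le> dec (Suc i)"
        unfolding dec dec' by auto
      moreover have "rel (dec i) (4 * (M' div \<sigma>) * 2 ^ E)"
        using rel_mult[OF relx, of "4 * 2 ^ E"] unfolding dec by (simp add: mult_ac)
      ultimately show ?thesis
        by (meson le_refl rel_add rel_le rel_mono)
    qed
  qed
  then show "rel (dec i + W) (dec (Suc i) + W)" "rel (dec (Suc i) + W) (dec i + W)"
    by (auto intro: rel_le)
qed

section \<open>The combined tail: ratios, values at noise 0, accuracy\<close>

lemma v0: "v 0 = m0 * 2 ^ e0"
  by (simp add: v_def fst0_def fval_def)

lemma W_power: "W ^ k = 2 ^ (w * k)"
  by (simp add: W_def power_mult)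

lemma pow_e0: "2 ^ e0 = W ^ (\<mu> - 1)"
  by (simp add: W_power e0_def mult.commute)

lemma W_pow_\<mu>: "W ^ \<mu> = W * 2 ^ e0"
proof -
  have "\<mu> = Suc (\<mu> - 1)" by (simp add: \<mu>_def)
  then show ?thesis
    unfolding pow_e0 by (metis power_Suc)
qed

lemma W_pow_le: "i \<le> j \<Longrightarrow> W ^ i \<le> W ^ j"
  using W_pos by (intro power_increasing) auto

text \<open>All arguments of \<open>nw\<close> words are covered, beyond those below
  \<open>n\<close>, because the binary search probes them as well. In this range the subtraction of
  \<open>W * i\<close> is not truncated.\<close>

lemma \<Gamma>_Suc:
  assumes "Suc i < W ^ nw"
  shows "\<Gamma> i = \<Gamma> (Suc i) + (dec i + W)"
proof -
  have "W * Suc i \<le> W ^ (nw + 2)"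
  proof -
    have "W * Suc i \<le> W * W ^ nw" using assms by (intro mult_le_mono2) simp
    also have "\<dots> = W ^ (nw + 1)" by simp
    also have "\<dots> \<le> W ^ (nw + 2)" by (intro W_pow_le) simp
    finally show ?thesis .
  qed
  moreover have "v i = v (Suc i) + dec i"
    using v_antimono by (simp add: dec_def)
  ultimately show ?thesis
    by (simp add: \<Gamma>_def)
qed

text \<open>The linear part stays at least \<open>s * W\<close>, so a step of size \<open>W\<close>
  changes it by a factor of at most 1 + 1/s.\<close>

lemma \<Gamma>_pos: "i < W ^ nw \<Longrightarrow> v i + s * W \<le> \<Gamma> i"
proof -
  assume i: "i < W ^ nw"
  have "s * W + W * i \<le> W * (s + W ^ nw)"
    using i by (simp add: algebra_simps)
  also have "\<dots> \<le> W * (W * W ^ nw)"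
  proof (intro mult_le_mono2)
    have "s * 2 \<le> W" using thr_big s_pows W_thr s big power_increasing[of 1 4 s] by (simp add: W_def)
    moreover have "W ^ nw \<ge> 1" using W_pos by simp
    ultimately have "s * W ^ nw + W ^ nw \<le> W * W ^ nw"
      using s mult_le_mono1[of "s + 1" W "W ^ nw"] by (simp add: algebra_simps)
    moreover have "s \<le> s * W ^ nw" using \<open>W ^ nw \<ge> 1\<close> by simp
    ultimately show "s + W ^ nw \<le> W * W ^ nw" by linarith
  qed
  finally show ?thesis by (simp add: \<Gamma>_def)
qed

lemma rel_\<Gamma>: "Suc i < W ^ nw \<Longrightarrow> rel (\<Gamma> i) (\<Gamma> (Suc i))"
proof -
  assume i: "Suc i < W ^ nw"
  define b where "b = \<Gamma> (Suc i) - v (Suc i)"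
  have b: "\<Gamma> (Suc i) = v (Suc i) + b" "s * W \<le> b"
    using \<Gamma>_pos[OF i] by (auto simp: b_def)
  have "\<Gamma> i = v i + (b + W)"
    using \<Gamma>_Suc[OF i] b v_antimono[of i] by (simp add: dec_def)
  moreover have "rel (b + W) b"
  proof -
    have "2 * s * (s * W) \<le> 2 * s * b" using b(2) by (rule mult_le_mono2)
    moreover have "2 * s ^ 2 * (b + W) = 2 * s ^ 2 * b + 2 * s * (s * W)"
      "(2 * s ^ 2 + 2 * s + 1) * b = 2 * s ^ 2 * b + 2 * s * b + b"
      by (simp_all add: algebra_simps power2_eq_square)
    ultimately show ?thesis unfolding rel_def by linarith
  qed
  ultimately show ?thesis
    unfolding b by (auto intro: rel_add rel_v)
qed

lemma \<Gamma>_antimono: "i \<le> j \<Longrightarrow> j < W ^ nw \<Longrightarrow> \<Gamma> j \<le> \<Gamma> i"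
proof (induction j rule: dec_induct)
  case (step j)
  then show ?case using \<Gamma>_Suc[of j] by simp
qed simp

lemma \<Gamma>0: "\<Gamma> 0 = v 0 + W ^ (nw + 2)" "W ^ (nw + 2) \<le> 2 ^ e0"
  unfolding pow_e0 by (auto simp: \<Gamma>_def \<mu>_def simp del: power_Suc intro!: W_pow_le)

text \<open>These are the comparisons at noise 0: \<open>tail 0\<close> with \<open>tail 1\<close>,
  and \<open>mass 0\<close> with \<open>mass 1\<close>. In units of \<open>y0 * 2 ^ e0\<close> the
  tails are about s + 1 and s, with ratio 1 + 1/s. The masses are about 1 and 4s/(4s+3), with ratio
  1 + 3/(4s). The size of \<open>y0\<close> covers the lower-order terms.\<close>

lemma \<Gamma>0_half: "2 * \<Gamma> 0 \<le> W ^ \<mu>"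
  and rel_init: "rel (W ^ \<mu> - \<Gamma> 0) (\<Gamma> 0)" "rel (\<Gamma> 0) (W ^ \<mu> - \<Gamma> 0)"
  and rel_init': "rel (W ^ \<mu> - 2 * \<Gamma> 0) (dec 0 + W)" "rel (dec 0 + W) (W ^ \<mu> - 2 * \<Gamma> 0)"
proof -
  define Z where "Z = (2::nat) ^ e0"
  have Z: "Z > 0" "W ^ \<mu> = W * Z" "v 0 = m0 * Z" "\<Gamma> 0 = m0 * Z + W ^ (nw + 2)" "W ^ (nw + 2) \<le> Z"
    using \<Gamma>0 by (auto simp: Z_def W_pow_\<mu> v0)
  have y0: "2 \<le> y0" "2 * s + 1 \<le> y0" "\<sigma> \<le> y0"
    using y0_big s_pows \<sigma>_less_big by linarith+
  have W: "2 * m0 + y0 + 1 \<le> W" using m0 by simp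
  have 1: "2 * (m0 * Z) + (y0 + 1) * Z \<le> W ^ \<mu>"
    using mult_le_mono1[OF W, of Z] by (simp add: Z algebra_simps)
  have y0Z: "2 * Z \<le> y0 * Z" using y0 by simp
  show half: "2 * \<Gamma> 0 \<le> W ^ \<mu>"
    using 1 Z(5) y0Z unfolding Z(4) add_mult_distrib add_mult_distrib2 by linarith
  then show "rel (\<Gamma> 0) (W ^ \<mu> - \<Gamma> 0)"
    by (intro rel_le) simp
  have "rel (W - m0) m0"
  proof -
    have "2 * s ^ 2 * W \<le> 2 * s ^ 2 * (2 * m0 + y0 + 2 * s + 1)"
      by (intro mult_le_mono2 m0)
    also have "\<dots> \<le> 2 * s ^ 2 * m0 + (2 * s ^ 2 + 2 * s + 1) * m0"
    proof -
      have "4 * s ^ 3 + 2 * s ^ 2 \<le> 1000 * s ^ 3"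
        using s_pows by linarith
      also have "\<dots> \<le> m0"
        using y0_big s by (simp add: m0_def le_trans[OF y0_big])
      finally show ?thesis
        by (simp add: m0_def algebra_simps power2_eq_square power3_eq_cube)
    qed
    finally show ?thesis
      by (simp add: rel_def diff_mult_distrib2)
  qed
  then have "rel ((W - m0) * Z) (m0 * Z)" by (rule rel_mult)
  then show "rel (W ^ \<mu> - \<Gamma> 0) (\<Gamma> 0)"
    by (rule rel_mono) (simp_all add: Z diff_mult_distrib)
  define x where "x = m0 div \<sigma>"
  have x: "\<sigma> * x \<le> m0" "m0 < \<sigma> * x + \<sigma>" "8 * x \<le> m0"
    using \<sigma>_div_le \<sigma>_div_gt[of m0] sub_half[of m0] by (auto simp: x_def)
  have "fstep w s (m0, e0) = (m0 - 4 * x, e0)"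
    using m0 by (simp add: fstep_def x_def thr_def \<sigma>_def)
  then have "v 1 = (m0 - 4 * x) * Z"
    by (simp add: v_def fst0_def fval_def Z_def)
  then have dec: "dec 0 = 4 * x * Z"
    using x by (simp add: dec_def Z diff_mult_distrib)
  have "rel (y0 + 2 * s + 1) (4 * x)"
  proof -
    have "2 * s\<^sup>2 * \<sigma> * (2 * s + 1) + (2 * s\<^sup>2 + 2 * s + 1) * (4 * \<sigma>) \<le> 1000 * s ^ 3 * s"
    proof -
      have "2 * s\<^sup>2 * \<sigma> * (2 * s + 1) \<le> 2 * s\<^sup>2 * (6 * s) * (3 * s)"
        using s \<sigma>_le by (intro mult_le_mono) auto
      moreover have "(2 * s\<^sup>2 + 2 * s + 1) * (4 * \<sigma>) \<le> (4 * s\<^sup>2) * (4 * (6 * s))"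
        using s s_pows \<sigma>_le by (intro mult_le_mono) auto
      moreover have "s ^ 3 \<le> s ^ 4"
        using s by (intro power_increasing) auto
      moreover have "2 * s\<^sup>2 * (6 * s) * (3 * s) = 36 * s ^ 4"
        "(4 * s\<^sup>2) * (4 * (6 * s)) = 96 * s ^ 3" "1000 * s ^ 3 * s = 1000 * s ^ 4"
        by (simp_all add: power2_eq_square power3_eq_cube power4_eq_xxxx)
      ultimately show ?thesis by linarith
    qed
    also have "\<dots> \<le> y0 * (2 * s\<^sup>2 + 4 * s)"
      using y0_big by (intro mult_le_mono) auto
    finally have 2: "2 * s\<^sup>2 * \<sigma> * (2 * s + 1) + (2 * s\<^sup>2 + 2 * s + 1) * (4 * \<sigma>) \<le> y0 * (2 * s\<^sup>2 + 4 * s)" .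
    have "(2 * s\<^sup>2 + 2 * s + 1) * (4 * m0) \<le> (2 * s\<^sup>2 + 2 * s + 1) * (4 * (\<sigma> * x + \<sigma>))"
      using x by (intro mult_le_mono2) simp
    moreover have "(2 * s\<^sup>2 + 2 * s + 1) * (4 * m0) = 2 * s\<^sup>2 * \<sigma> * y0 + y0 * (2 * s\<^sup>2 + 4 * s)"
      by (simp add: m0_def \<sigma>_def algebra_simps power2_eq_square)
    ultimately have "2 * s\<^sup>2 * \<sigma> * y0 + 2 * s\<^sup>2 * \<sigma> * (2 * s + 1) + (2 * s\<^sup>2 + 2 * s + 1) * (4 * \<sigma>)
        \<le> (2 * s\<^sup>2 + 2 * s + 1) * (4 * (\<sigma> * x)) + (2 * s\<^sup>2 + 2 * s + 1) * (4 * \<sigma>)"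
      using 2 by (simp add: add_mult_distrib2)
    then have "\<sigma> * (2 * s\<^sup>2 * (y0 + 2 * s + 1)) \<le> \<sigma> * ((2 * s\<^sup>2 + 2 * s + 1) * (4 * x))"
      by (simp add: algebra_simps)
    then show ?thesis
      unfolding rel_def by (subst (asm) nat_mult_le_cancel1) (simp_all add: \<sigma>_def)
  qed
  then have "rel ((y0 + 2 * s + 1) * Z) (dec 0)"
    unfolding dec by (rule rel_mult)
  moreover have "W ^ \<mu> - 2 * \<Gamma> 0 \<le> (y0 + 2 * s + 1) * Z"
    using mult_le_mono1[OF m0(4), of Z] by (simp add: Z algebra_simps)
  ultimately show "rel (W ^ \<mu> - 2 * \<Gamma> 0) (dec 0 + W)"
    by (rule rel_mono[of _ _ _ "dec 0 + W"]) simp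
  have "4 * x + 2 \<le> y0"
  proof -
    have "\<sigma> * (4 * x + 2) \<le> 4 * m0 + 2 * \<sigma>"
      using x(1) by simp
    also have "\<dots> \<le> \<sigma> * y0"
      using y0(3) y0 by (simp add: \<sigma>_def m0_def algebra_simps)
    finally show ?thesis
      by (subst (asm) nat_mult_le_cancel1) (simp_all add: \<sigma>_def)
  qed
  then have "(4 * x + 2) * Z \<le> y0 * Z" by (rule mult_le_mono1)
  moreover have "W \<le> Z"
    using le_trans[OF W_pow_le[of 1 "nw + 2"] Z(5)] unfolding power_one_right by simp
  ultimately have "dec 0 + W \<le> W ^ \<mu> - 2 * \<Gamma> 0"
    using 1 Z(5) unfolding dec Z(4) by (simp add: algebra_simps)
  then show "rel (dec 0 + W) (W ^ \<mu> - 2 * \<Gamma> 0)"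
    by (rule rel_le)
qed

text \<open>The geometric term comes from \<open>2 * v 0 <= W ^ \<mu>\<close>. The linear part and
  the residue \<open>thr\<close> left by the exhausted recursion together fit into the share
  \<open>1 / gd\<close>, that is \<gamma>.\<close>

lemma \<Gamma>_tail:
  assumes "gd < W ^ gw" "0 < gd"
  shows "2 * real (\<Gamma> i) \<le> (1 / real gd + (s / (s + 1)) ^ i) * W ^ \<mu>"
proof -
  have "2 * m0 \<le> W" using m0 by simp
  then have "2 * v 0 \<le> W ^ \<mu>"
    unfolding v0 W_pow_\<mu> using mult_le_mono1[of "2 * m0" W "2 ^ e0"] by simp
  then have "real (2 * v 0) \<le> real (W ^ \<mu>)"
    by (simp only: of_nat_le_iff)
  then have 1: "(s / (s + 1)) ^ i * (2 * v 0) \<le> (s / (s + 1)) ^ i * real (W ^ \<mu>)"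
    by (intro mult_left_mono) auto
  have "(2 * thr + 2 * W ^ (nw + 2)) * gd \<le> (W * W ^ (nw + 2)) * W ^ gw"
  proof (intro mult_le_mono)
    have "W \<le> W ^ (nw + 2)" using W_pow_le[of 1 "nw + 2"] by simp
    then have "2 * thr + 2 * W ^ (nw + 2) \<le> 3 * W ^ (nw + 2)" using W_thr by simp
    also have "\<dots> \<le> W * W ^ (nw + 2)"
    proof (intro mult_le_mono1)
      show "3 \<le> W" using w power_increasing[of 2 w "2::nat"] by (simp add: W_def)
    qed
    finally show "2 * thr + 2 * W ^ (nw + 2) \<le> W * W ^ (nw + 2)" .
  qed (use assms in simp)
  also have "\<dots> = W ^ \<mu>" by (simp add: \<mu>_def power_add power3_eq_cube power2_eq_square)
  finally have "real ((2 * thr + 2 * W ^ (nw + 2)) * gd) \<le> real (W ^ \<mu>)"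
    by (simp only: of_nat_le_iff)
  then have 2: "2 * real thr + 2 * real (W ^ (nw + 2)) \<le> 1 / real gd * real (W ^ \<mu>)"
    using assms(2) by (simp add: field_simps)
  have "\<Gamma> i \<le> v i + W ^ (nw + 2)" by (simp add: \<Gamma>_def)
  then have "real (\<Gamma> i) \<le> real (v i) + real (W ^ (nw + 2))"
    by (simp only: of_nat_add[symmetric] of_nat_le_iff)
  then show ?thesis
    using v_le_geometric[of i] 1 2 by (simp add: algebra_simps)
qed

text \<open>A potential bounding the number of steps until exhaustion: the recursion spends at most about \<open>\<sigma>\<close>
  steps on each value of the exponent.\<close>

definition \<Phi> :: "nat \<times> nat \<Rightarrow> nat" where
  "\<Phi> = (\<lambda>(m, e). e * \<sigma> + m div (4 * (thr div \<sigma>)))"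

lemma \<Phi>_aux: "2 * thr < \<sigma> * (4 * (thr div \<sigma>))"
proof -
  have "\<sigma> \<le> \<sigma> * (thr div \<sigma>)"
    using div_\<sigma>_big[of thr] s_pows by simp
  then show ?thesis
    using \<sigma>_div_gt[of thr] by linarith
qed

lemma \<Phi>_start: "\<Phi> (m0, e0) \<le> (e0 + 1) * \<sigma>"
proof -
  have "m0 < \<sigma> * (4 * (thr div \<sigma>))"
    using m0 \<Phi>_aux by linarith
  then have "m0 div (4 * (thr div \<sigma>)) < \<sigma>"
    by (rule less_mult_imp_div_less)
  then show ?thesis
    by (simp add: \<Phi>_def)
qed

text \<open>At a fixed exponent a step lowers the mantissa by at least the divisor in \<Phi>, hence
  the quotient by at least one. When the exponent drops, the first summand loses \<sigma>, while the
  quotient of the new mantissa is less than \<sigma>.\<close>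

lemma \<Phi>_fstep:
  assumes "normal p" "\<not> exhausted w p"
  shows "\<Phi> (fstep w s p) < \<Phi> p"
  using assms(1)
proof (cases rule: step_cases)
  case exh
  then show ?thesis using assms(2) by simp
next
  case (step M E)
  define \<Delta> where "\<Delta> = 4 * (thr div \<sigma>)"
  have \<Delta>: "\<Delta> > 0" "\<Delta> \<le> 4 * (M div \<sigma>)"
    using div_\<sigma>_big[of thr] s_pows step(2) by (auto simp: \<Delta>_def intro: div_le_mono)
  have fs: "\<Phi> (fstep w s p) = E * \<sigma> + (M - 4 * (M div \<sigma>)) div \<Delta>"
    by (simp add: step \<Phi>_def \<Delta>_def)
  from step(6) show ?thesis
  proof
    assume *: "thr \<le> fst p \<and> M = fst p \<and> E = snd p"
    have "(M - 4 * (M div \<sigma>)) div \<Delta> + 1 = (M - 4 * (M div \<sigma>) + \<Delta>) div \<Delta>"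
      using \<Delta> by simp
    also have "\<dots> \<le> M div \<Delta>"
      using \<Delta> sub_half[of M] by (intro div_le_mono) linarith
    finally show ?thesis
      using * unfolding fs by (cases p) (simp add: \<Phi>_def \<Delta>_def)
  next
    assume *: "fst p < thr \<and> M = 2 * fst p \<and> snd p = Suc E"
    have "M - 4 * (M div \<sigma>) < \<sigma> * \<Delta>"
      using \<Phi>_aux step(3) by (simp add: \<Delta>_def)
    then have "(M - 4 * (M div \<sigma>)) div \<Delta> < \<sigma>"
      by (rule less_mult_imp_div_less)
    then show ?thesis
      using * unfolding fs by (cases p) (simp add: \<Phi>_def)
  qed
qed

lemma funpow_fstep_exhausted:
  assumes "normal p" "\<Phi> p \<le> i"
  shows "exhausted w ((fstep w s ^^ i) p)"
  using assms
proof (induction i arbitrary: p)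
  case 0
  then show ?case using \<Phi>_fstep[of p] by fastforce
next
  case (Suc i)
  show ?case
  proof (cases "exhausted w p")
    case True
    then show ?thesis by (metis fstep_funpow_exhausted)
  next
    case False
    then have "exhausted w ((fstep w s ^^ i) (fstep w s p))"
      using Suc \<Phi>_fstep[of p] by (intro Suc.IH normal_fstep) auto
    then show ?thesis by (simp add: funpow_swap1)
  qed
qed

lemma fst0_min:
  assumes "(e0 + 1) * \<sigma> \<le> k"
  shows "fst0 i = (fstep w s ^^ (min i k)) (m0, e0)"
proof (cases "i \<le> k")
  case False
  have "normal (m0, e0)" using normal_fst0[of 0] by (simp add: fst0_def)
  then have "exhausted w ((fstep w s ^^ k) (m0, e0))"
    using assms \<Phi>_start by (intro funpow_fstep_exhausted) auto
  then have "(fstep w s ^^ (i - k)) ((fstep w s ^^ k) (m0, e0)) = (fstep w s ^^ k) (m0, e0)"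
    by (rule fstep_funpow_exhausted)
  then show ?thesis
    using False funpow_add[of "i - k" k "fstep w s"] by (simp add: fst0_def)
qed (simp add: fst0_def)

end

section \<open>Evaluation of the tails\<close>

text \<open>Register 40 counts the steps of the recursion and \<open>(41, 42)\<close> holds the current mantissa and exponent. The
  counter is the argument cut off at the largest word; this is harmless because the recursion has
  become stationary by then.\<close>

definition step_body :: com where
  "step_body =
     Op Lt 43 41 13 ;;
     If 43 (If 42 (Op Add 41 41 41 ;; Const 44 1 ;; Op Sub 42 42 44 ;; Const 43 0) (Const 40 1)) Skip ;;
     If 43 Skip (Op Div 44 41 12 ;; Const 45 4 ;; Op Mul 44 44 45 ;; Op Sub 41 41 44) ;;
     Const 44 1 ;; Op Sub 40 40 44"

text \<open>The comparison with \<open>W - 1\<close> decides whether the argument itself serves as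
  counter. A floating-point value touches only two adjacent words, at offset exponent
  \<open>div\<close> \<open>w\<close>; they are written for the subtraction and erased afterwards,
  so that region 2 is zero again for the next call.\<close>

definition eval_com :: com where
  "eval_com =
     sub_com 30 32 31 1 ;;
     (If 25 (Load 40 30) (Mov 40 11) ;; Mov 41 14 ;; Mov 42 15) ;;
     While 40 step_body ;;
     (Op Div 43 42 10 ;; Op Mod 44 42 10 ;; Op Shl 45 41 44 ;; Op Sub 46 10 44 ;; Op Shr 46 41 46 ;;
      Op Add 43 43 18 ;; Store 43 45 ;; Const 47 1 ;; Op Add 47 43 47 ;; Store 47 46) ;;
     sub_com 17 18 19 16 ;;
     Const 48 0 ;; Store 43 48 ;; Store 47 48"

lemma val_one: "val w m a 1 = m a"
  by (simp add: val_def)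

lemma mod_sub_nat: "a < W \<Longrightarrow> b \<le> a \<Longrightarrow> (a + W - b) mod W = a - (b::nat)"
proof -
  assume "a < W" "b \<le> a"
  then have "a + W - b = (a - b) + W" "a - b < W" by linarith+
  then show ?thesis by (simp only: mod_add_self2 mod_less)
qed

context geom
begin

lemma normal_less: "normal (m, e) \<Longrightarrow> 2 * m < 2 ^ w"
  using W_thr by (auto simp: normal_def W_def)

text \<open>On exhaustion the counter is set to 1 just before it is decremented, which ends the loop
  at once. The running time is therefore independent of the counter, which may be as large as
  \<open>W - 1\<close>.\<close>

lemma ex_step_body:
  assumes wf: "wf_state w (R, m)" and R: "R 10 = w" "R 12 = \<sigma>" "R 13 = thr" "R 40 \<noteq> 0"
    and normal: "normal (R 41, R 42)"
  obtains R' where "ex w step_body (R, m) = (R', m)" "(R' 41, R' 42) = fstep w s (R 41, R 42)"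
    "R' 40 = (if exhausted w (R 41, R 42) then 0 else R 40 - 1)"
    "\<And>r. r \<notin> {40..49} \<Longrightarrow> R' r = R r"
proof -
  obtain R' m' where R': "ex w step_body (R, m) = (R', m')" by fastforce
  have w0: "w \<noteq> 0" using w by simp
  have w1: "1 < (2::nat) ^ w" using w by (intro one_less_power) auto
  have w4: "4 < (2::nat) ^ w" using w power_increasing[of 3 w "2::nat"] by simp
  have one: "1 mod (2::nat) ^ w = 1" "4 mod (2::nat) ^ w = 4" using w1 w4 w by simp_all
  have m2: "2 * R 41 < 2 ^ w" using normal by (rule normal_less)
  then have m1: "R 41 < 2 ^ w" by simp
  have lt: "R 40 < 2 ^ w" "R 42 < 2 ^ w" using wf by (auto simp: wf_state_def)
  have mod2: "(R 41 + R 41) mod 2 ^ w = 2 * R 41" using m2 by (simp add: mult_2)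
  have x: "(M div \<sigma> * 4) mod 2 ^ w = 4 * (M div \<sigma>)"
    "(M + 2 ^ w - 4 * (M div \<sigma>)) mod 2 ^ w = M - 4 * (M div \<sigma>)" if "M < 2 ^ w" for M
    using sub_half[of M] that by (auto intro!: mod_sub_nat)
  have dec: "(R 40 + 2 ^ w - 1) mod 2 ^ w = R 40 - 1"
    using lt R(4) by (intro mod_sub_nat) auto
  have dec': "(R 42 + 2 ^ w - 1) mod 2 ^ w = R 42 - 1" if "R 42 > 0"
    using lt that by (intro mod_sub_nat) auto
  consider "thr \<le> R 41" | "R 41 < thr" "R 42 = 0" | "R 41 < thr" "R 42 > 0" by linarith
  then have "m' = m \<and> (R' 41, R' 42) = fstep w s (R 41, R 42) \<and>
    R' 40 = (if exhausted w (R 41, R 42) then 0 else R 40 - 1) \<and> (\<forall>r. r \<notin> {40..49} \<longrightarrow> R' r = R r)"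
  proof cases
    case 1
    then show ?thesis
      using R' by (auto simp: w0 step_body_def R x[OF m1] dec one
        fstep_def exhausted_def thr_def[symmetric] \<sigma>_def[symmetric] simp del: One_nat_def)
  next
    case 2
    then show ?thesis
      using R' by (auto simp: w0 step_body_def R one
        fstep_def exhausted_def thr_def[symmetric] \<sigma>_def[symmetric] simp del: One_nat_def)
  next
    case 3
    then show ?thesis
      using R' dec' by (auto simp: w0 step_body_def R x[OF m2] dec one mod2
        fstep_def exhausted_def thr_def[symmetric] \<sigma>_def[symmetric] simp del: One_nat_def)
  qed
  with R' show thesis by (intro that[of R']) auto
qed

lemma tr_steps:
  assumes wf: "wf_state w (R, m)" and R: "R 10 = w" "R 12 = \<sigma>" "R 13 = thr" "R 41 = m0" "R 42 = e0"
    and T: "((e0 + 1) * \<sigma> + 1) * 18 + 1 \<le> T"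
    and Q: "\<And>R'. wf_state w (R', m) \<Longrightarrow> (\<And>r. r \<notin> {40..49} \<Longrightarrow> R' r = R r) \<Longrightarrow>
        (R' 41, R' 42) = (fstep w s ^^ R 40) (m0, e0) \<Longrightarrow> Q (R', m)"
  shows "tr w mc (While 40 step_body) (R, m) T Q"
proof -
  define I where "I = (\<lambda>(R', m'). m' = m \<and> (\<forall>r. r \<notin> {40..49} \<longrightarrow> R' r = R r) \<and>
     normal (R' 41, R' 42) \<and> (fstep w s ^^ R' 40) (R' 41, R' 42) = (fstep w s ^^ R 40) (m0, e0))"
  \<comment> \<open>The potential bounds the rounds however large the counter is; its
    \<open>+ 1\<close> pays for the round that detects exhaustion.\<close>
  define M where "M = (\<lambda>(R' :: nat \<Rightarrow> nat, m' :: nat \<Rightarrow> nat).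
     if R' 40 = 0 then 0 else min (R' 40) (\<Phi> (R' 41, R' 42) + 1))"
  have "tr w mc (While 40 step_body) (R, m) (((e0 + 1) * \<sigma> + 1) * (17 + 1) + 1)
      (\<lambda>s'. I s' \<and> fst s' 40 = 0)"
  proof (rule tr_While[where \<mu> = M and k = "(e0 + 1) * \<sigma> + 1", OF _ wf])
    show "I (R, m)"
      using normal_fst0[of 0] by (simp add: I_def R fst0_def)
    show "M (R, m) \<le> (e0 + 1) * \<sigma> + 1"
      using \<Phi>_start by (auto simp: M_def R min_def)
  next
    fix R1 m1 assume wf1: "wf_state w (R1, m1)" and I1: "I (R1, m1)" and ne: "R1 40 \<noteq> 0"
    have n1: "normal (R1 41, R1 42)" using I1 by (simp add: I_def)
    have "R1 10 = w" "R1 12 = \<sigma>" "R1 13 = thr" using I1 R by (auto simp: I_def)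
    from ex_step_body[OF wf1 this ne n1]
    obtain R2 where R2: "ex w step_body (R1, m1) = (R2, m1)"
      "(R2 41, R2 42) = fstep w s (R1 41, R1 42)"
      "R2 40 = (if exhausted w (R1 41, R1 42) then 0 else R1 40 - 1)"
      "\<And>r. r \<notin> {40..49} \<Longrightarrow> R2 r = R1 r" by blast
    have n2: "normal (R2 41, R2 42)" unfolding R2(2) by (rule normal_fstep[OF n1])
    have dec: "I (R2, m1) \<and> M (R2, m1) < M (R1, m1)"
    proof (cases "exhausted w (R1 41, R1 42)")
      case True
      then have "(R2 41, R2 42) = (R1 41, R1 42)" by (simp only: R2(2) fstep_exhausted)
      moreover have "(fstep w s ^^ R1 40) (R1 41, R1 42) = (R1 41, R1 42)"
        using True by (rule fstep_funpow_exhausted)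
      ultimately show ?thesis
        using True I1 R2 n2 ne by (auto simp: I_def M_def)
    next
      case False
      then have c: "R1 40 = Suc (R2 40)" using R2(3) ne by simp
      have "(fstep w s ^^ R2 40) (R2 41, R2 42) = (fstep w s ^^ R1 40) (R1 41, R1 42)"
        unfolding R2(2) c by (simp add: funpow_swap1)
      moreover have "\<Phi> (R2 41, R2 42) < \<Phi> (R1 41, R1 42)"
        unfolding R2(2) using \<Phi>_fstep[OF n1 False] .
      ultimately show ?thesis
        using I1 R2(4) n2 c by (auto simp: I_def M_def)
    qed
    show "tr w mc step_body (R1, m1) 17 (\<lambda>s'. I s' \<and> M s' < M (R1, m1))"
    proof (intro tr_straight)
      show "I (ex w step_body (R1, m1)) \<and> M (ex w step_body (R1, m1)) < M (R1, m1)"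
        using dec by (simp only: R2(1))
    qed (use w wf1 in \<open>simp_all add: step_body_def\<close>)
  qed simp
  then show ?thesis
    by (rule tr_weaken) (use Q T in \<open>auto simp: I_def\<close>)
qed

lemma v_le: "v i \<le> v 0"
  by (induction i) (auto intro: le_trans[OF v_antimono])

lemma snd_fst0_le: "snd (fst0 i) \<le> e0"
proof (induction i)
  case 0
  then show ?case by (simp add: fst0_def)
next
  case (Suc i)
  have "snd (fstep w s p) \<le> snd p" for p
    by (auto simp: fstep_def split: prod.splits)
  with Suc show ?case by (metis fst0_Suc le_trans)
qed

end

locale layout = geom +
  fixes pad q :: nat
  assumes nw: "0 < nw" and q: "16 * q = 2 ^ w" and fits: "\<mu> + pad + 2 \<le> q"
    and iterations: "(e0 + 1) * \<sigma> < W"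
begin

text \<open>Memory is divided into 16 regions of size \<open>q\<close>. Region 0 holds the input. Region 1 holds the argument \<open>i\<close> from
  \<open>q + 1\<close> on, surrounded by words such that the \<open>\<mu>\<close> words from \<open>q\<close> on form the integer
  \<open>W ^ \<mu> - W ^ (nw + 2) + W * i\<close>; subtracting the floating-point value, expanded in region 2, yields \<open>W ^ \<mu> - \<Gamma> i\<close>.
  It is stored in region 5 behind \<open>pad\<close> zero words, i.e. multiplied by \<open>W ^ pad\<close>. Region 3 is scratch space and
  region 4 holds the number \<open>W - 1\<close>.\<close>

definition regs_ok :: "(nat \<Rightarrow> nat) \<Rightarrow> bool" where
  "regs_ok R \<longleftrightarrow> R 1 = nw \<and> R 10 = w \<and> R 11 = W - 1 \<and> R 12 = \<sigma> \<and> R 13 = thr \<and> R 14 = m0 \<and> R 15 = e0 \<and>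
     R 16 = \<mu> \<and> R 17 = q \<and> R 18 = 2 * q \<and> R 19 = 5 * q + pad \<and> R 30 = q + 1 \<and> R 31 = 3 * q \<and> R 32 = 4 * q"

lemma regs_ok_cong:
  "regs_ok R \<Longrightarrow> (\<And>r. r \<notin> {20..29} \<Longrightarrow> r \<notin> {40..99} \<Longrightarrow> R' r = R r) \<Longrightarrow> regs_ok R'"
  by (simp add: regs_ok_def)

definition mem_ok :: "(nat \<Rightarrow> nat) \<Rightarrow> bool" where
  "mem_ok m \<longleftrightarrow> m q = 0 \<and> m (q + nw + 1) = 0 \<and> val w m (q + nw + 2) (gw + 1) = W ^ (gw + 1) - 1 \<and>
     (\<forall>x. 2 * q \<le> x \<and> x < 3 * q \<longrightarrow> m x = 0) \<and> m (4 * q) = W - 1 \<and>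
     (\<forall>x. 4 * q < x \<and> x < 5 * q \<longrightarrow> m x = 0)"

lemma mem_ok_cong:
  assumes "mem_ok m" "\<And>x. q \<le> x \<Longrightarrow> x < 5 * q \<Longrightarrow> \<not> (q + 1 \<le> x \<and> x < q + 1 + nw) \<Longrightarrow>
      \<not> (3 * q \<le> x \<and> x < 4 * q) \<Longrightarrow> m' x = m x"
  shows "mem_ok m'"
proof -
  have "nw + gw + 5 \<le> q" using fits by (simp add: \<mu>_def)
  then have "val w m' (q + nw + 2) (gw + 1) = val w m (q + nw + 2) (gw + 1)"
    using assms(2) by (intro val_cong) auto
  then show ?thesis
    using assms \<open>nw + gw + 5 \<le> q\<close> by (auto simp: mem_ok_def)
qed

definition "eval_time = 13 * nw + 13 * \<mu> + ((e0 + 1) * \<sigma> + 1) * 18 + 100"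

text \<open>The block of \<open>gw + 1\<close> words \<open>W - 1\<close> at the top contributes
  \<open>W ^ (nw + 2) * (W ^ (gw + 1) - 1)\<close>, which is
  \<open>W ^ \<mu> - W ^ (nw + 2)\<close>; the zero word at the bottom multiplies the argument by
  \<open>W\<close>.\<close>

lemma val_V:
  assumes "mem_ok m"
  shows "val w m q \<mu> + W ^ (nw + 2) = W * val w m (q + 1) nw + W ^ \<mu>"
proof -
  have \<mu>: "\<mu> = 1 + (nw + (1 + (gw + 1)))" by (simp add: \<mu>_def)
  have "val w m q \<mu> = val w m q 1 + 2 ^ (w * 1) * (val w m (q + 1) nw + 2 ^ (w * nw) *
      (val w m (q + 1 + nw) 1 + 2 ^ (w * 1) * val w m (q + 1 + nw + 1) (gw + 1)))"
    by (simp only: \<mu> val_add)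
  also have "\<dots> = W * (val w m (q + 1) nw + W ^ nw * (W * (W ^ (gw + 1) - 1)))"
  proof -
    have "q + 1 + nw + 1 = q + nw + 2" "q + 1 + nw = q + nw + 1" by simp_all
    then show ?thesis
      using assms by (simp only: mem_ok_def val_one W_power mult_1_right W_def power_mult) simp
  qed
  finally have "val w m q \<mu> = W * (val w m (q + 1) nw + W ^ nw * (W * (W ^ (gw + 1) - 1)))" .
  moreover have "W ^ \<mu> = W ^ (nw + 2) * W ^ (gw + 1)"
  proof -
    have "\<mu> = (nw + 2) + (gw + 1)" by (simp add: \<mu>_def)
    then show ?thesis by (simp only: power_add)
  qed
  moreover obtain Z where Z: "W ^ (gw + 1) = Z + 1"
    using W_pos by (metis Suc_eq_plus1 gr0_conv_Suc zero_less_power)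
  moreover have "W ^ (nw + 2) = W ^ nw * (W * W)"
    by (simp add: power_add power2_eq_square)
  ultimately show ?thesis
    by (simp only: Z diff_add_inverse2) (simp add: algebra_simps)
qed

lemma tr_eval:
  assumes wf: "wf_state w (R, m)" and R: "regs_ok R" and m: "mem_ok m" and T: "eval_time \<le> T"
    and Q: "\<And>R' m'. wf_state w (R', m') \<Longrightarrow>
        (\<And>r. r \<notin> {20..29} \<Longrightarrow> r \<notin> {40..49} \<Longrightarrow> R' r = R r) \<Longrightarrow>
        (\<And>x. \<not> (3 * q \<le> x \<and> x < 4 * q) \<Longrightarrow> \<not> (5 * q + pad \<le> x \<and> x < 5 * q + pad + \<mu>) \<Longrightarrow> m' x = m x) \<Longrightarrow>
        val w m' (5 * q + pad) \<mu> + \<Gamma> (val w m (q + 1) nw) = W ^ \<mu> \<Longrightarrow> Q (R', m')"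
  shows "tr w mc eval_com (R, m) T Q"
proof -
  define i where "i = val w m (q + 1) nw"
  have w0: "0 < w" using w by simp
  have qs: "nw + gw + pad + 5 \<le> q" using fits by (simp add: \<mu>_def)
  have q16: "16 * q = W" using q by (simp add: W_def)
  note r = R[unfolded regs_ok_def]
  have memlt: "\<And>x. m x < W" using wf by (simp add: wf_state_def W_def)
  have i: "i < W ^ nw"
    unfolding i_def W_power using memlt by (intro val_less) (simp add: W_def)
  have max: "val w m (4 * q) nw = W - 1"
  proof -
    have n: "nw = 1 + (nw - 1)" using nw by simp
    have "val w m (4 * q + 1) (nw - 1) = 0"
      using m qs by (intro val_zero) (auto simp: mem_ok_def)
    then have "val w m (4 * q) nw = m (4 * q)"
      by (subst n) (simp only: val_add val_one)
    then show ?thesis using m by (simp add: mem_ok_def)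
  qed
  define P1 where "P1 = (\<lambda>(R1, m1). (\<forall>r. r \<notin> {20..29} \<longrightarrow> R1 r = R r) \<and>
    (\<forall>x. \<not> (3 * q \<le> x \<and> x < 4 * q) \<longrightarrow> m1 x = m x) \<and> R1 25 = of_bool (i < W - 1))"
  define P2 where "P2 = (\<lambda>(R1, m1). (\<forall>r. r \<notin> {20..29} \<and> r \<notin> {40..49} \<longrightarrow> R1 r = R r) \<and>
    (\<forall>x. \<not> (3 * q \<le> x \<and> x < 4 * q) \<longrightarrow> m1 x = m x) \<and>
    R1 40 = min i (W - 1) \<and> R1 41 = m0 \<and> R1 42 = e0)"
  define P3 where "P3 = (\<lambda>(R1, m1). (\<forall>r. r \<notin> {20..29} \<and> r \<notin> {40..49} \<longrightarrow> R1 r = R r) \<and>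
    (\<forall>x. \<not> (3 * q \<le> x \<and> x < 4 * q) \<longrightarrow> m1 x = m x) \<and> (R1 41, R1 42) = fst0 i)"
  obtain M E where ME: "fst0 i = (M, E)" by fastforce
  define f where "f = E div w"
  define lo hi where "lo = M * 2 ^ (E mod w) mod W" and "hi = M div 2 ^ (w - E mod w)"
  define P4 where "P4 = (\<lambda>(R1, m1). (\<forall>r. r \<notin> {20..29} \<and> r \<notin> {40..49} \<longrightarrow> R1 r = R r) \<and>
    (\<forall>x. \<not> (3 * q \<le> x \<and> x < 4 * q) \<longrightarrow> x \<noteq> 2 * q + f \<and> x \<noteq> 2 * q + f + 1 \<longrightarrow> m1 x = m x) \<and>
    m1 (2 * q + f) = lo \<and> m1 (2 * q + f + 1) = hi \<and> R1 43 = 2 * q + f \<and> R1 47 = 2 * q + f + 1)"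
  define P5 where "P5 = (\<lambda>(R1, m1). (\<forall>r. r \<notin> {20..29} \<and> r \<notin> {40..49} \<longrightarrow> R1 r = R r) \<and>
    (\<forall>x. \<not> (3 * q \<le> x \<and> x < 4 * q) \<longrightarrow> \<not> (5 * q + pad \<le> x \<and> x < 5 * q + pad + \<mu>) \<longrightarrow>
       x \<noteq> 2 * q + f \<and> x \<noteq> 2 * q + f + 1 \<longrightarrow> m1 x = m x) \<and> R1 43 = 2 * q + f \<and> R1 47 = 2 * q + f + 1 \<and>
    val w m1 (5 * q + pad) \<mu> + \<Gamma> i = W ^ \<mu>)"
  have E: "E \<le> e0" using snd_fst0_le[of i] ME by simp
  have f: "f < \<mu>"
  proof -
    have "\<mu> * w = e0 + w" by (simp add: e0_def \<mu>_def algebra_simps)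
    then have "E < \<mu> * w" using E w by linarith
    then show ?thesis unfolding f_def by (rule less_mult_imp_div_less)
  qed
  have norm: "normal (M, E)" using normal_fst0[of i] ME by simp
  then have M: "2 * M < W" using normal_less by (simp add: W_def)
  have E_eq: "E = w * f + E mod w" by (simp add: f_def)
  have split: "lo + hi * W = M * 2 ^ (E mod w)"
  proof -
    have "W = 2 ^ (w - E mod w) * 2 ^ (E mod w)"
      using w by (simp add: W_def flip: power_add)
    then have "M * 2 ^ (E mod w) div W = hi"
      by (simp add: hi_def)
    then show ?thesis
      using mod_mult_div_eq[of "M * 2 ^ (E mod w)" W] by (simp add: lo_def mult.commute)
  qed
  \<comment> \<open>In the top word the bound \<open>E <= e0\<close> leaves no shift, so the second
    word, which would lie outside the \<mu> words of the array, is zero.\<close>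
  have hi0: "hi = 0" if "f = \<mu> - 1"
  proof -
    have "w * f = e0" using that by (simp add: e0_def mult.commute)
    then have "E mod w = 0" using E E_eq by linarith
    then show ?thesis using M by (simp add: hi_def W_def)
  qed
  have s1: "tr w mc (sub_com 30 32 31 1) (R, m) (13 * nw + 8) P1"
    by (rule tr_sub[OF w0 wf])
      (use r qs q16 max in \<open>auto simp: P1_def i_def W_def\<close>)
  have s2: "tr w mc (If 25 (Load 40 30) (Mov 40 11) ;; Mov 41 14 ;; Mov 42 15) st 10 P2"
    if "wf_state w st" "P1 st" for st
  proof -
    obtain R1 m1 where st: "st = (R1, m1)" by fastforce
    have P: "\<And>r. r \<notin> {20..29} \<Longrightarrow> R1 r = R r" "\<And>x. \<not> (3 * q \<le> x \<and> x < 4 * q) \<Longrightarrow> m1 x = m x"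
      "R1 25 = of_bool (i < W - 1)"
      using that by (auto simp: P1_def st)
    have "m1 (q + 1) = i" if "i < W"
    proof -
      have n: "nw = 1 + (nw - 1)" using nw by simp
      have "i = m (q + 1) + W * val w m (q + 1 + 1) (nw - 1)"
        unfolding i_def by (subst n) (simp only: val_add val_one W_def mult_1_right)
      then have "m (q + 1) = i" using that by (cases "val w m (q + 1 + 1) (nw - 1)") auto
      moreover have "m1 (q + 1) = m (q + 1)" using qs by (intro P) auto
      ultimately show ?thesis by simp
    qed
    then show ?thesis
      unfolding st using w0 that P(1) r P(2,3)
      by (intro tr_straight) (auto simp: st P2_def)
  qed
  have s3: "tr w mc (While 40 step_body) st (((e0 + 1) * \<sigma> + 1) * 18 + 1) P3"
    if "wf_state w st" "P2 st" for st
  proof -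
    obtain R1 m1 where st: "st = (R1, m1)" by fastforce
    have P: "\<And>r. r \<notin> {20..29} \<Longrightarrow> r \<notin> {40..49} \<Longrightarrow> R1 r = R r"
      "\<And>x. \<not> (3 * q \<le> x \<and> x < 4 * q) \<Longrightarrow> m1 x = m x"
      "R1 40 = min i (W - 1)" "R1 41 = m0" "R1 42 = e0"
      using that by (auto simp: P2_def st)
    have "fst0 i = (fstep w s ^^ R1 40) (m0, e0)"
      unfolding P(3) using iterations by (intro fst0_min) simp
    then show ?thesis
      unfolding st using that P r
      by (intro tr_steps[OF _ _ _ _ _ _ le_refl]) (auto simp: st P3_def)
  qed
  have s4: "tr w mc (Op Div 43 42 10 ;; Op Mod 44 42 10 ;; Op Shl 45 41 44 ;; Op Sub 46 10 44 ;;
      Op Shr 46 41 46 ;; Op Add 43 43 18 ;; Store 43 45 ;; Const 47 1 ;; Op Add 47 43 47 ;; Store 47 46)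
      st 10 P4"
    if "wf_state w st" "P3 st" for st
  proof -
    obtain R1 m1 where st: "st = (R1, m1)" by fastforce
    have P: "\<And>r. r \<notin> {20..29} \<Longrightarrow> r \<notin> {40..49} \<Longrightarrow> R1 r = R r"
      "\<And>x. \<not> (3 * q \<le> x \<and> x < 4 * q) \<Longrightarrow> m1 x = m x" "R1 41 = M" "R1 42 = E"
      using that by (auto simp: P3_def st ME)
    have "R1 10 = w" "R1 18 = 2 * q" using P(1) r by auto
    moreover have "(w + 2 ^ w - E mod w) mod 2 ^ w = w - E mod w"
      using w0 by (intro mod_sub_nat) (auto intro: less_imp_le)
    moreover have "(E div w + 2 * q) mod 2 ^ w = 2 * q + f" "(2 * q + f + 1) mod 2 ^ w = 2 * q + f + 1"
      using f fits q by (auto simp: f_def)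
    moreover have "1 mod 2 ^ w = (1::nat)" using w0 by simp
    ultimately show ?thesis
      unfolding st using w0 that P f fits
      by (intro tr_straight) (auto simp: st P4_def lo_def hi_def W_def simp del: One_nat_def)
  qed
  have s5: "tr w mc (sub_com 17 18 19 16) st (13 * \<mu> + 8) P5"
    if "wf_state w st" "P4 st" for st
  proof -
    obtain R1 m1 where st: "st = (R1, m1)" by fastforce
    have P: "\<And>r. r \<notin> {20..29} \<Longrightarrow> r \<notin> {40..49} \<Longrightarrow> R1 r = R r"
      "\<And>x. \<not> (3 * q \<le> x \<and> x < 4 * q) \<Longrightarrow> x \<noteq> 2 * q + f \<Longrightarrow> x \<noteq> 2 * q + f + 1 \<Longrightarrow> m1 x = m x"
      "m1 (2 * q + f) = lo" "m1 (2 * q + f + 1) = hi" "R1 43 = 2 * q + f" "R1 47 = 2 * q + f + 1"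
      using that by (auto simp: P4_def st)
    have V: "val w m1 q \<mu> = val w m q \<mu>"
      using fits by (intro val_cong P(2)) auto
    have Y: "val w m1 (2 * q) \<mu> = v i"
    proof -
      have z: "m1 x = 0" if "2 * q \<le> x" "x < 3 * q" "x \<noteq> 2 * q + f" "x \<noteq> 2 * q + f + 1" for x
        using that m by (subst P(2)) (auto simp: mem_ok_def)
      have pw: "2 ^ (w * f) = W ^ f" "2 ^ (w * 1) = W"
        by (simp_all add: W_def power_mult)
      have z1: "val w m1 (2 * q) f = 0"
        using f fits by (intro val_zero z) auto
      have "val w m1 (2 * q) \<mu> = lo * W ^ f + hi * W ^ (f + 1)"
      proof (cases "f = \<mu> - 1")
        case True
        then have n: "\<mu> = f + 1" using f by simp
        show ?thesis
          using hi0[OF True] z1 by (simp only: n val_add val_one P(3)) (simp add: W_power)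
      next
        case False
        then have n: "\<mu> = f + (1 + (1 + (\<mu> - f - 2)))" using f by simp
        have "val w m1 (2 * q + f + 1 + 1) (\<mu> - f - 2) = 0"
          using f fits by (intro val_zero z) auto
        then show ?thesis
          using z1 by (subst n, simp only: val_add val_one P(3,4) pw) (simp add: algebra_simps)
      qed
      also have "\<dots> = (lo + hi * W) * W ^ f" by (simp add: algebra_simps)
      also have "\<dots> = M * 2 ^ E"
        unfolding split W_power by (subst (2) E_eq) (simp add: power_add algebra_simps)
      finally show ?thesis
        by (simp add: v_def ME fval_def)
    qed
    have le: "v i \<le> val w m q \<mu>"
    proof -
      have "v i + W ^ (nw + 2) \<le> W ^ \<mu>"
        using \<Gamma>0(1) \<Gamma>0_half v_le by (metis add_le_mono1 le_trans mult_2 le_add1)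
      then show ?thesis using val_V[OF m] by linarith
    qed
    have wi: "W * i \<le> W ^ (nw + 2)"
    proof -
      have "W * i \<le> W * W ^ nw" using i by (intro mult_le_mono2) simp
      also have "\<dots> = W ^ (nw + 1)" by simp
      also have "\<dots> \<le> W ^ (nw + 2)" by (intro W_pow_le) simp
      finally show ?thesis .
    qed
    have R1: "R1 17 = q" "R1 18 = 2 * q" "R1 19 = 5 * q + pad" "R1 16 = \<mu>"
      using P(1) r by auto
    show ?thesis
      unfolding st
    proof (rule tr_sub)
      fix R2 m2
      assume *: "\<And>r. r \<notin> {20..29} \<Longrightarrow> R2 r = R1 r"
        "\<And>x. \<not> (R1 19 \<le> x \<and> x < R1 19 + R1 16) \<Longrightarrow> m2 x = m1 x"
        "R2 25 = of_bool (val w m1 (R1 17) (R1 16) < val w m1 (R1 18) (R1 16))"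
        "val w m2 (R1 19) (R1 16) + val w m1 (R1 18) (R1 16) =
          val w m1 (R1 17) (R1 16) + R2 25 * 2 ^ (w * R1 16)"
      from *(3) have "R2 25 = 0" using le by (simp add: R1 V Y)
      with *(4) have "val w m2 (5 * q + pad) \<mu> + v i = val w m q \<mu>"
        by (simp add: R1 V Y)
      then have "val w m2 (5 * q + pad) \<mu> + \<Gamma> i = W ^ \<mu>"
        using val_V[OF m] wi unfolding \<Gamma>_def i_def[symmetric] by linarith
      then show "P5 (R2, m2)"
        using * P by (auto simp: P5_def R1)
    qed (use w0 that R1 fits q16 f in \<open>auto simp: st W_def\<close>)
  qed
  have s6: "tr w mc (Const 48 0 ;; Store 43 48 ;; Store 47 48) st 3 Q"
    if "wf_state w st" "P5 st" for st
  proof (rule tr_straight)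
    obtain R1 m1 where st: "st = (R1, m1)" by fastforce
    let ?p = "Const 48 0 ;; Store 43 48 ;; Store 47 48"
    have ex: "ex w ?p st = (R1(48 := 0), m1(2 * q + f := 0, 2 * q + f + 1 := 0))"
      using that by (simp add: st P5_def)
    have wf': "wf_state w (ex w ?p st)"
      using run_ex[of ?p] wf_state_run w0 that(1) by (metis straight.simps)
    have Y: "m (2 * q + f) = 0" "m (2 * q + f + 1) = 0"
      using m f fits by (auto simp: mem_ok_def)
    have "val w (m1(2 * q + f := 0, 2 * q + f + 1 := 0)) (5 * q + pad) \<mu> = val w m1 (5 * q + pad) \<mu>"
      using f fits by (intro val_cong) auto
    then show "Q (ex w ?p st)"
      using wf' that(2) Y unfolding ex by (intro Q) (auto simp: st P5_def i_def)
  qed (use w0 that in auto)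
  show ?thesis
    unfolding eval_com_def
    by (rule tr_Seq[OF s1], rule tr_Seq[OF s2], assumption+, rule tr_Seq[OF s3], assumption+,
        rule tr_Seq[OF s4], assumption+, rule tr_Seq[OF s5], assumption+, rule s6, assumption+,
        (rule order_refl)+) (use T in \<open>simp add: eval_time_def\<close>)
qed

end

text \<open>A program does not know the word length: the first loop doubles 1 until it overflows, and the second
  one finds the scale \<open>s\<close> as the least power of two that is at least \<open>2 * K\<close>.\<close>

definition setup_com :: com where
  "setup_com =
     (Const 40 1 ;; Const 10 0 ;; Const 41 1) ;;
     While 40 (Op Add 40 40 40 ;; Op Add 10 10 41) ;;
     (Const 43 0 ;; Op Sub 11 43 41 ;; Load 44 2 ;; Op Add 44 44 44 ;; Const 42 1 ;; Op Lt 43 42 44) ;;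
     While 43 (Op Add 42 42 42 ;; Op Lt 43 42 44) ;;
     (Const 45 4 ;; Op Mul 12 42 45 ;; Const 45 3 ;; Op Add 12 12 45 ;;
      Const 45 2 ;; Op Sub 46 10 45 ;; Op Shl 13 41 46 ;;
      Op Add 46 42 42 ;; Op Add 46 46 41 ;; Op Div 46 11 46 ;; Op Mul 14 42 46 ;;
      Const 45 3 ;; Op Add 16 1 5 ;; Op Add 16 16 45 ;;
      Op Sub 15 16 41 ;; Op Mul 15 15 10) ;;
     (Const 45 2 ;; Op Shr 46 10 45 ;; Op Sub 46 46 41 ;; Op Shl 46 41 46 ;; Op Div 60 46 10 ;;
      Op Add 60 60 41 ;; Op Sub 61 60 16) ;;
     (Const 45 4 ;; Op Sub 46 10 45 ;; Op Shl 17 41 46 ;; Op Add 30 17 41 ;;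
      Op Add 18 17 17 ;; Op Add 31 18 17 ;; Op Add 32 31 17 ;; Op Add 35 32 17 ;; Op Add 19 35 61) ;;
     (Op Add 36 35 17 ;; Op Add 37 36 17 ;; Op Add 38 37 17 ;; Op Add 39 38 17 ;;
      Op Add 62 30 1 ;; Op Add 62 62 41 ;; Op Add 63 5 41 ;; Store 32 11 ;; Store 36 41) ;;
     sub_com 37 36 62 63"

lemmas exec_simps = ex.simps binop_val.simps fun_upd_apply rel_simps num.simps if_True if_False
  simp_thms prod.case mult_1 mult_1_right

text \<open>The scale found by the program and the one fixed by the parameters are both powers of
  two in \<open>[2 * K, 4 * K)\<close>, and this interval contains only one.\<close>

lemma power_two_unique:
  fixes K :: nat
  assumes "2 * K \<le> 2 ^ i" "2 ^ i < 4 * K" "2 * K \<le> 2 ^ j" "(2::nat) ^ j < 4 * K"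
  shows "(2::nat) ^ i = 2 ^ j"
proof -
  have "(2::nat) ^ i < 2 ^ Suc j" "(2::nat) ^ j < 2 ^ Suc i" using assms by auto
  then have "i < Suc j" "j < Suc i" by (simp_all only: power_strict_increasing_iff)
  then show ?thesis by simp
qed

lemma tr_word_length:
  assumes w: "w > 0" and wf: "wf_state w (R, m)" and R: "R 40 = 1" "R 10 = 0" "R 41 = 1"
    and T: "3 * w + 1 \<le> T"
    and Q: "\<And>R'. wf_state w (R', m) \<Longrightarrow> R' 10 = w \<Longrightarrow> (\<And>r. r \<noteq> 10 \<Longrightarrow> r \<noteq> 40 \<Longrightarrow> R' r = R r) \<Longrightarrow> Q (R', m)"
  shows "tr w mc (While 40 (Op Add 40 40 40 ;; Op Add 10 10 41)) (R, m) T Q"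
proof -
  define I where "I = (\<lambda>(R', m'). m' = m \<and> (\<forall>r. r \<noteq> 10 \<longrightarrow> r \<noteq> 40 \<longrightarrow> R' r = R r) \<and>
    R' 10 \<le> w \<and> R' 40 = 2 ^ R' 10 mod 2 ^ w)"
  have "tr w mc (While 40 (Op Add 40 40 40 ;; Op Add 10 10 41)) (R, m) (w * (2 + 1) + 1)
      (\<lambda>s'. I s' \<and> fst s' 40 = 0)"
  proof (rule tr_While[where \<mu> = "\<lambda>s. w - fst s 10" and k = w, OF _ wf])
    show "I (R, m)" using w by (simp add: I_def R)
  next
    fix R1 m1 assume wf1: "wf_state w (R1, m1)" and I1: "I (R1, m1)" and ne: "R1 40 \<noteq> 0"
    have j: "R1 10 < w"
      using I1 ne by (cases "R1 10 = w") (auto simp: I_def)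
    have "(2 ^ R1 10 + 2 ^ R1 10) mod 2 ^ w = 2 ^ (R1 10 + 1) mod (2::nat) ^ w"
      by (simp add: mult_2)
    moreover have "R1 40 = 2 ^ R1 10"
      using I1 j by (simp add: I_def)
    moreover have "(R1 10 + 1) mod 2 ^ w = R1 10 + 1"
    proof -
      have "R1 10 + 1 \<le> w" using j by simp
      also have "w < 2 ^ w" by (rule less_exp)
      finally show ?thesis by simp
    qed
    ultimately show "tr w mc (Op Add 40 40 40 ;; Op Add 10 10 41) (R1, m1) 2
        (\<lambda>s'. I s' \<and> w - fst s' 10 < w - fst (R1, m1) 10)"
      using w wf1 I1 j R by (intro tr_straight) (auto simp: I_def)
  qed (use w in auto)
  then show ?thesis
  proof (rule tr_weaken)
    fix s' assume s': "wf_state w s'" "I s' \<and> fst s' 40 = 0"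
    obtain R' where R': "s' = (R', m)" using s' by (cases s') (auto simp: I_def)
    have "R' 10 = w"
    proof (rule ccontr)
      assume "R' 10 \<noteq> w"
      then have "R' 10 < w" using s' by (simp add: I_def R')
      then have "(2::nat) ^ R' 10 < 2 ^ w" by simp
      moreover have "R' 40 = 2 ^ R' 10 mod 2 ^ w" "R' 40 = 0" using s' unfolding I_def R' by auto
      ultimately show False by (metis mod_less power_not_zero zero_neq_numeral)
    qed
    then show "Q s'" using s' unfolding R' by (intro Q) (auto simp: I_def)
  qed (use T in simp)
qed

text \<open>The variant gives a bound linear in \<open>K\<close> where a logarithmic one would be
  true. This suffices because a single evaluation of the tail is already charged a number of steps
  proportional to \<open>K\<close>.\<close>

lemma tr_scale:
  assumes w: "w > 0" and wf: "wf_state w (R, m)" and K: "0 < K" "4 * K < 2 ^ w"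
    and R: "R 42 = 1" "R 44 = 2 * K" "R 43 = of_bool (1 < 2 * K)"
    and T: "6 * K + 1 \<le> T"
    and Q: "\<And>R'. wf_state w (R', m) \<Longrightarrow> \<exists>j. R' 42 = 2 ^ j \<Longrightarrow> 2 * K \<le> R' 42 \<Longrightarrow> R' 42 < 4 * K \<Longrightarrow>
        (\<And>r. r \<noteq> 42 \<Longrightarrow> r \<noteq> 43 \<Longrightarrow> R' r = R r) \<Longrightarrow> Q (R', m)"
  shows "tr w mc (While 43 (Op Add 42 42 42 ;; Op Lt 43 42 44)) (R, m) T Q"
proof -
  define I where "I = (\<lambda>(R', m'). m' = m \<and> (\<forall>r. r \<noteq> 42 \<longrightarrow> r \<noteq> 43 \<longrightarrow> R' r = R r) \<and>
    (\<exists>j. R' 42 = 2 ^ j) \<and> R' 42 < 4 * K \<and> R' 43 = of_bool (R' 42 < 2 * K))"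
  have "tr w mc (While 43 (Op Add 42 42 42 ;; Op Lt 43 42 44)) (R, m) ((2 * K) * (2 + 1) + 1)
      (\<lambda>s'. I s' \<and> fst s' 43 = 0)"
  proof (rule tr_While[where \<mu> = "\<lambda>s. 2 * K - fst s 42" and k = "2 * K", OF _ wf])
    show "I (R, m)" using K by (auto simp: I_def R intro: exI[of _ 0])
  next
    fix R1 m1 assume wf1: "wf_state w (R1, m1)" and I1: "I (R1, m1)" and ne: "R1 43 \<noteq> 0"
    have lt: "R1 42 < 2 * K" using I1 ne by (auto simp: I_def)
    from I1 obtain j where j: "R1 42 = 2 ^ j" by (auto simp: I_def)
    have "(R1 42 + R1 42) mod 2 ^ w = 2 ^ Suc j"
      using lt K j by (simp add: mult_2)
    moreover have "2 * K - 2 * 2 ^ j < 2 * K - 2 ^ j"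
      using lt unfolding j by (intro diff_less_mono2) auto
    ultimately show "tr w mc (Op Add 42 42 42 ;; Op Lt 43 42 44) (R1, m1) 2
        (\<lambda>s'. I s' \<and> 2 * K - fst s' 42 < 2 * K - fst (R1, m1) 42)"
      using w wf1 I1 j R lt by (intro tr_straight) (auto simp: I_def intro: exI[of _ "Suc j"])
  qed auto
  then show ?thesis
    by (rule tr_weaken) (use T Q in \<open>auto simp: I_def\<close>)
qed

text \<open>\<open>lam\<close> is the number of words of the padded noise range, with
  \<open>D = W ^ lam\<close>. It is determined by the word length alone, which is how a program can
  compute it.\<close>

locale prog = layout +
  fixes K lam :: nat
  assumes K: "0 < K" "2 * K \<le> s" "s < 4 * K" "\<exists>k. s = 2 ^ k"
    and lam: "lam = 2 ^ (w div 4 - 1) div w + 1" "lam = \<mu> + pad"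
begin

text \<open>Regions 6 and 7 hold the integers 1 and 0.\<close>

definition ready :: "(nat \<Rightarrow> nat) \<Rightarrow> (nat \<Rightarrow> nat) \<Rightarrow> bool" where
  "ready R m \<longleftrightarrow> regs_ok R \<and> mem_ok m \<and> R 35 = 5 * q \<and> R 36 = 6 * q \<and> R 37 = 7 * q \<and> R 38 = 8 * q \<and>
     R 39 = 9 * q \<and> R 60 = lam \<and> R 61 = pad \<and> m (6 * q) = 1 \<and> (\<forall>x. 6 * q < x \<and> x < 8 * q \<longrightarrow> m x = 0)"

lemma ready_cong:
  assumes "ready R m" "\<And>r. r \<notin> {20..29} \<Longrightarrow> r \<notin> {40..59} \<Longrightarrow> \<not> r \<ge> 64 \<Longrightarrow> R' r = R r"
    "\<And>x. q \<le> x \<Longrightarrow> x < 8 * q \<Longrightarrow> \<not> (q + 1 \<le> x \<and> x < q + 1 + nw) \<Longrightarrow> \<not> (3 * q \<le> x \<and> x < 4 * q) \<Longrightarrow>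
      \<not> (5 * q \<le> x \<and> x < 6 * q) \<Longrightarrow> m' x = m x"
  shows "ready R' m'"
proof -
  have *: "regs_ok R" "mem_ok m" "R 35 = 5 * q" "R 36 = 6 * q" "R 37 = 7 * q" "R 38 = 8 * q"
    "R 39 = 9 * q" "R 60 = lam" "R 61 = pad" "m (6 * q) = 1" "\<forall>x. 6 * q < x \<and> x < 8 * q \<longrightarrow> m x = 0"
    using assms(1) by (simp_all add: ready_def)
  have "0 < q" using fits by simp
  have "regs_ok R'" using *(1) assms(2) by (simp add: regs_ok_def)
  moreover have "mem_ok m'"
    by (rule mem_ok_cong[OF *(2)], rule assms(3)) auto
  moreover have "m' x = m x" if "6 * q \<le> x" "x < 8 * q" for x
    using that fits by (intro assms(3)) (auto simp: \<mu>_def)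
  ultimately show ?thesis
    using * assms(2) \<open>0 < q\<close> by (simp add: ready_def)
qed

lemma val_zero_array: "ready R m \<Longrightarrow> l < q \<Longrightarrow> val w m (7 * q) l = 0"
  by (intro val_zero) (auto simp: ready_def)

lemma val_one_array: "ready R m \<Longrightarrow> l < q \<Longrightarrow> 0 < l \<Longrightarrow> val w m (6 * q) l = 1"
proof -
  assume *: "ready R m" "l < q" "0 < l"
  then have n: "l = 1 + (l - 1)" by simp
  have "val w m (6 * q + 1) (l - 1) = 0"
    using * by (intro val_zero) (auto simp: ready_def)
  then show ?thesis
    using * by (subst n, simp only: val_add val_one) (simp add: ready_def)
qed

definition "setup_time = 3 * w + 6 * K + 13 * gw + 100"

lemma tr_setup:
  assumes wf: "wf_state w (R, m)" and R: "R 1 = nw" "R 5 = gw" "m (R 2) = K"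
    and m: "\<And>x. q \<le> x \<Longrightarrow> m x = 0"
    and T: "setup_time \<le> T"
    and Q: "\<And>R' m'. wf_state w (R', m') \<Longrightarrow> ready R' m' \<Longrightarrow> (\<And>r. r < 10 \<Longrightarrow> R' r = R r) \<Longrightarrow>
        (\<And>x. x < q \<or> 5 * q \<le> x \<and> x \<noteq> 6 * q \<or> x = q + 1 \<or> (q + 1 \<le> x \<and> x < q + 1 + nw) \<Longrightarrow> m' x = m x) \<Longrightarrow> Q (R', m')"
  shows "tr w mc setup_com (R, m) T Q"
proof -
  have w0: "0 < w" using w by simp
  have one: "1 mod (2::nat) ^ w = 1" using w0 by simp
  have K4: "4 * K < 2 ^ w"
  proof -
    have "2 * s < W" using m0 y0_big s_pows W_thr unfolding m0_def
      using mult_le_mono2[of 2 y0 s] by linarith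
    then show ?thesis using K by (simp add: W_def)
  qed
  have fits': "nw + gw + pad + 5 \<le> q" using fits by (simp add: \<mu>_def)
  define low where "low = (\<lambda>R1. \<forall>r<10. R1 r = R r)"
  have low_upd: "low (R1(k := x)) = low R1" if "10 \<le> k" for R1 k x
    using that by (auto simp: low_def)
  have low_upd_num: "low (R1(numeral k := x)) = low R1" if "10 \<le> (numeral k :: nat)" for R1 k x
    using that by (rule low_upd)
  define P1 where "P1 = (\<lambda>(R1, m1). m1 = m \<and> R1 40 = 1 \<and> R1 10 = 0 \<and> R1 41 = (1::nat) \<and> low R1)"
  define P2 where "P2 = (\<lambda>(R1, m1). m1 = m \<and> R1 10 = w \<and> R1 41 = (1::nat) \<and> low R1)"
  define P3 where "P3 = (\<lambda>(R1, m1). m1 = m \<and> R1 10 = w \<and> R1 41 = 1 \<and> R1 11 = W - 1 \<and> R1 44 = 2 * K \<and>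
    R1 42 = 1 \<and> R1 43 = of_bool (1 < 2 * K) \<and> low R1)"
  define P4 where "P4 = (\<lambda>(R1, m1). m1 = m \<and> R1 10 = w \<and> R1 41 = (1::nat) \<and> R1 11 = W - 1 \<and> R1 42 = s \<and> low R1)"
  define P5 where "P5 = (\<lambda>(R1, m1). m1 = m \<and> R1 10 = w \<and> R1 41 = (1::nat) \<and> R1 11 = W - 1 \<and> R1 12 = \<sigma> \<and>
    R1 13 = thr \<and> R1 14 = m0 \<and> R1 15 = e0 \<and> R1 16 = \<mu> \<and> low R1)"
  define P6 where "P6 = (\<lambda>(R1, m1). m1 = m(4 * q := W - 1, 6 * q := 1) \<and> regs_ok R1 \<and> R1 35 = 5 * q \<and>
    R1 36 = 6 * q \<and> R1 37 = 7 * q \<and> R1 38 = 8 * q \<and> R1 39 = 9 * q \<and> R1 60 = lam \<and> R1 61 = pad \<and>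
    R1 62 = q + nw + 2 \<and> R1 63 = gw + 1 \<and> low R1)"
  have s1: "tr w mc (Const 40 1 ;; Const 10 0 ;; Const 41 1) (R, m) 3 P1"
    by (rule tr_straight) (use w0 wf in \<open>simp_all add: P1_def low_upd low_def\<close>)
  have s2: "tr w mc (While 40 (Op Add 40 40 40 ;; Op Add 10 10 41)) st (3 * w + 1) P2"
    if "wf_state w st" "P1 st" for st
    using that by (cases st) (auto simp: P1_def P2_def low_def intro!: tr_word_length w0)
  have s3: "tr w mc (Const 43 0 ;; Op Sub 11 43 41 ;; Load 44 2 ;; Op Add 44 44 44 ;; Const 42 1 ;; Op Lt 43 42 44)
      st 6 P3" if "wf_state w st" "P2 st" for st
  proof -
    have "(K + K) mod 2 ^ w = 2 * K" using K4 by simp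
    then show ?thesis
      using that w0 R one by (intro tr_straight) (auto simp: P2_def P3_def W_def low_def)
  qed
  have s4: "tr w mc (While 43 (Op Add 42 42 42 ;; Op Lt 43 42 44)) st (6 * K + 1) P4"
    if "wf_state w st" "P3 st" for st
  proof -
    obtain R1 m1 where st: "st = (R1, m1)" by fastforce
    obtain k where k: "s = 2 ^ k" using K(4) by blast
    have uniq: "x = s" if "\<exists>j. x = 2 ^ j" "2 * K \<le> x" "x < 4 * K" for x
      using that K(2,3) power_two_unique[of K _ k] unfolding k by blast
    have P: "m1 = m" "R1 10 = w" "R1 41 = 1" "R1 11 = W - 1" "R1 44 = 2 * K" "R1 42 = 1"
      "R1 43 = of_bool (1 < 2 * K)" "low R1"
      using that(2) unfolding P3_def st by blast+
    show ?thesis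
      unfolding st
    proof (rule tr_scale[OF w0 _ K(1) K4 P(6,5,7) le_refl])
      show "wf_state w (R1, m1)" using that st by simp
    next
      fix R' assume "\<exists>j. R' 42 = 2 ^ j" "2 * K \<le> R' 42" "R' 42 < 4 * K"
        and fr: "\<And>r. r \<noteq> 42 \<Longrightarrow> r \<noteq> 43 \<Longrightarrow> R' r = R1 r"
      then have "R' 42 = s" by (intro uniq)
      then show "P4 (R', m1)" using P fr by (simp add: P4_def low_def)
    qed
  qed
  have s5: "tr w mc (Const 45 4 ;; Op Mul 12 42 45 ;; Const 45 3 ;; Op Add 12 12 45 ;;
      Const 45 2 ;; Op Sub 46 10 45 ;; Op Shl 13 41 46 ;;
      Op Add 46 42 42 ;; Op Add 46 46 41 ;; Op Div 46 11 46 ;; Op Mul 14 42 46 ;;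
      Const 45 3 ;; Op Add 16 1 5 ;; Op Add 16 16 45 ;;
      Op Sub 15 16 41 ;; Op Mul 15 15 10) st 16 P5" (is "tr _ _ ?p _ _ _")
    if "wf_state w st" "P4 st" for st
  proof -
    obtain R1 m1 where st: "st = (R1, m1)" by fastforce
    have P: "m1 = m" "R1 10 = w" "R1 41 = 1" "R1 11 = W - 1" "R1 42 = s" "low R1"
      using that(2) unfolding P4_def st by blast+
    have R1: "R1 1 = nw" "R1 5 = gw" using P(6) R by (simp_all add: low_def)
    have ww: "w < 2 ^ w" by (rule less_exp)
    have "1 * \<sigma> \<le> (e0 + 1) * \<sigma>" "e0 * 1 \<le> (e0 + 1) * \<sigma>"
      by (intro mult_le_mono; simp add: \<sigma>_def)+
    then have lt: "\<sigma> < 2 ^ w" "e0 < 2 ^ w" "m0 < 2 ^ w"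
      using iterations m0 W_thr unfolding W_def by linarith+
    then have a: "(s * 4 mod 2 ^ w) = 4 * s" "(4 * s + 3) mod 2 ^ w = \<sigma>"
       "(s + s) mod 2 ^ w = 2 * s" "(2 * s + 1) mod 2 ^ w = 2 * s + 1"
      by (auto simp: \<sigma>_def)
    have b: "(w + 2 ^ w - 2) mod 2 ^ w = w - 2"
      using w ww by (intro mod_sub_nat) linarith+
    have c: "4 mod 2 ^ w = (4::nat)" "3 mod 2 ^ w = (3::nat)" "2 mod 2 ^ w = (2::nat)"
      using w ww by (intro mod_less; linarith)+
    have d: "2 ^ (w - 2) mod 2 ^ w = thr"
      using w by (simp add: thr_def)
    have e: "(s * y0) mod 2 ^ w = m0" using lt by (simp add: m0_def)
    have f: "(nw + gw) mod 2 ^ w = nw + gw" "(nw + gw + 3) mod 2 ^ w = \<mu>"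
      using fits q by (auto simp: \<mu>_def)
    have g: "(\<mu> + 2 ^ w - 1) mod 2 ^ w = \<mu> - 1"
      using fits q by (intro mod_sub_nat; simp add: \<mu>_def)
    have h: "((\<mu> - 1) * w) mod 2 ^ w = e0" using lt by (simp add: e0_def)
    show ?thesis
      unfolding st
    proof (rule tr_straight)
      show "P5 (ex w ?p (R1, m1))"
        unfolding P5_def
        by (simp add: P(1-5) R1 a b c d e f g h y0_def[symmetric] low_upd P(6) del: One_nat_def)
    qed (use w0 that(1) in \<open>simp_all add: st\<close>)
  qed
  have ww: "w < 2 ^ w" by (rule less_exp)
  have small: "a mod 2 ^ w = a" if "a < 16 * q" for a using that q by simp
  have c: "4 mod 2 ^ w = (4::nat)" "2 mod 2 ^ w = (2::nat)"
    using w ww by (intro mod_less; linarith)+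
  have d: "(w div 4 + 2 ^ w - 1) mod 2 ^ w = w div 4 - 1" "(w + 2 ^ w - 4) mod 2 ^ w = w - 4"
    using w ww div_le_dividend[of w 4] by (intro mod_sub_nat; linarith)+
  have "(2::nat) ^ (w div 4 - 1) < 2 ^ w" "(2::nat) ^ (w - 4) < 2 ^ w"
    using w by (auto intro!: power_strict_increasing)
  then have e: "2 ^ (w div 4 - 1) mod 2 ^ w = (2::nat) ^ (w div 4 - 1)" "2 ^ (w - 4) mod 2 ^ w = (2::nat) ^ (w - 4)"
    by simp_all
  have q': "2 ^ (w - 4) = q"
  proof -
    have "w = 4 + (w - 4)" using w by simp
    then have "(2::nat) ^ w = 16 * 2 ^ (w - 4)" using power_add[of "2::nat" 4 "w - 4"] by simp
    then show ?thesis using q by simp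
  qed
  have e': "2 ^ (w - 4) mod 2 ^ w = q" using e(2) q' by simp
  have l: "(2 ^ (w div 4 - 1) div w + 1) mod 2 ^ w = lam" "(lam + 2 ^ w - \<mu>) mod 2 ^ w = pad"
  proof -
    have "lam < 2 ^ w" "lam - \<mu> = pad" "\<mu> \<le> lam" using lam(2) fits q by linarith+
    then show "(2 ^ (w div 4 - 1) div w + 1) mod 2 ^ w = lam" "(lam + 2 ^ w - \<mu>) mod 2 ^ w = pad"
      unfolding lam(1)[symmetric] using mod_sub_nat[of lam "2 ^ w" \<mu>] by simp_all
  qed
  have r: "(q + 1) mod 2 ^ w = q + 1" "(q + q) mod 2 ^ w = 2 * q" "(2 * q + q) mod 2 ^ w = 3 * q"
    "(3 * q + q) mod 2 ^ w = 4 * q" "(4 * q + q) mod 2 ^ w = 5 * q" "(5 * q + pad) mod 2 ^ w = 5 * q + pad"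
    "(5 * q + q) mod 2 ^ w = 6 * q" "(6 * q + q) mod 2 ^ w = 7 * q" "(7 * q + q) mod 2 ^ w = 8 * q"
    "(8 * q + q) mod 2 ^ w = 9 * q" "(q + 1 + nw) mod 2 ^ w = q + 1 + nw"
    "(q + 1 + nw + 1) mod 2 ^ w = q + nw + 2" "(gw + 1) mod 2 ^ w = gw + 1"
    using fits' by (subst small; simp)+
  define P5a where "P5a = (\<lambda>(R1, m1). P5 (R1, m1) \<and> R1 60 = lam \<and> R1 61 = pad)"
  define P5b where "P5b = (\<lambda>(R1, m1). P5a (R1, m1) \<and> R1 17 = q \<and> R1 30 = q + 1 \<and> R1 18 = 2 * q \<and>
     R1 31 = 3 * q \<and> R1 32 = 4 * q \<and> R1 35 = 5 * q \<and> R1 19 = 5 * q + pad)"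
  have s6a: "tr w mc (Const 45 2 ;; Op Shr 46 10 45 ;; Op Sub 46 46 41 ;; Op Shl 46 41 46 ;; Op Div 60 46 10 ;;
      Op Add 60 60 41 ;; Op Sub 61 60 16) st 7 P5a"
    if "wf_state w st" "P5 st" for st
  proof (cases st)
    case st: (Pair R1 m1)
    have P: "m1 = m" "R1 10 = w" "R1 41 = 1" "R1 11 = W - 1" "R1 12 = \<sigma>"
      "R1 13 = thr" "R1 14 = m0" "R1 15 = e0" "R1 16 = \<mu>" "low R1"
      using that(2) unfolding P5_def st by blast+
    show ?thesis
      unfolding st
      by (rule tr_straight)
        (use w0 that(1) in \<open>simp_all add: st low_upd P(10) P5_def P5a_def P(1-9) c d e l del: One_nat_def\<close>)
  qed
  have s6b: "tr w mc (Const 45 4 ;; Op Sub 46 10 45 ;; Op Shl 17 41 46 ;; Op Add 30 17 41 ;;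
      Op Add 18 17 17 ;; Op Add 31 18 17 ;; Op Add 32 31 17 ;; Op Add 35 32 17 ;; Op Add 19 35 61) st 9 P5b"
    (is "tr _ _ ?p _ _ _")
    if "wf_state w st" "P5a st" for st
  proof (cases st)
    case st: (Pair R1 m1)
    have P: "m1 = m" "R1 10 = w" "R1 41 = 1" "R1 11 = W - 1" "R1 12 = \<sigma>"
      "R1 13 = thr" "R1 14 = m0" "R1 15 = e0" "R1 16 = \<mu>" "low R1" "R1 60 = lam" "R1 61 = pad"
      using that(2) unfolding P5_def P5a_def st by blast+
    show ?thesis
      unfolding st
    proof (rule tr_straight[OF _ w0])
      show "wf_state w (R1, m1)" using that(1) st by simp
      show "P5b (ex w ?p (R1, m1))"
        by (simp only: exec_simps low_upd_num P5_def P5a_def P5b_def P c d e' r)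
    qed simp_all
  qed
  have s6c: "tr w mc (Op Add 36 35 17 ;; Op Add 37 36 17 ;; Op Add 38 37 17 ;; Op Add 39 38 17 ;;
      Op Add 62 30 1 ;; Op Add 62 62 41 ;; Op Add 63 5 41 ;; Store 32 11 ;; Store 36 41) st 9 P6"
    (is "tr _ _ ?p _ _ _")
    if "wf_state w st" "P5b st" for st
  proof (cases st)
    case st: (Pair R1 m1)
    have P: "m1 = m" "R1 10 = w" "R1 41 = 1" "R1 11 = W - 1" "R1 12 = \<sigma>"
      "R1 13 = thr" "R1 14 = m0" "R1 15 = e0" "R1 16 = \<mu>" "low R1" "R1 60 = lam" "R1 61 = pad"
      "R1 17 = q" "R1 30 = q + 1" "R1 18 = 2 * q"
     "R1 31 = 3 * q" "R1 32 = 4 * q" "R1 35 = 5 * q" "R1 19 = 5 * q + pad"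
      using that(2) unfolding P5_def P5a_def P5b_def st by blast+
    have R1: "R1 1 = nw" "R1 5 = gw" using P(10) R by (simp_all add: low_def)
    show ?thesis
      unfolding st
    proof (rule tr_straight[OF _ w0])
      show "wf_state w (R1, m1)" using that(1) st by simp
      show "P6 (ex w ?p (R1, m1))"
        by (simp only: exec_simps low_upd_num P6_def regs_ok_def P R1 r)
    qed simp_all
  qed
  have s7: "tr w mc (sub_com 37 36 62 63) st (13 * (gw + 1) + 8) Q" if "wf_state w st" "P6 st" for st
  proof -
    obtain R1 m1 where st: "st = (R1, m1)" by fastforce
    have P: "m1 = m(4 * q := W - 1, 6 * q := 1)" "regs_ok R1" "R1 35 = 5 * q"
      "R1 36 = 6 * q" "R1 37 = 7 * q" "R1 38 = 8 * q" "R1 39 = 9 * q" "R1 60 = lam" "R1 61 = pad"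
      "R1 62 = q + nw + 2" "R1 63 = gw + 1" "low R1"
      using that(2) unfolding P6_def st by blast+
    have v0: "val w m1 (7 * q) (gw + 1) = 0"
      using m fits' by (intro val_zero) (simp add: P(1))
    have "val w m1 (6 * q + 1) gw = 0"
      using m fits' by (intro val_zero) (simp add: P(1))
    then have "val w m1 (6 * q) (1 + gw) = 1"
      by (simp only: val_add val_one) (simp add: P(1))
    then have v1: "val w m1 (6 * q) (gw + 1) = 1"
      by (simp only: add.commute)
    show ?thesis
      unfolding st
    proof (rule tr_sub)
      fix R2 m2
      assume wf2: "wf_state w (R2, m2)" and fr: "\<And>r. r \<notin> {20..29} \<Longrightarrow> R2 r = R1 r"
        and mem: "\<And>x. \<not> (R1 62 \<le> x \<and> x < R1 62 + R1 63) \<Longrightarrow> m2 x = m1 x"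
        and b: "R2 25 = of_bool (val w m1 (R1 37) (R1 63) < val w m1 (R1 36) (R1 63))"
        and v: "val w m2 (R1 62) (R1 63) + val w m1 (R1 36) (R1 63) =
          val w m1 (R1 37) (R1 63) + R2 25 * 2 ^ (w * R1 63)"
      \<comment> \<open>Subtracting 1 from 0 borrows through all words and leaves the block of words
        \<open>W - 1\<close> required by \<open>mem_ok\<close>.\<close>
      have b1: "R2 25 = 1"
        using b unfolding P(4,5,10,11) v0 v1 by simp
      have "val w m2 (q + nw + 2) (gw + 1) + 1 = W ^ (gw + 1)"
        using v unfolding P(4,5,10,11) v0 v1 b1 W_power by simp
      then have top: "val w m2 (q + nw + 2) (gw + 1) = W ^ (gw + 1) - 1"
        by linarith
      have mem': "m2 x = (if x = 4 * q then W - 1 else if x = 6 * q then 1 else m x)"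
        if "\<not> (q + nw + 2 \<le> x \<and> x < q + nw + gw + 3)" for x
        using mem[of x] that fits' by (auto simp: P)
      have "mem_ok m2"
        unfolding mem_ok_def using top m fits' by (auto simp: mem')
      moreover have "regs_ok R2"
        by (rule regs_ok_cong[OF P(2)], rule fr)
      ultimately have "ready R2 m2"
        unfolding ready_def using m fits' by (simp add: mem' fr P(3-9))
      then show "Q (R2, m2)"
        using wf2 P(12) m fits' by (intro Q) (auto simp: mem' low_def fr)
    qed (use w0 that(1) fits' q in \<open>auto simp: st P\<close>)
  qed
  show ?thesis
    unfolding setup_com_def
    by (rule tr_Seq[OF s1], rule tr_Seq[OF s2], assumption+, rule tr_Seq[OF s3], assumption+,
        rule tr_Seq[OF s4], assumption+, rule tr_Seq[OF s5], assumption+, rule tr_Seq[OF s6a], assumption+,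
        rule tr_Seq[OF s6b], assumption+, rule tr_Seq[OF s6c], assumption+,
        rule s7, assumption+, (rule order_refl)+) (use T in \<open>simp add: setup_time_def\<close>)
qed

end

section \<open>Sampling and evaluation programs\<close>

lemma tr_bind:
  assumes "tr w mc p s T1 (\<lambda>s'. tr w mc q s' T2 Q)" "T1 + T2 \<le> T"
  shows "tr w mc (Seq p q) s T Q"
  using assms by (auto intro: tr_Seq)

lemma tr_bind_straight:
  assumes "straight p" "w > 0" "wf_state w s" "ex w p s = s'"
    "wf_state w s' \<Longrightarrow> tr w mc q s' T2 Q" "straight_cost p + T2 \<le> T"
  shows "tr w mc (Seq p q) s T Q"
proof (rule tr_bind[OF _ assms(6)], rule tr_straight[OF assms(1-3) le_refl])
  have "wf_state w s'"
    using run_ex[OF assms(1), of w mc s] wf_state_run assms(2-4) by blast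
  then show "tr w mc q (ex w p s) T2 Q" using assms(4,5) by simp
qed

lemma val_digit:
  assumes "\<And>x. m x < 2 ^ w" "j < l"
  shows "m (a + j) = val w m a l div 2 ^ (w * j) mod 2 ^ w"
proof -
  have n: "l = j + (1 + (l - j - 1))" using assms(2) by simp
  have "val w m a l = val w m a j + 2 ^ (w * j) * (m (a + j) + 2 ^ w * val w m (a + j + 1) (l - j - 1))"
    by (subst n) (simp only: val_add val_one mult_1_right)
  then have "val w m a l div 2 ^ (w * j) = m (a + j) + 2 ^ w * val w m (a + j + 1) (l - j - 1)"
    using val_less[of m w a j] assms(1) by simp
  then show ?thesis using assms(1)[of "a + j"] by simp
qed

lemma val_upd:
  assumes "j < l"
  shows "val w (m(a + j := y)) a l + m (a + j) * 2 ^ (w * j) = val w m a l + y * 2 ^ (w * j)"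
  using assms
proof (induction l)
  case (Suc l)
  show ?case
  proof (cases "j = l")
    case True
    have "val w (m(a + j := y)) a l = val w m a l"
      using True by (intro val_cong) auto
    then show ?thesis unfolding True val_Suc fun_upd_same by linarith
  next
    case False
    then show ?thesis using Suc by (simp add: val_Suc)
  qed
qed simp

text \<open>Binary search, one bit per round, for the number of indices \<open>i\<close> whose tail \<open>\<Gamma> i\<close> reaches the random value. It
  starts from the all-ones argument; a round clears the bit whose index is in register 50 and restores it if
  the tail there is still large enough.\<close>

definition search_body :: com where
  "search_body =
     (Const 51 1 ;; Op Sub 50 50 51 ;; Op Div 52 50 10 ;; Op Add 52 52 30 ;; Op Mod 53 50 10 ;;
      Op Shl 53 51 53 ;; Load 54 52 ;; Op Sub 54 54 53 ;; Store 52 54) ;;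
     eval_com ;;
     sub_com 74 19 31 16 ;;
     If 25 Skip (Op Add 54 54 53 ;; Store 52 54)"

text \<open>Region 8 receives \<open>u - 1\<close>, whose upper \<open>\<mu>\<close> words \<open>x\<close> decide everything, because all tails are multiples of
  \<open>W ^ pad\<close>. The sign of the noise is the most significant bit of \<open>x\<close> (register 68); the search uses \<open>x\<close> or its
  complement, formed in region 10 from the all-ones integer in region 9.\<close>

definition sign_com :: com where
  "sign_com =
     Op Add 64 38 61 ;; Const 45 1 ;; Op Add 65 38 60 ;; Op Sub 65 65 45 ;; Load 66 65 ;;
     Op Add 67 13 13 ;; Op Lt 68 66 67 ;; Op Add 69 39 17 ;; Op Add 70 69 17"

definition addr_com :: com where
  "addr_com = Op Add 71 70 17 ;; Op Add 72 71 17 ;; Op Add 73 72 17 ;; Op Mul 50 1 10"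

definition prepare_com :: com where
  "prepare_com =
     setup_com ;; sub_com 8 36 38 60 ;; sign_com ;; addr_com ;;
     sub_com 37 36 39 16 ;; sub_com 39 64 69 16 ;; If 68 (Mov 74 69) (Mov 74 64) ;; sub_com 37 36 30 1"

text \<open>The count is copied to an area of zeros, which extends it to \<open>nw\<close> words.
  For downward noise a borrow means output 0, given as an integer of zero words. For upward noise
  the sum is formed as \<open>n - ((n - c) - J)\<close>, so subtraction alone suffices; if
  \<open>n - c < J\<close>, registers 0 and 1 still designate the input \<open>n\<close>, the
  clamped value.\<close>

definition finish_com :: com where
  "finish_com =
     sub_com 6 37 70 7 ;;
     If 68
       (sub_com 70 30 71 1 ;; If 25 (Const 1 0) (Mov 0 71))
       (sub_com 0 70 71 1 ;; sub_com 71 30 72 1 ;; If 25 Skip (sub_com 0 72 73 1 ;; Mov 0 73))"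

definition P_main :: com where
  "P_main = prepare_com ;; While 50 search_body ;; finish_com"

text \<open>The case \<open>z = n\<close> has its own branch because the value
  \<open>W ^ lam\<close> is one word longer than region 5 provides for in the other cases; there the
  zero words of the padding are part of the output.\<close>

definition Q_main :: com where
  "Q_main =
     setup_com ;; sub_com 6 0 31 1 ;;
     If 25
       (sub_com 6 37 30 1 ;; eval_com ;; Mov 0 35 ;; Mov 1 60)
       (Const 51 1 ;; Op Add 50 35 60 ;; Store 50 51 ;; Mov 0 35 ;; Op Add 1 60 51)"

context prog
begin

text \<open>Here \<open>J\<close> is the number of accepting indices below \<open>W ^ nw - 1\<close>.\<close>

definition "accepts xb i \<longleftrightarrow> W ^ \<mu> \<le> xb + \<Gamma> i"

definition "found xb J \<longleftrightarrow> J < W ^ nw \<and> (J = 0 \<or> accepts xb (J - 1)) \<and> (J + 1 = W ^ nw \<or> \<not> accepts xb J)"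

section \<open>Binary search for the noise\<close>

definition "search_step_time = eval_time + 13 * \<mu> + 30"

text \<open>In the invariant the array holds \<open>p + 2 ^ R1 50 - 1\<close> with \<open>p\<close>
  a multiple of the power, that is, decided high bits followed by ones, and the sought number lies
  in \<open>[p, p + 2 ^ R1 50)\<close>. Clearing the next bit probes the last index of the lower
  half; acceptance restores the bit and moves \<open>p\<close> to the upper half.\<close>

lemma tr_search:
  assumes wf: "wf_state w (R, m)" and ready: "ready R m"
    and R: "R 50 = nw * w" "8 * q \<le> R 74" "R 74 + \<mu> < 16 * q" "val w m (R 74) \<mu> = xb"
    and init: "val w m (q + 1) nw + 1 = W ^ nw"
    and T: "nw * w * (search_step_time + 1) + 1 \<le> T"
    and Q: "\<And>R' m'. wf_state w (R', m') \<Longrightarrow> ready R' m' \<Longrightarrow>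
        (\<And>r. r \<notin> {20..29} \<Longrightarrow> r \<notin> {40..59} \<Longrightarrow> R' r = R r) \<Longrightarrow>
        (\<And>x. x < q \<or> 8 * q \<le> x \<Longrightarrow> m' x = m x) \<Longrightarrow> found xb (val w m' (q + 1) nw) \<Longrightarrow> Q (R', m')"
  shows "tr w mc (While 50 search_body) (R, m) T Q"
proof -
  define I where "I = (\<lambda>(R1, m1). ready R1 m1 \<and> (\<forall>r. r \<notin> {20..29} \<longrightarrow> r \<notin> {40..59} \<longrightarrow> R1 r = R r) \<and>
    (\<forall>x. x < q \<or> 8 * q \<le> x \<longrightarrow> m1 x = m x) \<and> R1 50 \<le> nw * w \<and>
    (\<exists>p. val w m1 (q + 1) nw + 1 = p + 2 ^ R1 50 \<and> 2 ^ R1 50 dvd p \<and> (p = 0 \<or> accepts xb (p - 1)) \<and>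
      (p + 2 ^ R1 50 = W ^ nw \<or> \<not> accepts xb (p + 2 ^ R1 50 - 1))))"
  have w0: "0 < w" using w by simp
  have qs: "nw + gw + pad + 5 \<le> q" "\<mu> + pad + 2 \<le> q" using fits by (auto simp: \<mu>_def)
  have step: "tr w mc search_body (R1, m1) search_step_time (\<lambda>s'. I s' \<and> fst s' 50 < fst (R1, m1) 50)"
    if wf1: "wf_state w (R1, m1)" and I1: "I (R1, m1)" and ne: "R1 50 \<noteq> 0" for R1 m1
  proof -
    define t where "t = R1 50 - 1"
    have t: "R1 50 = Suc t" using ne by (simp add: t_def)
    define j b where "j = t div w" and "b = t mod w"
    have tjb: "t = w * j + b" "b < w" using w0 by (simp_all add: j_def b_def)
    have I1': "ready R1 m1" "\<And>r. r \<notin> {20..29} \<Longrightarrow> r \<notin> {40..59} \<Longrightarrow> R1 r = R r"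
      "\<And>x. x < q \<or> 8 * q \<le> x \<Longrightarrow> m1 x = m x" "t < nw * w"
      using I1 unfolding I_def by (auto simp: t)
    from I1 obtain p where p: "val w m1 (q + 1) nw + 1 = p + 2 ^ Suc t" "2 ^ Suc t dvd p"
      "p = 0 \<or> accepts xb (p - 1)" "p + 2 ^ Suc t = W ^ nw \<or> \<not> accepts xb (p + 2 ^ Suc t - 1)"
      unfolding I_def t[symmetric] by auto
    have j: "j < nw" unfolding j_def using I1'(4) by (rule less_mult_imp_div_less)
    define V where "V = val w m1 (q + 1) nw"
    define d where "d = m1 (q + 1 + j)"
    have memlt: "\<And>x. m1 x < 2 ^ w" using wf1 by (simp add: wf_state_def)
    \<comment> \<open>Bit \<open>t\<close> is still set because all undecided low bits are ones, so
      the bit can be cleared by a subtraction within one word.\<close>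
    have d: "2 ^ b \<le> d"
    proof -
      obtain k where k: "p = 2 ^ Suc t * k" using p(2) by blast
      have "V + 1 = 2 ^ t * (2 * k + 1) + 2 ^ t"
        using p(1) unfolding V_def[symmetric] k by (simp add: algebra_simps)
      moreover have "2 ^ t * Suc (2 * k + 1) = 2 ^ t * (2 * k + 1) + 2 ^ t" "(1::nat) \<le> 2 ^ t"
        by simp_all
      ultimately have "V div 2 ^ t = 2 * k + 1"
        by (intro div_nat_eqI) linarith+
      then have "bit V t" by (simp add: bit_iff_odd)
      then have "bit (take_bit w (drop_bit (w * j) V)) b"
        unfolding bit_take_bit_iff bit_drop_bit_eq using tjb by simp
      moreover have "d = take_bit w (drop_bit (w * j) V)"
        unfolding d_def V_def take_bit_eq_mod drop_bit_eq_div by (rule val_digit[OF memlt j])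
      ultimately have "bit d b" by simp
      then show ?thesis
        by (metis bit_iff_odd div_less even_zero not_less)
    qed
    define m2 where "m2 = m1(q + 1 + j := d - 2 ^ b)"
    define R2 where "R2 = R1(51 := 1, 50 := t, 52 := j + (q + 1), 53 := 2 ^ b, 54 := d - 2 ^ b)"
    have "val w m2 (q + 1) nw + d * 2 ^ (w * j) = V + (d - 2 ^ b) * 2 ^ (w * j)"
      unfolding m2_def d_def V_def by (rule val_upd[OF j])
    moreover have "d * 2 ^ (w * j) = (d - 2 ^ b) * 2 ^ (w * j) + 2 ^ t"
      using d by (simp add: tjb(1) power_add diff_mult_distrib)
    ultimately have V2: "val w m2 (q + 1) nw + 2 ^ t = V" by linarith
    then have V2': "val w m2 (q + 1) nw + 1 = p + 2 ^ t"
      using p(1) unfolding V_def[symmetric] by simp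
    have regs: "R1 10 = w" "R1 30 = q + 1" "regs_ok R1"
      using I1'(1) by (simp_all add: ready_def regs_ok_def)
    have ex: "ex w (Const 51 1 ;; Op Sub 50 50 51 ;; Op Div 52 50 10 ;; Op Add 52 52 30 ;; Op Mod 53 50 10 ;;
        Op Shl 53 51 53 ;; Load 54 52 ;; Op Sub 54 54 53 ;; Store 52 54) (R1, m1) = (R2, m2)"
    proof -
      have "Suc t < 2 ^ w" using wf1 by (metis t wf_state_reg)
      then have a: "(Suc t + 2 ^ w - 1) mod 2 ^ w = t"
        using mod_sub_nat[of "Suc t" "2 ^ w" 1] by simp
      have c: "(j + (q + 1)) mod 2 ^ w = j + (q + 1)"
        using j qs q by simp
      have e: "2 ^ b mod 2 ^ w = (2::nat) ^ b" using tjb by simp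
      have f: "(d + 2 ^ w - 2 ^ b) mod 2 ^ w = d - 2 ^ b"
        using d memlt unfolding d_def by (intro mod_sub_nat) auto
      have g: "1 mod 2 ^ w = (1::nat)" using w0 by simp
      have h: "m1 (j + (q + 1)) = d" by (simp add: d_def add.commute)
      show ?thesis
        by (simp only: exec_simps regs t a c e f g h j_def[symmetric] b_def[symmetric])
          (auto simp: R2_def m2_def fun_eq_iff add.commute)
    qed
    have ready2: "ready R2 m2"
      by (rule ready_cong[OF I1'(1)]) (use j in \<open>auto simp: R2_def m2_def\<close>)
    then have rm2: "regs_ok R2" "mem_ok m2" by (simp_all add: ready_def)
    have j2: "j + (q + 1) < 2 * q" using j qs by simp
    show ?thesis
      unfolding search_body_def
    proof (rule tr_bind_straight[OF _ w0 wf1 ex], simp)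
      assume wf2: "wf_state w (R2, m2)"
      show "tr w mc (eval_com ;; sub_com 74 19 31 16 ;; If 25 Skip (Op Add 54 54 53 ;; Store 52 54)) (R2, m2)
         (eval_time + (13 * \<mu> + 8 + 10)) (\<lambda>s'. I s' \<and> fst s' 50 < fst (R1, m1) 50)"
      proof (rule tr_bind[OF _ le_refl], rule tr_eval[OF wf2 rm2 le_refl])
        fix R3 m3
        assume wf3: "wf_state w (R3, m3)" and R3: "\<And>r. r \<notin> {20..29} \<Longrightarrow> r \<notin> {40..49} \<Longrightarrow> R3 r = R2 r"
          and m3: "\<And>x. \<not> (3 * q \<le> x \<and> x < 4 * q) \<Longrightarrow> \<not> (5 * q + pad \<le> x \<and> x < 5 * q + pad + \<mu>) \<Longrightarrow> m3 x = m2 x"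
          and A: "val w m3 (5 * q + pad) \<mu> + \<Gamma> (val w m2 (q + 1) nw) = W ^ \<mu>"
        have r3: "R3 74 = R 74" "R3 19 = 5 * q + pad" "R3 31 = 3 * q" "R3 16 = \<mu>"
          using R3 rm2(1) I1'(2) by (auto simp: regs_ok_def R2_def)
        have xb: "val w m3 (R 74) \<mu> = xb"
        proof -
          have "val w m3 (R 74) \<mu> = val w m (R 74) \<mu>"
          proof (rule val_cong)
            fix x assume x: "R 74 \<le> x" "x < R 74 + \<mu>"
            then have "m3 x = m2 x" using R qs by (intro m3) auto
            also have "\<dots> = m1 x" using x R j2 by (auto simp: m2_def)
            also have "\<dots> = m x" using x R by (intro I1') auto
            finally show "m3 x = m x" .
          qed
          then show ?thesis using R by simp
        qed
        show "tr w mc (sub_com 74 19 31 16 ;; If 25 Skip (Op Add 54 54 53 ;; Store 52 54)) (R3, m3)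
            (13 * \<mu> + 8 + 10) (\<lambda>s'. I s' \<and> fst s' 50 < fst (R1, m1) 50)"
        proof (rule tr_bind[OF _ le_refl], rule tr_sub[OF w0 wf3])
          fix R4 m4
          assume wf4: "wf_state w (R4, m4)" and R4: "\<And>r. r \<notin> {20..29} \<Longrightarrow> R4 r = R3 r"
            and m4: "\<And>x. \<not> (R3 31 \<le> x \<and> x < R3 31 + R3 16) \<Longrightarrow> m4 x = m3 x"
            and b4: "R4 25 = of_bool (val w m3 (R3 74) (R3 16) < val w m3 (R3 19) (R3 16))"
          have fr: "R4 r = R2 r" if "r \<notin> {20..29}" "r \<notin> {40..49}" for r
            using R3 R4 that by simp
          have mm: "m4 x = m2 x" if "\<not> (3 * q \<le> x \<and> x < 4 * q)" "\<not> (5 * q \<le> x \<and> x < 6 * q)" for x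
            using that m3[of x] m4[of x] r3 qs by auto
          have b: "R4 25 = 0 \<longleftrightarrow> accepts xb (val w m2 (q + 1) nw)"
            using b4 A unfolding r3 xb accepts_def by (auto simp del: W_pow_\<mu>)
          have ready4: "ready R4 m4"
            by (rule ready_cong[OF ready2]) (auto intro: fr mm)
          have V4: "val w m4 (q + 1) nw = val w m2 (q + 1) nw"
            using qs by (intro val_cong mm) auto
          have low4: "m4 x = m x" if "x < q \<or> 8 * q \<le> x" for x
            using that mm[of x] I1'(3)[of x] j2 by (auto simp: m2_def)
          have frR: "R4 r = R r" if "r \<notin> {20..29}" "r \<notin> {40..59}" for r
            using fr[of r] I1'(2)[of r] that by (auto simp: R2_def)
          have i: "val w m2 (q + 1) nw = p + 2 ^ t - 1" using V2' by simp
          show "tr w mc (If 25 Skip (Op Add 54 54 53 ;; Store 52 54)) (R4, m4) 10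
              (\<lambda>s'. I s' \<and> fst s' 50 < fst (R1, m1) 50)"
          proof (rule tr_If[where T = 2])
            assume "R4 25 \<noteq> 0"
            then have na: "\<not> accepts xb (p + 2 ^ t - 1)" using b i by simp
            have "I (R4, m4)"
              unfolding I_def using ready4 low4 frR V4 V2' p na I1'(4) fr[of 50]
              by (auto simp: R2_def intro!: exI[of _ p] dest: dvd_mult_right)
            then show "tr w mc Skip (R4, m4) 2 (\<lambda>s'. I s' \<and> fst s' 50 < fst (R1, m1) 50)"
              using wf4 w0 fr[of 50] t by (intro tr_straight) (auto simp: R2_def)
          next
            assume "R4 25 = 0"
            then have acc: "accepts xb (p + 2 ^ t - 1)" using b i by simp
            have r4: "R4 52 = q + 1 + j" "R4 53 = 2 ^ b" "R4 54 = d - 2 ^ b" "R4 50 = t"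
              using fr[of 52] fr[of 53] fr[of 54] fr[of 50] by (auto simp: R2_def)
            define m5 where "m5 = m4(q + 1 + j := d)"
            define R5 where "R5 = R4(54 := d)"
            have ex5: "ex w (Op Add 54 54 53 ;; Store 52 54) (R4, m4) = (R5, m5)"
            proof -
              have "(d - 2 ^ b + 2 ^ b) mod 2 ^ w = d"
                using d memlt unfolding d_def by simp
              then show ?thesis by (simp add: r4 R5_def m5_def)
            qed
            have "val w m5 (q + 1) nw = V"
            proof -
              have "val w m5 (q + 1) nw = val w (m2(q + 1 + j := d)) (q + 1) nw"
                using qs mm by (intro val_cong) (auto simp: m5_def)
              also have "m2(q + 1 + j := d) = m1" by (auto simp: m2_def d_def)
              finally show ?thesis by (simp add: V_def)
            qed
            then have V5: "val w m5 (q + 1) nw + 1 = (p + 2 ^ t) + 2 ^ t"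
              using p(1) by (simp add: V_def)
            have "ready R5 m5"
              by (rule ready_cong[OF ready4]) (use j in \<open>auto simp: R5_def m5_def\<close>)
            moreover have "2 ^ t dvd p + 2 ^ t"
              using p(2) by (auto dest: dvd_mult_right)
            moreover have p4: "p + 2 ^ t + 2 ^ t = W ^ nw \<or> \<not> accepts xb (p + 2 ^ t + 2 ^ t - 1)"
              using p(4) by (simp only: power_Suc mult_2 add.assoc)
            ultimately have "I (R5, m5)"
              unfolding I_def using low4 frR V5 p4 acc I1'(4) r4 j2 j
              by (auto simp: R5_def m5_def intro!: exI[of _ "p + 2 ^ t"])
            then have "I (ex w (Op Add 54 54 53 ;; Store 52 54) (R4, m4)) \<and>
                fst (ex w (Op Add 54 54 53 ;; Store 52 54) (R4, m4)) 50 < fst (R1, m1) 50"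
              unfolding ex5 using r4(4) t by (simp add: R5_def)
            then show "tr w mc (Op Add 54 54 53 ;; Store 52 54) (R4, m4) 2
                (\<lambda>s'. I s' \<and> fst s' 50 < fst (R1, m1) 50)"
              by (intro tr_straight) (use w0 wf4 in simp_all)
          qed simp
        qed (use r3 R qs q in auto)
      qed
    qed (simp add: search_step_time_def)
  qed
  have "tr w mc (While 50 search_body) (R, m) (nw * w * (search_step_time + 1) + 1)
     (\<lambda>s'. I s' \<and> fst s' 50 = 0)"
  proof (rule tr_While[where \<mu> = "\<lambda>s. fst s 50" and k = "nw * w", OF step wf])
    have "W ^ nw = 2 ^ (nw * w)" by (simp add: W_power mult.commute)
    then show "I (R, m)"
      unfolding I_def using ready init R by (auto intro!: exI[of _ 0])
  qed (use R in auto)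
  then show ?thesis
  proof (rule tr_weaken)
    fix s' assume s': "wf_state w s'" "I s' \<and> fst s' 50 = 0"
    obtain R' m' where st: "s' = (R', m')" by fastforce
    have lt: "val w m' (q + 1) nw < W ^ nw"
      unfolding W_power using s' st by (intro val_less) (auto simp: wf_state_def)
    have "found xb (val w m' (q + 1) nw)"
      using s'(2) lt unfolding I_def st found_def by auto
    then show "Q s'"
      using s' unfolding st by (intro Q) (auto simp: I_def)
  qed (use T in simp)
qed

lemma tr_sub_ready:
  assumes wf: "wf_state w (R, m)" and ready: "ready R m"
    and regs: "a \<notin> {20..29}" "b \<notin> {20..29}" "d \<notin> {20..29}" "l \<notin> {20..29}"
    and bnd: "R a + R l < 16 * q" "R b + R l < 16 * q" "R d + R l < 16 * q"
    and dis: "R a + R l \<le> R d \<or> R d + R l \<le> R a" "R b + R l \<le> R d \<or> R d + R l \<le> R b"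
    and target: "8 * q \<le> R d \<or> 3 * q \<le> R d \<and> R d + R l \<le> 4 * q \<or> q + 1 \<le> R d \<and> R d + R l \<le> q + 1 + nw"
    and T: "13 * R l + 8 \<le> T"
    and Q: "\<And>R' m'. wf_state w (R', m') \<Longrightarrow> ready R' m' \<Longrightarrow>
        (\<And>r. r \<notin> {20..29} \<Longrightarrow> R' r = R r) \<Longrightarrow>
        (\<And>x. \<not> (R d \<le> x \<and> x < R d + R l) \<Longrightarrow> m' x = m x) \<Longrightarrow>
        R' 25 = of_bool (val w m (R a) (R l) < val w m (R b) (R l)) \<Longrightarrow>
        val w m' (R d) (R l) + val w m (R b) (R l) =
          val w m (R a) (R l) + R' 25 * W ^ R l \<Longrightarrow> Q (R', m')"
  shows "tr w mc (sub_com a b d l) (R, m) T Q"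
proof (rule tr_sub[OF _ wf regs _ _ _ dis T])
  fix R' m'
  assume *: "wf_state w (R', m')" "\<And>r. r \<notin> {20..29} \<Longrightarrow> R' r = R r"
    "\<And>x. \<not> (R d \<le> x \<and> x < R d + R l) \<Longrightarrow> m' x = m x"
    "R' 25 = of_bool (val w m (R a) (R l) < val w m (R b) (R l))"
    "val w m' (R d) (R l) + val w m (R b) (R l) = val w m (R a) (R l) + R' 25 * 2 ^ (w * R l)"
  have "nw + 1 \<le> q" using fits by (simp add: \<mu>_def)
  have "ready R' m'"
    by (rule ready_cong[OF ready]) (use target \<open>nw + 1 \<le> q\<close> in \<open>auto intro!: *(2,3)\<close>)
  then show "Q (R', m')"
    using * by (intro Q) (auto simp: W_power)
qed (use w bnd q in auto)

section \<open>Sign of the noise and preparation of the search\<close>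

definition "prepare_time = setup_time + 13 * lam + 26 * \<mu> + 13 * nw + 100"

lemma qs: "nw + gw + pad + 5 \<le> q" "\<mu> + pad + 2 \<le> q" "lam + 2 \<le> q" "lam = pad + \<mu>" "\<mu> = nw + gw + 3"
  using fits lam by (auto simp: \<mu>_def)

lemma small_mod: "a < 16 * q \<Longrightarrow> a mod 2 ^ w = a"
  using q by simp

lemma ex_sign:
  assumes ready: "ready R m"
  defines "msw \<equiv> m (8 * q + lam - 1)"
  shows "ex w sign_com (R, m) = (R(64 := 8 * q + pad, 45 := 1, 65 := 8 * q + lam - 1, 66 := msw, 67 := 2 * thr,
        68 := of_bool (msw < 2 * thr), 69 := 10 * q, 70 := 11 * q), m)"
proof -
  have r: "R 38 = 8 * q" "R 61 = pad" "R 60 = lam" "R 13 = thr" "R 39 = 9 * q" "R 17 = q"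
    using ready by (simp_all add: ready_def regs_ok_def)
  have s: "(8 * q + pad) mod 2 ^ w = 8 * q + pad" "(8 * q + lam) mod 2 ^ w = 8 * q + lam"
    "(9 * q + q) mod 2 ^ w = 10 * q" "(10 * q + q) mod 2 ^ w = 11 * q"
    using qs by (subst small_mod; simp)+
  have one: "1 mod 2 ^ w = (1::nat)" using w by simp
  have t: "(8 * q + lam + 2 ^ w - 1) mod 2 ^ w = 8 * q + lam - 1"
    using qs q by (intro mod_sub_nat) linarith+
  have th: "(thr + thr) mod 2 ^ w = 2 * thr"
    using W_thr W_pos by (simp add: W_def)
  show ?thesis
    unfolding sign_com_def
    by (simp only: exec_simps r s one t th msw_def[symmetric]) (auto simp: fun_eq_iff)
qed

lemma ex_addr:
  assumes "ready R m" "R 70 = 11 * q"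
  shows "ex w addr_com (R, m) = (R(71 := 12 * q, 72 := 13 * q, 73 := 14 * q, 50 := nw * w), m)"
proof -
  have r: "R 17 = q" "R 1 = nw" "R 10 = w"
    using assms by (simp_all add: ready_def regs_ok_def)
  have s: "(11 * q + q) mod 2 ^ w = 12 * q" "(12 * q + q) mod 2 ^ w = 13 * q" "(13 * q + q) mod 2 ^ w = 14 * q"
    using qs by (subst small_mod; simp)+
  have "nw * w \<le> e0" unfolding e0_def by (intro mult_le_mono1) (simp add: \<mu>_def)
  moreover have "e0 * 1 \<le> (e0 + 1) * \<sigma>" by (intro mult_le_mono) (simp_all add: \<sigma>_def)
  ultimately have t: "nw * w mod 2 ^ w = nw * w" using iterations by (simp add: W_def)
  show ?thesis
    unfolding addr_com_def
    by (simp only: exec_simps r s t assms(2))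
qed

text \<open>Half of \<open>W ^ \<mu>\<close> is \<open>2 * thr * W ^ (\<mu> - 1)\<close>, a multiple
  of the weight of the top word, so the lower words cannot affect the comparison.\<close>

lemma top_digit:
  assumes "wf_state w (R, m)" "val w m (8 * q + pad) \<mu> = x"
  shows "m (8 * q + lam - 1) < 2 * thr \<longleftrightarrow> 2 * x < W ^ \<mu>"
proof -
  define msw where "msw = m (8 * q + lam - 1)"
  have n: "\<mu> = (\<mu> - 1) + 1" by (simp add: \<mu>_def)
  have "8 * q + pad + (\<mu> - 1) = 8 * q + lam - 1" using qs(4) by (simp add: \<mu>_def)
  then have "x = val w m (8 * q + pad) (\<mu> - 1) + W ^ (\<mu> - 1) * msw"
    unfolding assms(2)[symmetric] msw_def W_power by (subst n) (simp only: val_add val_one)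
  moreover have "val w m (8 * q + pad) (\<mu> - 1) < W ^ (\<mu> - 1)"
    unfolding W_power using assms(1) by (intro val_less) (simp add: wf_state_def)
  moreover have "W ^ \<mu> = 2 * (W ^ (\<mu> - 1) * (2 * thr))"
    by (subst n) (simp add: W_thr)
  moreover have "W ^ (\<mu> - 1) * msw + W ^ (\<mu> - 1) \<le> W ^ (\<mu> - 1) * (2 * thr)" if "msw < 2 * thr"
    using mult_le_mono2[of "msw + 1" "2 * thr" "W ^ (\<mu> - 1)"] that by simp
  moreover have "W ^ (\<mu> - 1) * (2 * thr) \<le> W ^ (\<mu> - 1) * msw" if "\<not> msw < 2 * thr"
    using that by (intro mult_le_mono2) simp
  ultimately show ?thesis unfolding msw_def[symmetric] by linarith
qed

lemma tr_prepare:
  assumes wf: "wf_state w (R, m)" and R: "R 1 = nw" "R 5 = gw" "m (R 2) = K"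
    and m: "\<And>x. q \<le> x \<Longrightarrow> m x = 0" and fit: "R 8 + lam \<le> q"
    and u: "val w m (R 8) lam = u mod W ^ lam" "1 \<le> u" "u \<le> W ^ lam"
    and x: "x = (u - 1) div W ^ pad" "xb = (if 2 * x < W ^ \<mu> then W ^ \<mu> - 1 - x else x)"
    and T: "prepare_time \<le> T"
    and Q: "\<And>R' m'. wf_state w (R', m') \<Longrightarrow> ready R' m' \<Longrightarrow> (\<And>r. r < 10 \<Longrightarrow> R' r = R r) \<Longrightarrow>
        (\<And>x. x < q \<or> 11 * q \<le> x \<Longrightarrow> m' x = m x) \<Longrightarrow> R' 68 = of_bool (2 * x < W ^ \<mu>) \<Longrightarrow>
        R' 70 = 11 * q \<Longrightarrow> R' 71 = 12 * q \<Longrightarrow> R' 72 = 13 * q \<Longrightarrow> R' 73 = 14 * q \<Longrightarrow> R' 50 = nw * w \<Longrightarrow>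
        8 * q \<le> R' 74 \<Longrightarrow> R' 74 + \<mu> < 16 * q \<Longrightarrow> val w m' (R' 74) \<mu> = xb \<Longrightarrow>
        val w m' (q + 1) nw + 1 = W ^ nw \<Longrightarrow> Q (R', m')"
  shows "tr w mc prepare_com (R, m) T Q"
proof (rule tr_weaken[OF _ _ T])
  let ?k6 = "sub_com 37 36 30 1"
  let ?k5 = "If 68 (Mov 74 69) (Mov 74 64) ;; ?k6"
  let ?k4 = "sub_com 39 64 69 16 ;; ?k5"
  let ?k3 = "sub_com 37 36 39 16 ;; ?k4"
  let ?k2 = "sign_com ;; addr_com ;; ?k3"
  have w0: "0 < w" using w by simp
  have WL: "0 < W ^ k" for k using W_pos by simp
  show "tr w mc prepare_com (R, m) prepare_time Q"
    unfolding prepare_com_def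
  proof (rule tr_bind, rule tr_setup[OF wf R m le_refl])
    fix R1 m1
    assume wf1: "wf_state w (R1, m1)" and ready1: "ready R1 m1" and R1: "\<And>r. r < 10 \<Longrightarrow> R1 r = R r"
      and m1: "\<And>x. x < q \<or> 5 * q \<le> x \<and> x \<noteq> 6 * q \<or> x = q + 1 \<or> (q + 1 \<le> x \<and> x < q + 1 + nw) \<Longrightarrow> m1 x = m x"
    have r1: "R1 36 = 6 * q" "R1 60 = lam" "R1 38 = 8 * q" "R1 8 = R 8"
      using ready1 R1 by (simp_all add: ready_def)
    have u1: "val w m1 (R 8) lam = u mod W ^ lam"
      using fit u(1) by (subst val_cong[of _ _ m1 m]) (auto intro!: m1)
    show "tr w mc (sub_com 8 36 38 60 ;; ?k2) (R1, m1) (13 * lam + 26 * \<mu> + 13 * nw + 90) Q"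
    proof (rule tr_bind, rule tr_sub_ready[OF wf1 ready1 _ _ _ _ _ _ _ _ _ _ le_refl])
      fix R2 m2
      assume wf2: "wf_state w (R2, m2)" and ready2: "ready R2 m2" and R2: "\<And>r. r \<notin> {20..29} \<Longrightarrow> R2 r = R1 r"
        and m2: "\<And>x. \<not> (R1 38 \<le> x \<and> x < R1 38 + R1 60) \<Longrightarrow> m2 x = m1 x"
        and b2: "R2 25 = of_bool (val w m1 (R1 8) (R1 60) < val w m1 (R1 36) (R1 60))"
        and v2: "val w m2 (R1 38) (R1 60) + val w m1 (R1 36) (R1 60) = val w m1 (R1 8) (R1 60) + R2 25 * W ^ R1 60"
      \<comment> \<open>The value \<open>u = W ^ lam\<close> reads as 0 in \<open>lam\<close> words;
        subtracting 1 wraps around to \<open>W ^ lam - 1\<close>, which is again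
        \<open>u - 1\<close>.\<close>
      have U: "val w m2 (8 * q) lam = u - 1"
      proof -
        have "val w m1 (6 * q) lam = 1"
          using qs val_one_array[OF ready1, of lam] by simp
        moreover have "u mod W ^ lam = (if u = W ^ lam then 0 else u)" using u by simp
        ultimately show ?thesis
          using b2 v2 u1 u(2) WL[of lam] unfolding r1 by (auto split: if_splits)
      qed
      have x2: "val w m2 (8 * q + pad) \<mu> = x"
      proof -
        have "u - 1 = val w m2 (8 * q) pad + W ^ pad * val w m2 (8 * q + pad) \<mu>"
          using U unfolding qs(4) val_add W_power by simp
        moreover have "val w m2 (8 * q) pad < W ^ pad"
          unfolding W_power using wf2 by (intro val_less) (simp add: wf_state_def)
        ultimately show ?thesis unfolding x(1) using WL[of pad] by simp
      qed
      define R3 where "R3 = R2(64 := 8 * q + pad, 45 := 1, 65 := 8 * q + lam - 1, 66 := m2 (8 * q + lam - 1),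
        67 := 2 * thr, 68 := of_bool (m2 (8 * q + lam - 1) < 2 * thr), 69 := 10 * q, 70 := 11 * q)"
      have ready3: "ready R3 m2" by (rule ready_cong[OF ready2]) (auto simp: R3_def)
      define R4 where "R4 = R3(71 := 12 * q, 72 := 13 * q, 73 := 14 * q, 50 := nw * w)"
      have ready4: "ready R4 m2" by (rule ready_cong[OF ready3]) (auto simp: R4_def)
      have x_lt: "x < W ^ \<mu>"
        unfolding x2[symmetric] W_power using wf2 by (intro val_less) (simp add: wf_state_def)
      show "tr w mc ?k2 (R2, m2) (26 * \<mu> + 13 * nw + 80) Q"
      proof (rule tr_bind_straight[OF _ w0 wf2 ex_sign[OF ready2, folded R3_def]])
        assume wf3: "wf_state w (R3, m2)"
        show "tr w mc (addr_com ;; ?k3) (R3, m2) (26 * \<mu> + 13 * nw + 60) Q"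
        proof (rule tr_bind_straight[OF _ w0 wf3 ex_addr[OF ready3, folded R4_def]])
          assume wf4: "wf_state w (R4, m2)"
          note r4 = ready4[unfolded ready_def regs_ok_def]
          have r4': "R4 37 = 7 * q" "R4 36 = 6 * q" "R4 39 = 9 * q" "R4 16 = \<mu>" "R4 64 = 8 * q + pad" "R4 69 = 10 * q"
             "R4 30 = q + 1" "R4 1 = nw"
            using r4 by (auto simp: R4_def R3_def)
          show "tr w mc ?k3 (R4, m2) (26 * \<mu> + 13 * nw + 50) Q"
          proof (rule tr_bind, rule tr_sub_ready[OF wf4 ready4 _ _ _ _ _ _ _ _ _ _ le_refl])
            fix R5 m5
            assume wf5: "wf_state w (R5, m5)" and ready5: "ready R5 m5" and R5: "\<And>r. r \<notin> {20..29} \<Longrightarrow> R5 r = R4 r"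
              and m5: "\<And>x. \<not> (R4 39 \<le> x \<and> x < R4 39 + R4 16) \<Longrightarrow> m5 x = m2 x"
              and b5: "R5 25 = of_bool (val w m2 (R4 37) (R4 16) < val w m2 (R4 36) (R4 16))"
              and v5: "val w m5 (R4 39) (R4 16) + val w m2 (R4 36) (R4 16) = val w m2 (R4 37) (R4 16) + R5 25 * W ^ R4 16"
            have r5: "R5 39 = 9 * q" "R5 64 = 8 * q + pad" "R5 69 = 10 * q" "R5 16 = \<mu>"
              using R5 r4' by auto
            have ones: "val w m5 (9 * q) \<mu> + 1 = W ^ \<mu>"
              using b5 v5 val_one_array[OF ready4, of \<mu>] val_zero_array[OF ready4, of \<mu>] qs
              unfolding r4' by simp
            have x5: "val w m5 (8 * q + pad) \<mu> = x"
              unfolding x2[symmetric] using qs r4' by (intro val_cong m5) auto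
            show "tr w mc ?k4 (R5, m5) (13 * \<mu> + 13 * nw + 40) Q"
            proof (rule tr_bind, rule tr_sub_ready[OF wf5 ready5 _ _ _ _ _ _ _ _ _ _ le_refl])
              fix R6 m6
              assume wf6: "wf_state w (R6, m6)" and ready6: "ready R6 m6" and R6: "\<And>r. r \<notin> {20..29} \<Longrightarrow> R6 r = R5 r"
                and m6: "\<And>x. \<not> (R5 69 \<le> x \<and> x < R5 69 + R5 16) \<Longrightarrow> m6 x = m5 x"
                and b6: "R6 25 = of_bool (val w m5 (R5 39) (R5 16) < val w m5 (R5 64) (R5 16))"
                and v6: "val w m6 (R5 69) (R5 16) + val w m5 (R5 64) (R5 16) = val w m5 (R5 39) (R5 16) + R6 25 * W ^ R5 16"
              have comp: "val w m6 (10 * q) \<mu> = W ^ \<mu> - 1 - x"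
                using b6 v6 x_lt ones unfolding r5 x5 by (auto split: if_splits)
              have x6: "val w m6 (8 * q + pad) \<mu> = x"
                unfolding x5[symmetric] using qs r5 by (intro val_cong m6) auto
              have frR: "R6 r = R4 r" if "r \<notin> {20..29}" for r using R5 R6 that by simp
              have sgn: "R6 68 = of_bool (2 * x < W ^ \<mu>)"
                using frR[of 68] top_digit[OF wf2 x2] by (simp add: R4_def R3_def)
              define a where "a = (if 2 * x < W ^ \<mu> then 10 * q else 8 * q + pad)"
              define R7 where "R7 = R6(74 := a)"
              have ex7: "ex w (If 68 (Mov 74 69) (Mov 74 64)) (R6, m6) = (R7, m6)"
                using sgn frR[of 69] frR[of 64] r4' by (auto simp: R7_def a_def)
              have ready7: "ready R7 m6" by (rule ready_cong[OF ready6]) (auto simp: R7_def)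
              show "tr w mc ?k5 (R6, m6) (13 * nw + 20) Q"
              proof (rule tr_bind_straight[OF _ w0 wf6 ex7])
                assume wf7: "wf_state w (R7, m6)"
                have r7: "R7 37 = 7 * q" "R7 36 = 6 * q" "R7 30 = q + 1" "R7 1 = nw"
                  using frR r4' by (auto simp: R7_def)
                show "tr w mc ?k6 (R7, m6) (13 * nw + 10) Q"
                proof (rule tr_sub_ready[OF wf7 ready7])
                  fix R8 m8
                  assume wf8: "wf_state w (R8, m8)" and ready8: "ready R8 m8" and R8: "\<And>r. r \<notin> {20..29} \<Longrightarrow> R8 r = R7 r"
                    and m8: "\<And>x. \<not> (R7 30 \<le> x \<and> x < R7 30 + R7 1) \<Longrightarrow> m8 x = m6 x"
                    and b8: "R8 25 = of_bool (val w m6 (R7 37) (R7 1) < val w m6 (R7 36) (R7 1))"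
                    and v8: "val w m8 (R7 30) (R7 1) + val w m6 (R7 36) (R7 1) = val w m6 (R7 37) (R7 1) + R8 25 * W ^ R7 1"
                  have i8: "val w m8 (q + 1) nw + 1 = W ^ nw"
                    using b8 v8 val_one_array[OF ready7, of nw] val_zero_array[OF ready7, of nw] qs nw
                    unfolding r7 by simp
                  have fr8: "R8 r = R4 r" if "r \<notin> {20..29}" "r \<noteq> 74" for r
                    using R8 frR that by (simp add: R7_def)
                  have mm8: "m8 x = m x" if "x < q \<or> 11 * q \<le> x" for x
                  proof -
                    have "m8 x = m6 x" using that qs unfolding r7 by (intro m8[unfolded r7]) auto
                    also have "\<dots> = m5 x" using that qs by (intro m6[unfolded r5]) auto
                    also have "\<dots> = m2 x" using that qs by (intro m5[unfolded r4']) auto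
                    also have "\<dots> = m1 x" using that qs by (intro m2[unfolded r1]) auto
                    also have "\<dots> = m x" using that qs by (intro m1) auto
                    finally show ?thesis .
                  qed
                  have a8: "R8 74 = a" using R8[of 74] by (simp add: R7_def)
                  have "val w m8 a \<mu> = val w m6 a \<mu>"
                    using qs by (intro val_cong m8[unfolded r7]) (auto simp: a_def split: if_splits)
                  also have "\<dots> = xb" using comp x6 by (simp add: a_def x(2))
                  finally have xb: "val w m8 a \<mu> = xb" .
                  have low: "R8 r = R r" if "r < 10" for r
                    using fr8[of r] R2[of r] R1[of r] that by (simp add: R4_def R3_def)
                  show "Q (R8, m8)"
                  proof (rule Q[OF wf8 ready8 low mm8])
                    show "R8 68 = of_bool (2 * x < W ^ \<mu>)" using sgn R8[of 68] by (simp add: R7_def)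
                    show "val w m8 (R8 74) \<mu> = xb" using a8 xb by simp
                    show "8 * q \<le> R8 74" "R8 74 + \<mu> < 16 * q" using a8 qs by (auto simp: a_def)
                    show "R8 50 = nw * w" "R8 70 = 11 * q" "R8 71 = 12 * q" "R8 72 = 13 * q" "R8 73 = 14 * q"
                      using fr8 by (simp_all add: R4_def R3_def)
                  qed (use i8 in auto)
                qed (use r7 qs in auto)
              qed simp_all
            qed (use r5 qs in auto)
          qed (use r4' qs in auto)
        qed (simp_all add: addr_com_def R3_def)
      qed (simp_all add: sign_com_def)
    qed (use r1 fit qs in auto)
  next
    show "setup_time + (13 * lam + 26 * \<mu> + 13 * nw + 90) \<le> prepare_time"
      by (simp add: prepare_time_def)
  qed
qed

section \<open>Applying the noise and clamping\<close>

definition "finish_time = 52 * nw + 60"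

lemma tr_finish:
  assumes wf: "wf_state w (R, m)" and ready: "ready R m"
    and R: "R 0 = 0" "R 68 = of_bool low" "R 70 = 11 * q" "R 71 = 12 * q" "R 72 = 13 * q" "R 73 = 14 * q"
    and fit: "R 6 + R 7 \<le> q" "R 7 \<le> nw" and m: "\<And>x. 11 * q \<le> x \<Longrightarrow> m x = 0"
    and n: "val w m 0 nw = n" and c: "val w m (R 6) (R 7) = c" "c \<le> n"
    and J: "val w m (q + 1) nw = J" and T: "finish_time \<le> T"
    and Q: "\<And>R' m'. R' 0 + R' 1 \<le> 2 ^ w \<Longrightarrow>
        val w m' (R' 0) (R' 1) = (if low then c - J else min n (c + J)) \<Longrightarrow> Q (R', m')"
  shows "tr w mc finish_com (R, m) T Q"
proof (rule tr_weaken[OF _ _ T])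
  let ?lo = "sub_com 70 30 71 1 ;; If 25 (Const 1 0) (Mov 0 71)"
  let ?h3 = "If 25 Skip (sub_com 0 72 73 1 ;; Mov 0 73)"
  let ?h2 = "sub_com 71 30 72 1 ;; ?h3"
  let ?hi = "sub_com 0 70 71 1 ;; ?h2"
  have w0: "0 < w" using w by simp
  have W1: "W ^ nw > 0" using W_pos by simp
  have r: "R 37 = 7 * q" "R 30 = q + 1" "R 1 = nw"
    using ready by (simp_all add: ready_def regs_ok_def)
  show "tr w mc finish_com (R, m) finish_time Q"
    unfolding finish_com_def
  proof (rule tr_bind, rule tr_sub_ready[OF wf ready _ _ _ _ _ _ _ _ _ _ le_refl])
    fix R1 m1
    assume wf1: "wf_state w (R1, m1)" and ready1: "ready R1 m1" and R1: "\<And>r. r \<notin> {20..29} \<Longrightarrow> R1 r = R r"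
      and m1: "\<And>x. \<not> (R 70 \<le> x \<and> x < R 70 + R 7) \<Longrightarrow> m1 x = m x"
      and b1: "R1 25 = of_bool (val w m (R 6) (R 7) < val w m (R 37) (R 7))"
      and v1: "val w m1 (R 70) (R 7) + val w m (R 37) (R 7) = val w m (R 6) (R 7) + R1 25 * W ^ R 7"
    have r1: "R1 37 = 7 * q" "R1 30 = q + 1" "R1 1 = nw" "R1 0 = 0" "R1 68 = of_bool low" "R1 70 = 11 * q"
      "R1 71 = 12 * q" "R1 72 = 13 * q" "R1 73 = 14 * q"
      using R R1 r by simp_all
    have c1: "val w m1 (11 * q) nw = c"
    proof -
      have "val w m (7 * q) (R 7) = 0" using val_zero_array[OF ready, of "R 7"] fit qs by simp
      then have "val w m1 (11 * q) (R 7) = c"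
        using b1 v1 unfolding r R c by simp
      moreover have "val w m1 (11 * q + R 7) (nw - R 7) = 0"
        using R m1 m by (intro val_zero) auto
      moreover have "nw = R 7 + (nw - R 7)" using fit by simp
      ultimately show ?thesis by (metis add.right_neutral mult_zero_right val_add)
    qed
    have n1: "val w m1 0 nw = n"
      unfolding n[symmetric] using R qs by (intro val_cong m1) auto
    have J1: "val w m1 (q + 1) nw = J"
      unfolding J[symmetric] using R qs by (intro val_cong m1) auto
    show "tr w mc (If 68 ?lo ?hi) (R1, m1) (39 * nw + 50) Q"
    proof (rule tr_If)
      assume "R1 68 \<noteq> 0"
      then have low: low using r1 by auto
      show "tr w mc ?lo (R1, m1) (39 * nw + 45) Q"
      proof (rule tr_bind, rule tr_sub_ready[OF wf1 ready1 _ _ _ _ _ _ _ _ _ _ le_refl])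
        fix R2 m2
        assume wf2: "wf_state w (R2, m2)" and R2: "\<And>r. r \<notin> {20..29} \<Longrightarrow> R2 r = R1 r"
          and b2: "R2 25 = of_bool (val w m1 (R1 70) (R1 1) < val w m1 (R1 30) (R1 1))"
          and v2: "val w m2 (R1 71) (R1 1) + val w m1 (R1 30) (R1 1) = val w m1 (R1 70) (R1 1) + R2 25 * W ^ R1 1"
        have r2: "R2 1 = nw" "R2 71 = 12 * q" "R2 0 = 0" using R2 r1 by simp_all
        have b2': "R2 25 = of_bool (c < J)" and v2': "val w m2 (12 * q) nw + J = c + R2 25 * W ^ nw"
          using b2 v2 unfolding r1 c1 J1 by simp_all
        show "tr w mc (If 25 (Const 1 0) (Mov 0 71)) (R2, m2) 20 Q"
        proof (rule tr_straight[OF _ w0 wf2])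
          show "Q (ex w (If 25 (Const 1 0) (Mov 0 71)) (R2, m2))"
          proof (cases "c < J")
            case True
            then show ?thesis using b2' low by (simp add: Q r2)
          next
            case False
            then have "val w m2 (12 * q) nw = c - J" "R2 25 = 0" using b2' v2' by auto
            moreover have "12 * q + nw \<le> 2 ^ w" using qs q by linarith
            ultimately have "Q (R2(0 := 12 * q), m2)"
              using low by (intro Q) (simp_all add: r2[simplified])
            then show ?thesis using \<open>R2 25 = 0\<close> by (simp add: r2)
          qed
        qed simp_all
      qed (use r1 qs in auto)
    next
      assume "R1 68 = 0"
      then have low: "\<not> low" using r1 by auto
      show "tr w mc ?hi (R1, m1) (39 * nw + 45) Q"
      proof (rule tr_bind, rule tr_sub_ready[OF wf1 ready1 _ _ _ _ _ _ _ _ _ _ le_refl])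
        fix R2 m2
        assume wf2: "wf_state w (R2, m2)" and ready2: "ready R2 m2" and R2: "\<And>r. r \<notin> {20..29} \<Longrightarrow> R2 r = R1 r"
          and m2: "\<And>x. \<not> (R1 71 \<le> x \<and> x < R1 71 + R1 1) \<Longrightarrow> m2 x = m1 x"
          and b2: "R2 25 = of_bool (val w m1 (R1 0) (R1 1) < val w m1 (R1 70) (R1 1))"
          and v2: "val w m2 (R1 71) (R1 1) + val w m1 (R1 70) (R1 1) = val w m1 (R1 0) (R1 1) + R2 25 * W ^ R1 1"
        have r2: "R2 1 = nw" "R2 71 = 12 * q" "R2 72 = 13 * q" "R2 73 = 14 * q" "R2 0 = 0" "R2 30 = q + 1"
          using R2 r1 by simp_all
        have v2': "val w m2 (12 * q) nw = n - c"
          using b2 v2 c(2) unfolding r1 c1 n1 by simp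
        have n2: "val w m2 0 nw = n"
          unfolding n1[symmetric] using r1 qs by (intro val_cong m2) auto
        have J2: "val w m2 (q + 1) nw = J"
          unfolding J1[symmetric] using r1 qs by (intro val_cong m2) auto
        show "tr w mc ?h2 (R2, m2) (26 * nw + 35) Q"
        proof (rule tr_bind, rule tr_sub_ready[OF wf2 ready2 _ _ _ _ _ _ _ _ _ _ le_refl])
          fix R3 m3
          assume wf3: "wf_state w (R3, m3)" and ready3: "ready R3 m3" and R3: "\<And>r. r \<notin> {20..29} \<Longrightarrow> R3 r = R2 r"
            and m3: "\<And>x. \<not> (R2 72 \<le> x \<and> x < R2 72 + R2 1) \<Longrightarrow> m3 x = m2 x"
            and b3: "R3 25 = of_bool (val w m2 (R2 71) (R2 1) < val w m2 (R2 30) (R2 1))"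
            and v3: "val w m3 (R2 72) (R2 1) + val w m2 (R2 30) (R2 1) = val w m2 (R2 71) (R2 1) + R3 25 * W ^ R2 1"
          have r3: "R3 1 = nw" "R3 72 = 13 * q" "R3 73 = 14 * q" "R3 0 = 0"
            using R3 r2 by simp_all
          have b3': "R3 25 = of_bool (n - c < J)" and v3': "val w m3 (13 * q) nw + J = n - c + R3 25 * W ^ nw"
            using b3 v3 unfolding r2 v2' J2 by simp_all
          have n3: "val w m3 0 nw = n"
            unfolding n2[symmetric] using r2 qs by (intro val_cong m3) auto
          show "tr w mc ?h3 (R3, m3) (13 * nw + 25) Q"
          proof (rule tr_If[where T = "13 * nw + 20"])
            assume "R3 25 \<noteq> 0"
            then have "n - c < J" using b3' by auto
            then have "Q (R3, m3)"
              using low n3 qs q c(2) by (intro Q) (auto simp: r3[simplified])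
            then show "tr w mc Skip (R3, m3) (13 * nw + 20) Q"
              using w0 wf3 by (intro tr_straight) auto
          next
            assume "R3 25 = 0"
            then have le: "J \<le> n - c" and v3'': "val w m3 (13 * q) nw = n - c - J"
              using b3' v3' by auto
            show "tr w mc (sub_com 0 72 73 1 ;; Mov 0 73) (R3, m3) (13 * nw + 20) Q"
            proof (rule tr_bind, rule tr_sub_ready[OF wf3 ready3 _ _ _ _ _ _ _ _ _ _ le_refl])
              fix R4 m4
              assume wf4: "wf_state w (R4, m4)" and R4: "\<And>r. r \<notin> {20..29} \<Longrightarrow> R4 r = R3 r"
                and b4: "R4 25 = of_bool (val w m3 (R3 0) (R3 1) < val w m3 (R3 72) (R3 1))"
                and v4: "val w m4 (R3 73) (R3 1) + val w m3 (R3 72) (R3 1) = val w m3 (R3 0) (R3 1) + R4 25 * W ^ R3 1"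
              have r4: "R4 1 = nw" "R4 73 = 14 * q" using R4 r3 by simp_all
              have "val w m4 (14 * q) nw = c + J"
              proof -
                have "R4 25 = 0" using b4 unfolding r3 n3 v3'' by auto
                then have "val w m4 (14 * q) nw + (n - c - J) = n"
                  using v4 unfolding r3 n3 v3'' by simp
                then show ?thesis using le c(2) by linarith
              qed
              moreover have "14 * q + nw \<le> 2 ^ w" using qs q by linarith
              ultimately have "Q (R4(0 := 14 * q), m4)"
                using low le c(2) by (intro Q) (simp_all add: r4[simplified])
              then have "Q (ex w (Mov 0 73) (R4, m4))"
                by (simp add: r4)
              then show "tr w mc (Mov 0 73) (R4, m4) 1 Q"
                using w0 wf4 by (intro tr_straight) auto
            qed (use r3 qs in auto)
          qed simp
        qed (use r2 qs in auto)
      qed (use r1 qs in auto)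
    qed simp
  qed (use R r fit qs in \<open>auto simp: finish_time_def\<close>)
qed

section \<open>The complete sampling and distribution-function programs\<close>

definition "P_time = prepare_time + (nw * w * (search_step_time + 1) + 1) + finish_time"

lemma tr_P_main:
  assumes wf: "wf_state w (R, m)" and R: "R 0 = 0" "R 1 = nw" "R 5 = gw" "m (R 2) = K"
    and m: "\<And>x. q \<le> x \<Longrightarrow> m x = 0"
    and fit: "R 6 + R 7 \<le> q" "R 7 \<le> nw" "R 8 + lam \<le> q"
    and n: "val w m 0 nw = n" and c: "val w m (R 6) (R 7) = c" "c \<le> n"
    and u: "val w m (R 8) lam = u mod W ^ lam" "1 \<le> u" "u \<le> W ^ lam"
    and x: "x = (u - 1) div W ^ pad" "xb = (if 2 * x < W ^ \<mu> then W ^ \<mu> - 1 - x else x)"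
    and T: "P_time \<le> T"
    and Q: "\<And>R' m' J. found xb J \<Longrightarrow> R' 0 + R' 1 \<le> 2 ^ w \<Longrightarrow>
        val w m' (R' 0) (R' 1) = (if 2 * x < W ^ \<mu> then c - J else min n (c + J)) \<Longrightarrow> Q (R', m')"
  shows "tr w mc P_main (R, m) T Q"
proof (rule tr_weaken[OF _ _ T])
  show "tr w mc P_main (R, m) P_time Q"
    unfolding P_main_def
  proof (rule tr_bind, rule tr_prepare[OF wf R(2,3,4) m fit(3) u x le_refl])
    fix R1 m1
    assume wf1: "wf_state w (R1, m1)" and ready1: "ready R1 m1" and low1: "\<And>r. r < 10 \<Longrightarrow> R1 r = R r"
      and m1: "\<And>x. x < q \<or> 11 * q \<le> x \<Longrightarrow> m1 x = m x" and sgn: "R1 68 = of_bool (2 * x < W ^ \<mu>)"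
      and a1: "R1 70 = 11 * q" "R1 71 = 12 * q" "R1 72 = 13 * q" "R1 73 = 14 * q"
      and s1: "R1 50 = nw * w" "8 * q \<le> R1 74" "R1 74 + \<mu> < 16 * q" "val w m1 (R1 74) \<mu> = xb"
        "val w m1 (q + 1) nw + 1 = W ^ nw"
    show "tr w mc (While 50 search_body ;; finish_com) (R1, m1)
        ((nw * w * (search_step_time + 1) + 1) + finish_time) Q"
    proof (rule tr_bind[OF _ le_refl], rule tr_search[OF wf1 ready1 s1 le_refl])
      fix R2 m2
      assume wf2: "wf_state w (R2, m2)" and ready2: "ready R2 m2"
        and R2: "\<And>r. r \<notin> {20..29} \<Longrightarrow> r \<notin> {40..59} \<Longrightarrow> R2 r = R1 r"
        and m2: "\<And>x. x < q \<or> 8 * q \<le> x \<Longrightarrow> m2 x = m1 x" and fnd: "found xb (val w m2 (q + 1) nw)"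
      have mm: "m2 x = m x" if "x < q \<or> 11 * q \<le> x" for x
        using that m1[of x] m2[of x] by auto
      have r2: "R2 6 = R 6" "R2 7 = R 7" "R2 0 = 0" using R2 low1 R by simp_all
      show "tr w mc finish_com (R2, m2) finish_time Q"
      proof (rule tr_finish[OF wf2 ready2 r2(3) _ _ _ _ _ _ _ _ _ _ c(2) refl le_refl])
        show "R2 68 = of_bool (2 * x < W ^ \<mu>)" using R2[of 68] sgn by simp
        show "val w m2 0 nw = n"
          unfolding n[symmetric] using qs by (intro val_cong mm) auto
        show "val w m2 (R2 6) (R2 7) = c"
          unfolding c(1)[symmetric] r2 using fit by (intro val_cong mm) auto
        show "m2 x = 0" if "11 * q \<le> x" for x using mm[of x] m[of x] that by simp
      qed (use R2 a1 r2 fit fnd Q in auto)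
    qed
  next
    show "prepare_time + ((nw * w * (search_step_time + 1) + 1) + finish_time) \<le> P_time"
      by (simp add: P_time_def)
  qed
qed

definition "Q_time = setup_time + 26 * nw + eval_time + 60"

lemma tr_Q_main:
  assumes wf: "wf_state w (R, m)" and R: "R 0 = 0" "R 1 = nw" "R 5 = gw" "m (R 2) = K"
    and m: "\<And>x. q \<le> x \<Longrightarrow> m x = 0" and fit: "R 6 + nw \<le> q"
    and n: "val w m 0 nw = n" and z: "val w m (R 6) nw = z" "z \<le> n"
    and T: "Q_time \<le> T"
    and Q: "\<And>R' m'. R' 0 + R' 1 \<le> 2 ^ w \<Longrightarrow>
        val w m' (R' 0) (R' 1) = (if z < n then W ^ pad * (W ^ \<mu> - \<Gamma> z) else W ^ lam) \<Longrightarrow> Q (R', m')"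
  shows "tr w mc Q_main (R, m) T Q"
proof (rule tr_weaken[OF _ _ T])
  let ?a3 = "Mov 0 35 ;; Mov 1 60"
  let ?a2 = "eval_com ;; ?a3"
  let ?a1 = "sub_com 6 37 30 1 ;; ?a2"
  let ?b = "Const 51 1 ;; Op Add 50 35 60 ;; Store 50 51 ;; Mov 0 35 ;; Op Add 1 60 51"
  have w0: "0 < w" using w by simp
  show "tr w mc Q_main (R, m) Q_time Q"
    unfolding Q_main_def
  proof (rule tr_bind, rule tr_setup[OF wf R(2,3,4) m le_refl])
    fix R1 m1
    assume wf1: "wf_state w (R1, m1)" and ready1: "ready R1 m1" and R1: "\<And>r. r < 10 \<Longrightarrow> R1 r = R r"
      and m1: "\<And>x. x < q \<or> 5 * q \<le> x \<and> x \<noteq> 6 * q \<or> x = q + 1 \<or> (q + 1 \<le> x \<and> x < q + 1 + nw) \<Longrightarrow> m1 x = m x"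
    have r1: "R1 0 = 0" "R1 1 = nw" "R1 6 = R 6" "R1 31 = 3 * q" "R1 30 = q + 1" "R1 37 = 7 * q"
        "R1 35 = 5 * q" "R1 60 = lam"
      using ready1 R1 R by (simp_all add: ready_def regs_ok_def)
    have n1: "val w m1 0 nw = n"
      unfolding n[symmetric] using qs by (intro val_cong m1) auto
    have z1: "val w m1 (R 6) nw = z"
      unfolding z(1)[symmetric] using fit by (intro val_cong m1) auto
    show "tr w mc (sub_com 6 0 31 1 ;; If 25 ?a1 ?b) (R1, m1) (26 * nw + eval_time + 55) Q"
    proof (rule tr_bind, rule tr_sub_ready[OF wf1 ready1 _ _ _ _ _ _ _ _ _ _ le_refl])
      fix R2 m2
      assume wf2: "wf_state w (R2, m2)" and ready2: "ready R2 m2" and R2: "\<And>r. r \<notin> {20..29} \<Longrightarrow> R2 r = R1 r"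
        and m2: "\<And>x. \<not> (R1 31 \<le> x \<and> x < R1 31 + R1 1) \<Longrightarrow> m2 x = m1 x"
        and b2: "R2 25 = of_bool (val w m1 (R1 6) (R1 1) < val w m1 (R1 0) (R1 1))"
      have b2': "R2 25 = of_bool (z < n)" using b2 unfolding r1 z1 n1 .
      have r2: "R2 1 = nw" "R2 6 = R 6" "R2 30 = q + 1" "R2 37 = 7 * q" "R2 35 = 5 * q" "R2 60 = lam"
        using R2 r1 by simp_all
      have z2: "val w m2 (R 6) nw = z"
        unfolding z1[symmetric] using r1 qs fit by (intro val_cong m2) auto
      have mA: "m2 x = 0" if "5 * q \<le> x" "x < 6 * q" for x
        using that m2[of x] m1[of x] m[of x] r1 qs by auto
      show "tr w mc (If 25 ?a1 ?b) (R2, m2) (13 * nw + eval_time + 45) Q"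
      proof (rule tr_If)
        assume "R2 25 \<noteq> 0"
        then have zn: "z < n" using b2' by auto
        show "tr w mc ?a1 (R2, m2) (13 * nw + eval_time + 40) Q"
        proof (rule tr_bind, rule tr_sub_ready[OF wf2 ready2 _ _ _ _ _ _ _ _ _ _ le_refl])
          fix R3 m3
          assume wf3: "wf_state w (R3, m3)" and ready3: "ready R3 m3" and R3: "\<And>r. r \<notin> {20..29} \<Longrightarrow> R3 r = R2 r"
            and m3: "\<And>x. \<not> (R2 30 \<le> x \<and> x < R2 30 + R2 1) \<Longrightarrow> m3 x = m2 x"
            and b3: "R3 25 = of_bool (val w m2 (R2 6) (R2 1) < val w m2 (R2 37) (R2 1))"
            and v3: "val w m3 (R2 30) (R2 1) + val w m2 (R2 37) (R2 1) = val w m2 (R2 6) (R2 1) + R3 25 * W ^ R2 1"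
          have z3: "val w m3 (q + 1) nw = z"
            using b3 v3 val_zero_array[OF ready2, of nw] qs unfolding r2 z2 by simp
          have r3: "regs_ok R3" "mem_ok m3" "R3 35 = 5 * q" "R3 60 = lam"
            using ready3 by (simp_all add: ready_def)
          show "tr w mc ?a2 (R3, m3) (eval_time + 30) Q"
          proof (rule tr_bind, rule tr_eval[OF wf3 r3(1,2) le_refl])
            fix R4 m4
            assume wf4: "wf_state w (R4, m4)" and R4: "\<And>r. r \<notin> {20..29} \<Longrightarrow> r \<notin> {40..49} \<Longrightarrow> R4 r = R3 r"
              and m4: "\<And>x. \<not> (3 * q \<le> x \<and> x < 4 * q) \<Longrightarrow> \<not> (5 * q + pad \<le> x \<and> x < 5 * q + pad + \<mu>) \<Longrightarrow> m4 x = m3 x"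
              and A: "val w m4 (5 * q + pad) \<mu> + \<Gamma> (val w m3 (q + 1) nw) = W ^ \<mu>"
            have "val w m4 (5 * q) pad = 0"
              using m4 m3 mA qs unfolding r2 by (intro val_zero) auto
            then have "val w m4 (5 * q) lam = W ^ pad * (W ^ \<mu> - \<Gamma> z)"
              using A unfolding qs(4) val_add W_power z3 by simp
            then have "Q (ex w ?a3 (R4, m4))"
              using zn qs q R4 r3 by (simp add: Q)
            then show "tr w mc ?a3 (R4, m4) 2 Q"
              using w0 wf4 by (intro tr_straight) auto
          qed simp
        qed (use r2 qs fit in auto)
      next
        assume "R2 25 = 0"
        then have zn: "\<not> z < n" using b2' by auto
        have ex: "ex w ?b (R2, m2) = (R2(51 := 1, 50 := 5 * q + lam, 0 := 5 * q, 1 := lam + 1), m2(5 * q + lam := 1))"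
        proof -
          have "1 mod 2 ^ w = (1::nat)" "(5 * q + lam) mod 2 ^ w = 5 * q + lam" "(lam + 1) mod 2 ^ w = lam + 1"
            using qs w0 by (simp, (subst small_mod; simp)+)
          then show ?thesis by (simp add: r2 del: One_nat_def)
        qed
        have "val w (m2(5 * q + lam := 1)) (5 * q) (lam + 1) = W ^ lam"
        proof -
          have "val w (m2(5 * q + lam := 1)) (5 * q) lam = 0"
            using mA qs by (intro val_zero) auto
          then show ?thesis by (simp add: val_add val_one W_power del: One_nat_def)
        qed
        then have "Q (ex w ?b (R2, m2))"
          unfolding ex using zn qs q by (intro Q) auto
        then show "tr w mc ?b (R2, m2) (13 * nw + eval_time + 40) Q"
          using w0 wf2 by (intro tr_straight) auto
      qed simp
    qed (use r1 fit qs in auto)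
  next
    show "setup_time + (26 * nw + eval_time + 55) \<le> Q_time"
      by (simp add: Q_time_def)
  qed
qed

end

section \<open>Input encoding\<close>

lemma Suc_0_less_two_power: "w > 0 \<Longrightarrow> Suc 0 < 2 ^ w"
  by (metis One_nat_def one_less_numeral_iff one_less_power semiring_norm(76))

lemma num_words_less: "w > 0 \<Longrightarrow> x < 2 ^ (w * num_words w x)"
  using floorlog_leD[of "2 ^ w" x "num_words w x"]
  by (simp add: num_words_def power_mult Suc_0_less_two_power)

lemma num_words_pos: "w > 0 \<Longrightarrow> 0 < x \<Longrightarrow> 0 < num_words w x"
  using Suc_0_less_two_power[of w] by (auto simp: num_words_def floorlog_eq_zero_iff intro!: Nat.gr0I)

lemma num_words_bits:
  assumes "w > 0" "0 < x"
  shows "w * num_words w x < floorlog 2 x + w"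
proof -
  have "(2 ^ w) ^ (num_words w x - 1) \<le> x"
    unfolding num_words_def using assms floorlog_bounds[of x "2 ^ w"] by (simp add: Suc_0_less_two_power)
  also have "x < 2 ^ floorlog 2 x" using floorlog_bounds[of x 2] assms by simp
  finally have "(2::nat) ^ (w * (num_words w x - 1)) < 2 ^ floorlog 2 x"
    by (simp add: power_mult)
  then have "w * (num_words w x - 1) < floorlog 2 x" by simp
  then show ?thesis
    using num_words_pos[OF assms] by (cases "num_words w x") auto
qed

lemma num_words_mono: "x \<le> y \<Longrightarrow> num_words w x \<le> num_words w y"
  unfolding num_words_def by (rule floorlog_mono)

lemma digit_less: "digit w x i < 2 ^ w"
  by (simp add: digit_def)

lemma sum_digit: "(\<Sum>i<l. digit w x i * 2 ^ (w * i)) = x mod 2 ^ (w * l)"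
proof (induction l)
  case (Suc l)
  have "x mod (2 ^ (w * l) * 2 ^ w) = 2 ^ (w * l) * (x div 2 ^ (w * l) mod 2 ^ w) + x mod 2 ^ (w * l)"
    by (rule mod_mult2_eq)
  with Suc show ?case
    by (simp add: digit_def power_add algebra_simps)
qed (simp add: mod_less)

definition words :: "nat \<Rightarrow> nat list \<Rightarrow> nat" where
  "words w xs = (\<Sum>x\<leftarrow>xs. num_words w x)"

abbreviation "word_list w xs \<equiv> concat (map (\<lambda>x. map (digit w x) [0..<num_words w x]) xs)"

lemma length_word_list: "length (word_list w xs) = words w xs"
  by (induction xs) (simp_all add: words_def)

lemma input_memory_at:
  assumes "j < num_words w x"
  shows "input_memory w (xs @ x # ys) (words w xs + j) = digit w x j"
  using assms by (simp add: input_memory_def nth_append length_word_list[symmetric])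

lemma input_memory_beyond: "words w xs \<le> a \<Longrightarrow> input_memory w xs a = 0"
  by (simp add: input_memory_def length_word_list)

lemma input_memory_less: "input_memory w xs a < 2 ^ w"
proof (cases "a < words w xs")
  case True
  have "set (word_list w xs) \<subseteq> {..<2 ^ w}"
    by (auto simp: digit_less)
  moreover have "word_list w xs ! a \<in> set (word_list w xs)"
    using True by (intro nth_mem) (simp add: length_word_list)
  moreover have "input_memory w xs a = word_list w xs ! a"
    using True by (simp add: input_memory_def length_word_list)
  ultimately show ?thesis by auto
qed (simp add: input_memory_beyond)

lemma val_input_memory:
  assumes "w > 0"
  shows "val w (input_memory w (xs @ x # ys)) (words w xs) (num_words w x) = x"
proof -
  have "val w (input_memory w (xs @ x # ys)) (words w xs) (num_words w x) =
      (\<Sum>i<num_words w x. digit w x i * 2 ^ (w * i))"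
    unfolding val_def by (intro sum.cong) (auto simp: input_memory_at)
  then show ?thesis
    using num_words_less[OF assms, of x] by (simp add: sum_digit)
qed

text \<open>Memory behind the last input is zero, so that input can be read with any number of
  words. The programs thus need not know the actual length of \<open>u\<close> or
  \<open>z\<close>.\<close>

lemma val_input_memory_last:
  assumes "w > 0"
  shows "val w (input_memory w (xs @ [x])) (words w xs) l = x mod 2 ^ (w * l)"
proof -
  have "input_memory w (xs @ [x]) (words w xs + j) = digit w x j" for j
  proof (cases "j < num_words w x")
    case True
    then show ?thesis by (rule input_memory_at)
  next
    case False
    then have "(2::nat) ^ (w * num_words w x) \<le> 2 ^ (w * j)"
      by (intro power_increasing) auto
    then have "x < 2 ^ (w * j)"
      using num_words_less[OF assms, of x] by linarith
    moreover have "input_memory w (xs @ [x]) (words w xs + j) = 0"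
      using False by (intro input_memory_beyond) (simp add: words_def)
    ultimately show ?thesis by (simp add: digit_def)
  qed
  then show ?thesis
    by (simp add: val_def sum_digit)
qed

lemma wf_state_input:
  assumes "words w xs < 2 ^ w"
  shows "wf_state w (input_registers w xs, input_memory w xs)"
proof -
  have take: "words w (take i xs) \<le> words w xs" for i
  proof -
    have "words w xs = words w (take i xs) + words w (drop i xs)"
      unfolding words_def by (metis append_take_drop_id map_append sum_list_append)
    then show ?thesis by simp
  qed
  have nth: "num_words w (xs ! i) \<le> words w xs" if "i < length xs" for i
    unfolding words_def using that by (intro member_le_sum_list) auto
  have "input_registers w xs r < 2 ^ w" for r
    using assms take[of "r div 2"] nth[of "r div 2"]
    by (auto simp: input_registers_def words_def intro: le_less_trans)
  then show ?thesis by (simp add: wf_state_def input_memory_less)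
qed

text \<open>The case \<open>n = 1\<close> must be treated apart: the bound on the running time of the sampler is then constant in the soft-O
  sense, whereas reading \<open>1 / \<epsilon>\<close> and \<open>1 / \<gamma>\<close> is not.\<close>

definition test_com :: com where
  "test_com = Load 50 0 ;; Const 51 1 ;; Op Eq 50 50 51 ;; Op Eq 52 1 51 ;; Op And 50 50 52"

text \<open>For \<open>n = 1\<close> the sampler is constantly 0, returned as an integer of zero
  words.\<close>

definition P_com :: com where
  "P_com = test_com ;; If 50 (Const 1 0) P_main"

text \<open>For \<open>n = 1\<close> the scaled distribution function is constantly 1, and the
  output registers already designate the input \<open>n\<close>, which has this value.\<close>

definition Q_com :: com where
  "Q_com = test_com ;; If 50 Skip Q_main"

lemma ex_test:
  assumes "w > 0" "R 0 = 0"
  obtains R' where "ex w test_com (R, m) = (R', m)" "R' 50 = of_bool (m 0 = 1 \<and> R 1 = 1)"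
    "\<And>r. r < 10 \<Longrightarrow> R' r = R r"
proof -
  define R' where "R' = R(50 := of_bool (m 0 = 1 \<and> R 1 = 1), 51 := 1, 52 := of_bool (R 1 = 1))"
  have "1 mod 2 ^ w = (1::nat)" using assms(1) by simp
  then have "ex w test_com (R, m) = (R', m)"
    using assms(2) by (auto simp: test_com_def R'_def fun_eq_iff)
  then show thesis by (rule that) (auto simp: R'_def)
qed

lemma tr_test:
  assumes w: "w > 0" and wf: "wf_state w (R, m)" and R: "R 0 = 0"
    and unit: "m 0 = 1 \<and> R 1 = 1 \<longleftrightarrow> unit"
    and p: "\<And>R'. unit \<Longrightarrow> wf_state w (R', m) \<Longrightarrow> (\<And>r. r < 10 \<Longrightarrow> R' r = R r) \<Longrightarrow> tr w mc p (R', m) T Q"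
    and q: "\<And>R'. \<not> unit \<Longrightarrow> wf_state w (R', m) \<Longrightarrow> (\<And>r. r < 10 \<Longrightarrow> R' r = R r) \<Longrightarrow> tr w mc q (R', m) T Q"
    and T: "T + 6 \<le> T'"
  shows "tr w mc (test_com ;; If 50 p q) (R, m) T' Q"
proof -
  obtain R' where R': "ex w test_com (R, m) = (R', m)" "R' 50 = of_bool (m 0 = 1 \<and> R 1 = 1)"
    "\<And>r. r < 10 \<Longrightarrow> R' r = R r"
    using ex_test[where w = w and R = R and m = m] w R by blast
  show ?thesis
  proof (rule tr_bind_straight[OF _ w wf R'(1)])
    assume "wf_state w (R', m)"
    then show "tr w mc (If 50 p q) (R', m) (T + 1) Q"
      using R' unit by (intro tr_If[where T = T] p q) auto
  qed (use T in \<open>simp_all add: test_com_def\<close>)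
qed

lemma tr_outputs_within:
  assumes "tr w mc p (input_registers w xs, input_memory w xs) T
      (\<lambda>(R, m). R 0 + R 1 \<le> 2 ^ w \<and> val w m (R 0) (R 1) = y)"
    and "real T \<le> T'"
  shows "outputs_within w mc p xs y T'"
proof -
  from assms(1) obtain t R m where "run w mc p (input_registers w xs, input_memory w xs) t (R, m)"
    "t \<le> T" "R 0 + R 1 \<le> 2 ^ w" "val w m (R 0) (R 1) = y"
    unfolding tr_def by auto
  then show ?thesis
    unfolding outputs_within_def using assms(2) stored_int_eq_val[of "R 0" "R 1" w m]
    by (metis of_nat_mono order_trans)
qed

section \<open>Parameters of the sampler\<close>

lemma linear_le_two_power: "10 \<le> f \<Longrightarrow> 20 * f \<le> 2 ^ (f - 2)"
proof (induction f rule: dec_induct)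
  case (step f)
  then have "Suc f - 2 = Suc (f - 2)" by simp
  then show ?case using step by simp
qed simp

locale sampler =
  fixes n K gd :: nat
  assumes n: "2 \<le> n" and K_pos: "0 < K" and gd: "0 < gd"
begin

text \<open>The word length must equal \<open>word_length 4 L\<close>, where the number \<open>L\<close> of input bits depends on \<open>D\<close>. Padding \<open>D\<close> to
  \<open>ll\<close> words makes \<open>L\<close> a number with exactly \<open>f\<close> bits, where \<open>f\<close> is large enough for words to hold the scale \<open>sc\<close>,
  the addresses and the step counts.\<close>

definition "len = 2 * floorlog 2 n + floorlog 2 K + floorlog 2 gd"
text \<open>The 10 additional bits give \<open>2 ^ f >= 1024 * (len + K)\<close>. This leaves room
  for \<open>256 * sc\<close>, and for the words in use including their rounding within half of the
  input length.\<close>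

definition "f = floorlog 2 (len + K) + 10"
definition "wl = 4 * f"
definition "sc = (2::nat) ^ ceillog2 (2 * K)"
definition "nn = num_words wl n"
definition "gg = num_words wl gd"
definition "ll = 2 ^ (f - 1) div wl + 1"
definition "pp = ll - (nn + gg + 3)"
definition "qq = (2::nat) ^ (wl - 4)"
definition "D = (2::nat) ^ (wl * ll)"

lemma f: "11 \<le> f" "1024 * (len + K) \<le> 2 ^ f" "2 ^ f \<le> 2048 * (len + K)"
proof -
  have "0 < len + K" using K_pos by simp
  then have b: "2 ^ (floorlog 2 (len + K) - 1) \<le> len + K" "len + K < 2 ^ floorlog 2 (len + K)"
    "0 < floorlog 2 (len + K)"
    using floorlog_bounds[of "len + K" 2] floorlog_eq_zero_iff[of 2 "len + K"] by auto
  have "floorlog 2 (len + K) = Suc (floorlog 2 (len + K) - 1)" using b(3) by simp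
  then have "(2::nat) ^ floorlog 2 (len + K) = 2 * 2 ^ (floorlog 2 (len + K) - 1)"
    by (metis power_Suc)
  then have c: "(2::nat) ^ floorlog 2 (len + K) \<le> 2 * (len + K)" using b(1) by simp
  have "(2::nat) ^ f = 1024 * 2 ^ floorlog 2 (len + K)"
    by (simp add: f_def power_add)
  then show "11 \<le> f" "1024 * (len + K) \<le> 2 ^ f" "2 ^ f \<le> 2048 * (len + K)"
    using b c by (auto simp: f_def)
qed

lemma f_pow: "2 ^ f = 4 * (2::nat) ^ (f - 2)" "2 ^ (f - 1) = 2 * (2::nat) ^ (f - 2)"
proof -
  have "f = Suc (Suc (f - 2))" "f - 1 = Suc (f - 2)" using f by simp_all
  then show "2 ^ f = 4 * (2::nat) ^ (f - 2)" "2 ^ (f - 1) = 2 * (2::nat) ^ (f - 2)"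
    using power_Suc[of "2::nat" "Suc (f - 2)"] power_Suc[of "2::nat" "f - 2"] by simp_all
qed

lemma wl: "44 \<le> wl" "0 < wl" "5 * wl \<le> 2 ^ (f - 2)"
  using f linear_le_two_power[of f] by (simp_all add: wl_def)

lemma ll: "2 ^ (f - 1) < ll * wl" "ll * wl \<le> 2 ^ (f - 1) + wl" "ll \<le> 2 ^ f"
proof -
  show "2 ^ (f - 1) < ll * wl"
    using dividend_less_div_times[of wl "2 ^ (f - 1)"] wl by (simp add: ll_def algebra_simps)
  show "ll * wl \<le> 2 ^ (f - 1) + wl" by (simp add: ll_def)
  have "2 ^ (f - 1) div wl \<le> (2::nat) ^ (f - 1)" by simp
  moreover have "(1::nat) \<le> 2 ^ (f - 1)" by simp
  moreover have "(2::nat) ^ (f - 1) + 2 ^ (f - 1) = 2 ^ f" using f_pow by simp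
  ultimately show "ll \<le> 2 ^ f" unfolding ll_def by linarith
qed

lemma word_bits: "wl * nn < floorlog 2 n + wl" "wl * gg < floorlog 2 gd + wl"
  unfolding nn_def gg_def using n gd wl by (auto intro!: num_words_bits)

text \<open>Rounding \<open>n\<close> and \<open>gd\<close> up to whole words wastes less than one
  word each; with the three extra words in \<mu> this makes \<open>5 * wl\<close>. It follows that
  the subtraction defining \<open>pp\<close> is not truncated.\<close>

lemma active_words: "(nn + gg + 3) * wl \<le> len + 5 * wl" "nn + gg + 3 < ll"
proof -
  show 1: "(nn + gg + 3) * wl \<le> len + 5 * wl"
    using word_bits by (simp add: len_def algebra_simps)
  also have "\<dots> \<le> 2 ^ (f - 1)"
    using f(2) wl(3) f_pow by simp
  also have "\<dots> < ll * wl" by (rule ll)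
  finally show "nn + gg + 3 < ll" by simp
qed

lemma sc: "2 * K \<le> sc" "sc < 4 * K" "256 * sc \<le> 2 ^ f"
proof -
  show "2 * K \<le> sc" unfolding sc_def by (rule le_two_power_ceillog2)
  show "sc < 4 * K" unfolding sc_def using two_power_ceillog2_gt[of "2 * K"] K_pos by simp
  then show "256 * sc \<le> 2 ^ f" using f by simp
qed

text \<open>The factor 4 in \<open>wl\<close> matches the fourth power of the scale required by
  \<open>geom\<close>, since \<open>2 ^ f\<close> exceeds a multiple of \<open>sc\<close>.\<close>

lemma pow_wl: "2 ^ wl = ((2::nat) ^ f) ^ 4"
  by (simp add: wl_def mult.commute flip: power_mult)

sublocale geom wl sc nn gg
proof
  show "2 \<le> sc" using sc(1) K_pos by linarith
  have "(8 * sc) ^ 4 \<le> (2 ^ f) ^ 4" using sc by (intro power_mono) auto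
  then show "2 ^ 12 * sc ^ 4 \<le> 2 ^ wl" by (simp add: pow_wl power_mult_distrib)
qed

sublocale layout wl sc nn gg pp qq
proof
  show "0 < nn" unfolding nn_def using n wl by (intro num_words_pos) auto
  have "wl = 4 + (wl - 4)" using wl by simp
  then show "16 * qq = 2 ^ wl"
    unfolding qq_def using power_add[of "2::nat" 4 "wl - 4"] by simp
  have "(2::nat) ^ f + 2 \<le> 2 ^ Suc f"
    using f power_increasing[of 1 f "2::nat"] by simp
  also have "\<dots> \<le> 2 ^ (wl - 4)"
    using f by (intro power_increasing) (auto simp: wl_def)
  finally show "\<mu> + pp + 2 \<le> qq"
    using ll active_words by (simp add: qq_def \<mu>_def pp_def)
  have "e0 + 1 \<le> 2 ^ f"
  proof -
    have "e0 + wl = (nn + gg + 3) * wl" by (simp add: e0_def \<mu>_def algebra_simps)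
    also have "\<dots> \<le> len + 5 * wl" by (rule active_words)
    finally have "e0 + wl \<le> len + 5 * wl" .
    moreover have "len \<le> 2 ^ (f - 2)" using f(2) f_pow(1) by simp
    moreover have "(2::nat) ^ (f - 2) + 2 ^ (f - 2) \<le> 2 ^ f" using f_pow(1) by simp
    ultimately show ?thesis using wl(1,3) by linarith
  qed
  moreover have "\<sigma> \<le> 2 ^ f" using \<sigma>_le sc by simp
  ultimately have "(e0 + 1) * \<sigma> \<le> 2 ^ f * 2 ^ f" by (rule mult_le_mono)
  also have "\<dots> = 2 ^ (f + f)" by (simp add: power_add)
  also have "\<dots> < 2 ^ wl" using f by (intro power_strict_increasing) (auto simp: wl_def)
  finally show "(e0 + 1) * \<sigma> < W" by (simp add: W_def)
qed

sublocale prog wl sc nn gg pp qq K ll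
proof
  show "\<exists>k. sc = 2 ^ k" unfolding sc_def by blast
  show "ll = 2 ^ (wl div 4 - 1) div wl + 1" by (simp add: ll_def wl_def)
  show "ll = \<mu> + pp" using active_words by (simp add: \<mu>_def pp_def)
qed (use sc K_pos in auto)

section \<open>Privacy and accuracy of the sampler\<close>

definition "G i = W ^ pp * \<Gamma> i"

abbreviation "sample \<equiv> clamped_noise n D G"

lemma n_less: "n < W ^ nn"
  unfolding W_power nn_def using wl by (intro num_words_less)

lemma gd_less: "gd < W ^ gg"
  unfolding W_power gg_def using wl by (intro num_words_less)

lemma D_eq: "D = W ^ pp * W ^ \<mu>" "D = W ^ ll"
  by (simp_all add: D_def W_power lam(2) add_mult_distrib2 flip: power_add)

lemma tails: "tails n D G"
proof
  show "2 * G 0 \<le> D"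
    using mult_le_mono2[OF \<Gamma>0_half, of "W ^ pp"] by (simp add: G_def D_eq algebra_simps)
  show "G j \<le> G i" if "i \<le> j" "j < n" for i j
    unfolding G_def using that n_less by (intro mult_le_mono2 \<Gamma>_antimono) auto
qed (use n in \<open>auto simp: D_def\<close>)

text \<open>The factor in \<open>rel\<close> is the quadratic Taylor polynomial of exp at
  \<open>1 / sc\<close>, and \<open>sc >= 2 * K\<close> bounds \<open>1 / sc\<close> by
  \<epsilon>/2.\<close>

lemma rel_exp:
  assumes "rel a b"
  shows "real a \<le> exp (1 / K / 2) * real b"
proof -
  have s: "0 < sc" using sc K_pos by simp
  have "real (2 * sc ^ 2 * a) \<le> real ((2 * sc ^ 2 + 2 * sc + 1) * b)"
    using assms unfolding rel_def by (simp only: of_nat_le_iff)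
  then have "real a \<le> (2 * real sc ^ 2 + 2 * sc + 1) / (2 * real sc ^ 2) * b"
    using s by (simp add: field_simps)
  also have "(2 * real sc ^ 2 + 2 * sc + 1) / (2 * real sc ^ 2) = 1 + 1 / sc + (1 / sc)\<^sup>2 / 2"
    using s by (simp add: field_simps power2_eq_square)
  finally have "real a \<le> (1 + 1 / sc + (1 / sc)\<^sup>2 / 2) * b" .
  also have "\<dots> \<le> exp (1 / sc) * b"
    by (intro mult_right_mono exp_lower_Taylor_quadratic) auto
  also have "\<dots> \<le> exp (1 / K / 2) * b"
  proof (intro mult_right_mono)
    have "real (2 * K) \<le> real sc" using sc by (simp only: of_nat_le_iff)
    then show "exp (1 / real sc) \<le> exp (1 / real K / 2)"
      using K_pos s by (simp add: field_simps)
  qed simp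
  finally show ?thesis .
qed

lemma diff_private_sample: "diff_private_counting n D (1 / K / 2) 0 sample"
proof -
  interpret tails n D G by (rule tails)
  have sc: "real (W ^ pp * a) \<le> exp (1 / K / 2) * real (W ^ pp * b)" if "rel a b" for a b
    using mult_left_mono[OF rel_exp[OF that], of "real (W ^ pp)"] by (simp add: algebra_simps)
  have tail0: "tail 0 = W ^ pp * (W ^ \<mu> - \<Gamma> 0)" "tail (Suc k) = W ^ pp * \<Gamma> k" for k
    unfolding tail_def G_def by (simp_all add: D_eq diff_mult_distrib2)
  have mass0: "mass 0 = W ^ pp * (W ^ \<mu> - 2 * \<Gamma> 0)"
    unfolding mass_def G_def by (simp add: D_eq diff_mult_distrib2)
  have massS: "mass (Suc k) = W ^ pp * (dec k + W)" if "Suc k < n" for k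
    using \<Gamma>_Suc[of k] that n_less by (simp add: mass_def G_def flip: diff_mult_distrib2)
  show ?thesis
  proof (rule diff_private_clamped_noise)
    fix k assume "k < n"
    show "tail k \<le> exp (1 / K / 2) * tail (Suc k) \<and> tail (Suc k) \<le> exp (1 / K / 2) * tail k"
    proof (cases k)
      case 0
      then show ?thesis unfolding 0 tail0 using rel_init by (intro conjI sc)
    next
      case (Suc j)
      then have "Suc j < W ^ nn" using \<open>k < n\<close> n_less by simp
      then show ?thesis unfolding Suc tail0
        by (intro conjI sc rel_\<Gamma> rel_le \<Gamma>_antimono) auto
    qed
  next
    fix k assume k: "Suc k < n"
    show "mass k \<le> exp (1 / K / 2) * mass (Suc k) \<and> mass (Suc k) \<le> exp (1 / K / 2) * mass k"
    proof (cases k)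
      case 0
      then show ?thesis using k rel_init' by (simp only: mass0 massS) (intro conjI sc)
    next
      case (Suc j)
      then show ?thesis using k dec_rel[of j] by (simp only: massS Suc_lessD) (intro conjI sc)
    qed
  qed
qed

text \<open>The choice of \<open>a\<close> makes the geometric part of the two tails at most \<beta>
  - \<gamma>, and \<open>\<Gamma>_tail\<close> bounds the rest by \<gamma>. For \<beta> < 1 the
  bound \<open>a\<close> is positive, hence a natural number; otherwise the claim is
  trivial.\<close>

lemma accurate_sample:
  assumes "1 / gd < \<beta>"
  shows "accurate n D \<lceil>1 / ln (1 + 1 / sc) * ln (1 / (\<beta> - 1 / gd))\<rceil> \<beta> sample"
proof -
  interpret tails n D G by (rule tails)
  have sc0: "0 < sc" using sc K_pos by simp
  define L where "L = ln (1 + 1 / sc)"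
  have L: "L > 0" unfolding L_def using sc0 by (intro ln_gt_zero) simp
  define a where "a = \<lceil>1 / L * ln (1 / (\<beta> - 1 / gd))\<rceil>"
  have "measure_pmf.prob (pmf_of_set {1..D}) {u. \<bar>int (sample c u) - int c\<bar> \<le> a} \<ge> 1 - \<beta>" if c: "c \<le> n" for c
  proof (cases "\<beta> < 1")
    case False
    then show ?thesis using measure_nonneg[of "pmf_of_set {1..D}"] by (smt (verit) measure_nonneg)
  next
    case True
    define x where "x = \<beta> - 1 / gd"
    have "0 < 1 / real gd" using gd by simp
    then have x: "0 < x" "x < 1" using assms True unfolding x_def by linarith+
    have "0 < ln (1 / x)" using x by simp
    then have "0 < 1 / L * ln (1 / x)" using L by simp
    then have "0 < a" unfolding a_def x_def[symmetric] by simp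
    then obtain k where k: "a = int k" using pos_int_cases by blast
    have "1 / L * ln (1 / x) \<le> k"
    proof -
      have "1 / L * ln (1 / x) \<le> real_of_int a"
        unfolding a_def x_def[symmetric] by (rule le_of_int_ceiling)
      then show ?thesis using k by simp
    qed
    then have "ln (1 / x) \<le> k * L"
      using L by (simp add: field_simps)
    then have "- (k * L) \<le> ln x"
      using x by (simp add: ln_div)
    then have e: "exp (- (k * L)) \<le> x" using x by (simp add: ln_ge_iff)
    have "(sc / (sc + 1)) ^ k = exp (- (k * L))"
    proof -
      have "exp L = (sc + 1) / sc" using sc0 by (simp add: L_def field_simps)
      then have "sc / (sc + 1) = exp (- L)" by (simp add: exp_minus)
      then show ?thesis by (simp add: exp_of_nat_mult[symmetric])
    qed
    then have "2 * real (\<Gamma> k) \<le> (1 / gd + exp (- (k * L))) * W ^ \<mu>"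
      using \<Gamma>_tail[OF gd_less gd, of k] by simp
    also have "\<dots> \<le> \<beta> * W ^ \<mu>"
      using e by (intro mult_right_mono) (auto simp: x_def)
    finally have "real (W ^ pp) * (2 * real (\<Gamma> k)) \<le> real (W ^ pp) * (\<beta> * W ^ \<mu>)"
      by (intro mult_left_mono) auto
    then have "2 * real (G k) \<le> \<beta> * D" by (simp add: G_def D_eq algebra_simps)
    moreover have "0 \<le> \<beta>" using assms \<open>0 < 1 / real gd\<close> by linarith
    ultimately show ?thesis
      unfolding k by (intro prob_clamped_noise_ge c)
  qed
  then show ?thesis unfolding accurate_def a_def L_def by blast
qed

section \<open>Word length, outputs and running times\<close>

lemma input_bits: "floorlog 2 n + floorlog 2 K + floorlog 2 gd + floorlog 2 n + floorlog 2 D = len + (wl * ll + 1)"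
proof -
  have "floorlog 2 D = wl * ll + 1"
    using floorlog_power[of 1 2 "wl * ll"] by (simp add: D_def floorlog_def)
  then show ?thesis by (simp add: len_def)
qed

text \<open>The random value contributes slightly more than \<open>2 ^ (f - 1)\<close> bits, and the
  other inputs together with the rounding to words are too short to reach \<open>2 ^ f\<close>. So
  the input length has exactly \<open>f\<close> bits, which breaks the circular dependence between
  word length and size of \<open>D\<close>.\<close>

lemma word_length_eq: "word_length 4 (len + (wl * ll + 1)) = wl"
proof -
  have "2 ^ (f - 1) \<le> len + (wl * ll + 1)"
    using ll(1) by (simp add: mult.commute)
  then have "f \<le> floorlog 2 (len + (wl * ll + 1))"
    by (intro floorlog_geI) auto
  moreover have "len + (wl * ll + 1) < 2 ^ f"
    using ll(2) f(2) wl(1,3) f_pow K_pos by (simp add: mult.commute)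
  then have "floorlog 2 (len + (wl * ll + 1)) \<le> f"
    by (intro floorlog_leI) auto
  ultimately show ?thesis by (simp add: word_length_def wl_def)
qed

text \<open>The search leaves index \<open>W ^ nn - 1\<close> undecided; this is harmless because
  \<open>n < W ^ nn\<close> places it outside the counted range.\<close>

lemma card_accepts:
  assumes "found xb J"
  shows "card {i. i < n \<and> accepts xb i} = min n J"
proof -
  have down: "accepts xb i" if "accepts xb j" "i \<le> j" "j < W ^ nn" for i j
    using that \<Gamma>_antimono[of i j] by (auto simp: accepts_def)
  have "accepts xb i \<longleftrightarrow> i < J" if i: "i < n" for i
  proof
    assume "i < J"
    then show "accepts xb i"
      using assms down[of "J - 1" i] by (auto simp: found_def)
  next
    assume acc: "accepts xb i"
    show "i < J"
    proof (rule ccontr)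
      assume "\<not> i < J"
      then have "accepts xb J" "J + 1 \<noteq> W ^ nn"
        using down[OF acc, of J] acc i n_less down[of i J] by auto
      then show False using assms by (auto simp: found_def)
    qed
  qed
  then have "{i. i < n \<and> accepts xb i} = {..<min n J}" by auto
  then show ?thesis by simp
qed

text \<open>As the tails are multiples of \<open>P = W ^ pp\<close>, the comparison
  \<open>u <= P * b\<close> means \<open>(u - 1) div P < b\<close> and depends on the upper words
  \<open>x\<close> only. The search result may exceed \<open>n\<close>, but \<open>c <= n\<close>
  makes clamping give the same output.\<close>

lemma sample_eq:
  assumes u: "1 \<le> u" "u \<le> D" and c: "c \<le> n"
    and x: "x = (u - 1) div W ^ pp" "xb = (if 2 * x < W ^ \<mu> then W ^ \<mu> - 1 - x else x)"
    and J: "found xb J"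
  shows "sample c u = (if 2 * x < W ^ \<mu> then c - J else min n (c + J))"
proof -
  define P where "P = W ^ pp"
  have P: "0 < P" using W_pos by (simp add: P_def)
  define r where "r = (u - 1) mod P"
  have r: "r < P" "u - 1 = P * x + r" using P by (simp_all add: r_def x P_def)
  have DP: "D = P * W ^ \<mu>" by (simp add: P_def D_eq)
  have xlt: "x < W ^ \<mu>"
  proof -
    have "P * x \<le> u - 1" unfolding r(2) by simp
    also have "\<dots> < P * W ^ \<mu>" using u by (simp add: DP)
    finally show ?thesis by simp
  qed
  \<comment> \<open>Here \<open>D - u\<close> is the complement of \<open>u - 1\<close> with respect
    to \<open>D - 1\<close>, an integer with all bits set, so its upper part is the complement of
    \<open>x\<close>.\<close>
  have Deq: "D - u = P * (W ^ \<mu> - 1 - x) + (P - 1 - r)"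
  proof -
    obtain k where k: "W ^ \<mu> = x + 1 + k" using xlt by (metis Suc_eq_plus1 Suc_leI le_Suc_ex)
    have "u = P * x + r + 1" using r(2) u(1) by linarith
    moreover have "D = P * x + P + P * k" unfolding DP k by (simp add: algebra_simps)
    ultimately show ?thesis unfolding k using r(1) by simp
  qed
  obtain H where H: "W ^ \<mu> = 2 * H"
  proof -
    have "W ^ \<mu> = W * 2 ^ e0" by (rule W_pow_\<mu>)
    also have "\<dots> = 2 * (2 * thr * 2 ^ e0)" by (simp add: W_thr)
    finally show thesis by (rule that)
  qed
  have "2 * u \<le> D \<longleftrightarrow> u - 1 < P * H"
    using u by (auto simp: DP H)
  also have "\<dots> \<longleftrightarrow> x < H"
    using P by (simp add: x P_def div_less_iff_less_mult mult.commute)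
  finally have low: "2 * u \<le> D \<longleftrightarrow> 2 * x < W ^ \<mu>" by (simp add: H)
  have div: "a \<le> P * b \<longleftrightarrow> (a - 1) div P < b" if "1 \<le> a" for a b
    using that P by (auto simp: div_less_iff_less_mult mult.commute)
  have lo: "u \<le> G i \<longleftrightarrow> accepts xb i" if "2 * x < W ^ \<mu>" for i
    using that xlt unfolding G_def P_def[symmetric] div[OF u(1)] accepts_def x(2)
    by (auto simp: x P_def)
  have "(D + 1 - u - 1) div P = W ^ \<mu> - 1 - x"
    using Deq P r(1) by (simp add: div_nat_eqI)
  then have hi: "D + 1 - u \<le> G i \<longleftrightarrow> accepts xb i" if "\<not> 2 * x < W ^ \<mu>" for i
    using that xlt u div[of "D + 1 - u" "\<Gamma> i"] unfolding G_def P_def[symmetric] accepts_def x(2)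
    by auto
  show ?thesis
    using lo hi card_accepts[OF J] c low
    by (cases "2 * x < W ^ \<mu>") (auto simp: clamped_noise_def rank_def)
qed

lemma qq_big: "4 * 2 ^ f \<le> qq"
proof -
  have "(4::nat) * 2 ^ f = 2 ^ (f + 2)" by (simp add: power_add)
  also have "\<dots> \<le> qq" unfolding qq_def using f by (intro power_increasing) (auto simp: wl_def)
  finally show ?thesis .
qed

lemma qq_less: "qq < 2 ^ wl"
  unfolding qq_def using wl by (intro power_strict_increasing) auto

lemma K_words: "num_words wl K = 1" "K < 2 ^ wl"
proof -
  have "K \<le> 2 ^ f" using f by simp
  also have "(2::nat) ^ f < 2 ^ wl" using f by (intro power_strict_increasing) (auto simp: wl_def)
  finally show 1: "K < 2 ^ wl" .
  then have "num_words wl K \<le> 1"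
    unfolding num_words_def using Suc_0_less_two_power[of wl] wl by (intro floorlog_leI) auto
  then show "num_words wl K = 1" using num_words_pos[of wl K] wl K_pos by simp
qed

lemma first_word: "\<not> (digit wl n 0 = 1 \<and> nn = 1)"
  using n num_words_less[of wl n] wl by (auto simp: digit_def nn_def)

lemma outputs_P:
  assumes c: "c \<le> n" and u: "1 \<le> u" "u \<le> D" and T: "real (P_time + 10) \<le> T"
  shows "outputs_within wl mc P_com [n, K, gd, c, u] (sample c u) T"
proof (rule tr_outputs_within[OF _ T])
  define xs where "xs = [n, K, gd, c, u]"
  define R where "R = input_registers wl xs"
  define m where "m = input_memory wl xs"
  have w0: "0 < wl" by (rule wl)
  have cw: "num_words wl c \<le> nn" unfolding nn_def by (intro num_words_mono c)
  \<comment> \<open>The largest value \<open>u = D = W ^ ll\<close> needs one word more than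
    \<open>ll\<close>.\<close>
  have uw: "num_words wl u \<le> ll + 1"
  proof -
    have "u \<le> 2 ^ (wl * ll)" using u(2) by (simp add: D_def)
    also have "\<dots> < 2 ^ (wl * (ll + 1))" using wl by (intro power_strict_increasing) auto
    also have "\<dots> = (2 ^ wl) ^ (ll + 1)" by (simp only: power_mult)
    finally have "u < (2 ^ wl) ^ (ll + 1)" .
    then show ?thesis
      unfolding num_words_def using Suc_0_less_two_power[of wl] wl by (intro floorlog_leI) auto
  qed
  have R: "R 0 = 0" "R 1 = nn" "R 2 = nn" "R 5 = gg" "R 6 = nn + 1 + gg" "R 7 = num_words wl c"
    "R 8 = nn + 1 + gg + num_words wl c"
    by (simp_all add: R_def xs_def input_registers_def nn_def gg_def K_words)
  have total: "words wl xs = nn + 1 + gg + num_words wl c + num_words wl u"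
    by (simp add: words_def xs_def nn_def gg_def K_words)
  have fit: "words wl xs \<le> qq" "nn + 1 + gg + nn + ll \<le> qq"
    using total cw uw active_words ll(3) qq_big by linarith+
  have wf: "wf_state wl (R, m)"
    unfolding R_def m_def using fit qq_less by (intro wf_state_input) simp
  have m0: "m 0 = digit wl n 0"
    using input_memory_at[of 0 wl n "[]" "[K, gd, c, u]"] nw by (simp add: m_def xs_def words_def nn_def)
  have mK: "m (R 2) = K"
    using input_memory_at[of 0 wl K "[n]" "[gd, c, u]"] K_words
    by (simp add: m_def xs_def words_def nn_def R digit_def)
  have mz: "m x = 0" if "qq \<le> x" for x
    unfolding m_def using that fit by (intro input_memory_beyond) simp
  have vn: "val wl m 0 nn = n"
    using val_input_memory[OF w0, of "[]" n "[K, gd, c, u]"] by (simp add: m_def xs_def words_def nn_def)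
  have vc: "val wl m (R 6) (R 7) = c"
    using val_input_memory[OF w0, of "[n, K, gd]" c "[u]"]
    by (simp add: m_def xs_def words_def nn_def gg_def R K_words add.assoc)
  have vu: "val wl m (R 8) ll = u mod W ^ ll"
    using val_input_memory_last[OF w0, of "[n, K, gd, c]" u ll]
    by (simp add: m_def xs_def words_def nn_def gg_def R K_words add.assoc W_power)
  show "tr wl mc P_com (input_registers wl [n, K, gd, c, u], input_memory wl [n, K, gd, c, u]) (P_time + 10)
     (\<lambda>(R, m). R 0 + R 1 \<le> 2 ^ wl \<and> val wl m (R 0) (R 1) = sample c u)"
    unfolding P_com_def xs_def[symmetric] R_def[symmetric] m_def[symmetric]
  proof (rule tr_test[OF w0 wf R(1), where unit = False and T = P_time])
    show "(m 0 = 1 \<and> R 1 = 1) = False" using first_word R m0 by simp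
  next
    fix R' assume wf': "wf_state wl (R', m)" and R': "\<And>r. r < 10 \<Longrightarrow> R' r = R r"
    have r: "R' 0 = R 0" "R' 1 = R 1" "R' 2 = R 2" "R' 5 = R 5" "R' 6 = R 6" "R' 7 = R 7" "R' 8 = R 8"
      by (simp_all add: R')
    show "tr wl mc P_main (R', m) P_time (\<lambda>(R, m). R 0 + R 1 \<le> 2 ^ wl \<and> val wl m (R 0) (R 1) = sample c u)"
    proof (rule tr_P_main[OF wf' _ _ _ _ mz _ _ _ vn _ c _ u(1) _ refl refl le_refl])
      fix R2 m2 J
      assume "found (if 2 * ((u - 1) div W ^ pp) < W ^ \<mu> then W ^ \<mu> - 1 - (u - 1) div W ^ pp else (u - 1) div W ^ pp) J"
        and "R2 0 + R2 1 \<le> 2 ^ wl"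
        and "val wl m2 (R2 0) (R2 1) = (if 2 * ((u - 1) div W ^ pp) < W ^ \<mu> then c - J else min n (c + J))"
      then show "case (R2, m2) of (R, m) \<Rightarrow> R 0 + R 1 \<le> 2 ^ wl \<and> val wl m (R 0) (R 1) = sample c u"
        using sample_eq[OF u c refl refl] by simp
    next
      show "u \<le> W ^ ll" using u D_eq by simp
      show "R' 8 + ll \<le> qq" using fit cw by (simp add: r R)
      show "R' 6 + R' 7 \<le> qq" using fit cw by (simp add: r R)
    qed (use R mK vc vu cw in \<open>simp_all only: r\<close>)
  qed simp_all
qed

lemma outputs_Q:
  assumes z: "z \<le> n" and T: "real (Q_time + 10) \<le> T"
  shows "\<exists>y. real y = scaled_cdf D sample z \<and> outputs_within wl mc Q_com [n, K, gd, z] y T"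
proof (intro exI conjI)
  define y where "y = (if z < n then W ^ pp * (W ^ \<mu> - \<Gamma> z) else W ^ ll)"
  show "real y = scaled_cdf D sample z"
  proof -
    interpret tails n D G by (rule tails)
    have "F 0 z = y" using z by (auto simp: F_def y_def G_def D_eq(1) diff_mult_distrib2 simp flip: D_eq)
    then show ?thesis by (simp add: scaled_cdf_clamped_noise)
  qed
  define xs where "xs = [n, K, gd, z]"
  define R where "R = input_registers wl xs"
  define m where "m = input_memory wl xs"
  have w0: "0 < wl" by (rule wl)
  have zw: "num_words wl z \<le> nn" unfolding nn_def by (intro num_words_mono z)
  have R: "R 0 = 0" "R 1 = nn" "R 2 = nn" "R 5 = gg" "R 6 = nn + 1 + gg"
    by (simp_all add: R_def xs_def input_registers_def nn_def gg_def K_words)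
  have total: "words wl xs = nn + 1 + gg + num_words wl z"
    by (simp add: words_def xs_def nn_def gg_def K_words)
  have fit: "words wl xs \<le> qq" "nn + 1 + gg + nn \<le> qq"
    using total zw active_words ll(3) qq_big by linarith+
  have wf: "wf_state wl (R, m)"
    unfolding R_def m_def using fit qq_less by (intro wf_state_input) simp
  have m0: "m 0 = digit wl n 0"
    using input_memory_at[of 0 wl n "[]" "[K, gd, z]"] nw by (simp add: m_def xs_def words_def nn_def)
  have mK: "m (R 2) = K"
    using input_memory_at[of 0 wl K "[n]" "[gd, z]"] K_words
    by (simp add: m_def xs_def words_def nn_def R digit_def)
  have mz: "m x = 0" if "qq \<le> x" for x
    unfolding m_def using that fit by (intro input_memory_beyond) simp
  have vn: "val wl m 0 nn = n"
    using val_input_memory[OF w0, of "[]" n "[K, gd, z]"] by (simp add: m_def xs_def words_def nn_def)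
  \<comment> \<open>As the last input, \<open>z\<close> is followed by zeros and may be read with
    the word count of \<open>n\<close>.\<close>
  have vz: "val wl m (R 6) nn = z"
    using val_input_memory_last[OF w0, of "[n, K, gd]" z nn] z n_less
    by (simp add: m_def xs_def words_def nn_def gg_def R K_words add.assoc W_power)
  show "outputs_within wl mc Q_com [n, K, gd, z] y T"
  proof (rule tr_outputs_within[OF _ T])
    show "tr wl mc Q_com (input_registers wl [n, K, gd, z], input_memory wl [n, K, gd, z]) (Q_time + 10)
       (\<lambda>(R, m). R 0 + R 1 \<le> 2 ^ wl \<and> val wl m (R 0) (R 1) = y)"
      unfolding Q_com_def xs_def[symmetric] R_def[symmetric] m_def[symmetric]
    proof (rule tr_test[OF w0 wf R(1), where unit = False and T = Q_time])
      show "(m 0 = 1 \<and> R 1 = 1) = False" using first_word R m0 by simp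
    next
      fix R' assume wf': "wf_state wl (R', m)" and R': "\<And>r. r < 10 \<Longrightarrow> R' r = R r"
      have r: "R' 0 = R 0" "R' 1 = R 1" "R' 2 = R 2" "R' 5 = R 5" "R' 6 = R 6"
        by (simp_all add: R')
      show "tr wl mc Q_main (R', m) Q_time (\<lambda>(R, m). R 0 + R 1 \<le> 2 ^ wl \<and> val wl m (R 0) (R 1) = y)"
      proof (rule tr_Q_main[OF wf' _ _ _ _ mz _ vn _ z le_refl])
        show "R' 6 + nn \<le> qq" using fit by (simp add: r R)
      qed (use R mK vz in \<open>simp_all only: r y_def, simp_all\<close>)
    qed simp_all
  qed
qed

text \<open>One evaluation takes at most of order \<open>K * (S + wl)\<close> steps, where
  \<open>wl\<close> stems from rounding up to words, and \<open>S + wl\<close> is at most of order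
  \<open>S * f\<close>. The sampler makes \<open>nn * wl\<close>, hence at most
  \<open>5 * a * f\<close>, evaluations. Reading the padded random value costs \<open>ll\<close>,
  itself of order \<open>K * S\<close>. The numerical constants are merely sufficient.\<close>

lemma sizes:
  defines "a \<equiv> floorlog 2 n" and "S \<equiv> floorlog 2 n + floorlog 2 gd"
  shows "2 \<le> a" "a < S" "len + K \<le> 4 * (K * S)" "Q_time + 10 \<le> 9000 * (K * S * f)"
    "P_time + 10 \<le> 150000 * (a * f * (K * S * f))"
proof -
  show a: "2 \<le> a" unfolding a_def using n by (intro floorlog_geI) auto
  have "1 \<le> floorlog 2 gd" using gd by (intro floorlog_geI) auto
  then show S: "a < S" by (simp add: S_def a_def)
  have "K < 2 ^ K" by (rule less_exp)
  then have "floorlog 2 K \<le> K" by (intro floorlog_leI) auto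
  moreover have "S \<le> K * S" "K \<le> K * S" using K_pos S by auto
  ultimately show lenK: "len + K \<le> 4 * (K * S)"
    unfolding len_def S_def by linarith
  define Y where "Y = K * S * f"
  have f1: "1 \<le> f" using f by simp
  have "1 \<le> K * S" using K_pos S by simp
  then have Y: "K * S \<le> Y" "f \<le> Y" "1 \<le> Y" "K \<le> Y" "S * f \<le> Y"
    using f1 \<open>K \<le> K * S\<close> \<open>S \<le> K * S\<close> unfolding Y_def
    by (auto intro: le_trans[of K "K * S"] mult_le_mono1)
  have wbits: "wl * nn \<le> a + wl" "wl * gg \<le> floorlog 2 gd + wl"
    using word_bits by (simp_all add: a_def)
  have "\<mu> * wl \<le> S + 5 * wl"
    using wbits by (simp add: \<mu>_def S_def a_def algebra_simps)
  moreover have "S \<le> S * f" "f \<le> S * f" using S f1 by auto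
  ultimately have \<mu>wl: "\<mu> * wl \<le> 21 * (S * f)"
    unfolding wl_def by linarith
  have "\<mu> \<le> \<mu> * wl" using wl by simp
  then have \<mu>: "\<mu> \<le> 21 * Y" using \<mu>wl Y(5) by linarith
  then have words: "nn \<le> 21 * Y" "gg \<le> 21 * Y" by (simp_all add: \<mu>_def)
  have "e0 + wl = \<mu> * wl" by (simp add: e0_def \<mu>_def algebra_simps)
  then have "e0 + 1 \<le> 21 * (S * f)" using \<mu>wl wl by linarith
  moreover have "\<sigma> \<le> 19 * K" using sc K_pos by (simp add: \<sigma>_def)
  ultimately have "(e0 + 1) * \<sigma> \<le> (21 * (S * f)) * (19 * K)" by (rule mult_le_mono)
  then have it: "(e0 + 1) * \<sigma> \<le> 399 * Y" by (simp add: Y_def mult_ac)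
  have ev: "eval_time \<le> 7846 * Y"
  proof -
    define z where "z = (e0 + 1) * \<sigma>"
    have "eval_time = 13 * nn + 13 * \<mu> + 18 * z + 118"
      unfolding eval_time_def z_def[symmetric] by simp
    moreover have "z \<le> 399 * Y" unfolding z_def by (rule it)
    ultimately show ?thesis using \<mu> words Y(3) by linarith
  qed
  have st: "setup_time \<le> 391 * Y"
    unfolding setup_time_def using words Y wl_def by linarith
  have lY: "ll \<le> 8192 * Y"
  proof -
    have "ll \<le> 2048 * (len + K)" using ll(3) f(3) by (rule le_trans)
    also have "\<dots> \<le> 2048 * (4 * (K * S))" by (intro mult_le_mono2 lenK)
    also have "\<dots> \<le> 8192 * Y" using Y(1) by simp
    finally show ?thesis .
  qed
  show "Q_time + 10 \<le> 9000 * (K * S * f)"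
    unfolding Y_def[symmetric] Q_time_def using ev st words Y(3) by linarith
  have "search_step_time + 1 \<le> 8150 * Y"
    unfolding search_step_time_def using ev \<mu> Y(3) by linarith
  moreover have "nn * wl \<le> 5 * (a * f)"
  proof -
    have "a \<le> a * f" "f \<le> a * f" using a f1 by auto
    moreover have "nn * wl = wl * nn" by (rule mult.commute)
    ultimately show ?thesis using wbits(1) wl_def by linarith
  qed
  ultimately have "nn * wl * (search_step_time + 1) \<le> (5 * (a * f)) * (8150 * Y)"
    by (rule mult_le_mono[rotated])
  then have loop: "nn * wl * (search_step_time + 1) \<le> 40750 * (a * f * Y)"
    by (simp add: mult_ac)
  have "1 * Y \<le> a * f * Y" using a f1 by (intro mult_le_mono1) simp
  then have aY: "Y \<le> a * f * Y" by simp
  have prep: "prepare_time \<le> 107806 * Y"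
    unfolding prepare_time_def using st lY \<mu> words Y(3) by linarith
  have fin: "finish_time \<le> 1152 * Y"
    unfolding finish_time_def using words Y(3) by linarith
  show "P_time + 10 \<le> 150000 * (a * f * (K * S * f))"
    unfolding Y_def[symmetric] P_time_def using loop aY prep fin Y(3) by linarith
qed

end

lemma floorlog_le_log: "0 < n \<Longrightarrow> real (floorlog 2 n) \<le> log 2 n + 1"
  by (simp add: floorlog_def)

section \<open>The range of \<open>eps_tilde\<close>\<close>

lemma eps_tilde_eq:
  assumes "0 < K"
  shows "eps_tilde (1 / real K) = 2 * ln (1 + 1 / 2 ^ ceillog2 (2 * K))"
proof -
  have "0 \<le> log 2 (real (2 * K))" using assms by simp
  then have "real_of_int \<lceil>log 2 (2 / (1 / real K))\<rceil> = real (ceillog2 (2 * K))"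
    using assms by (simp add: ceillog2_def)
  then show ?thesis
    unfolding eps_tilde_def by (simp add: powr_minus powr_realpow divide_inverse)
qed

text \<open>The upper bound is ln(1 + x) <= x with x = 1/s <= 1/(2K). For the lower bound, ln(1 + x)
  >= x - x^2, which increases on [0, 1/2], is evaluated at a lower bound for x.\<close>

lemma eps_tilde_bounds:
  assumes K: "0 < K"
  shows "eps_tilde (1 / real K) \<le> 1 / K" "4 / 9 * (1 / real K) < eps_tilde (1 / real K)"
proof -
  define s where "s = (2::nat) ^ ceillog2 (2 * K)"
  have s: "2 * K \<le> s" "s < 4 * K"
    using le_two_power_ceillog2[of "2 * K"] two_power_ceillog2_gt[of "2 * K"] K by (auto simp: s_def)
  define x where "x = 1 / real s"
  have eq: "eps_tilde (1 / real K) = 2 * ln (1 + x)"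
    using eps_tilde_eq[OF K] by (simp add: x_def s_def)
  have "real (2 * K) \<le> real s" using s by (simp only: of_nat_le_iff)
  then have x: "0 < x" "x \<le> 1 / (2 * real K)"
    using K by (auto simp: x_def field_simps)
  have "ln (1 + x) \<le> x" using x by (intro ln_add_one_self_le_self) simp
  then show "eps_tilde (1 / real K) \<le> 1 / K"
  proof -
    have "2 * ln (1 + x) \<le> 2 * (1 / (2 * real K))"
      using x \<open>ln (1 + x) \<le> x\<close> by linarith
    then show ?thesis by (simp add: eq)
  qed
  have "1 / (2 * real K) \<le> 1" using K by simp
  then have ln: "x - x\<^sup>2 \<le> ln (1 + x)"
    using x by (intro ln_one_plus_pos_lower_bound) auto
  have "2 / 9 * (1 / real K) < x - x\<^sup>2"
  proof (cases "K = 1")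
    case True
    then have "s = 2" using s by (simp add: s_def numeral_2_eq_2[symmetric])
    then show ?thesis using True by (simp add: x_def power2_eq_square)
  next
    case False
    then have K2: "2 \<le> K" using K by simp
    \<comment> \<open>For K >= 2 the power \<open>s\<close> is a multiple of 4, which sharpens
      \<open>s < 4 * K\<close>. The sharper bound matters: at x = 1/(4K) the estimate x - x^2 falls
      short of 2/(9K) when K = 2.\<close>
    have "s \<le> 4 * (K - 1)"
    proof -
      have "ceillog2 (2 * K) \<ge> 2"
        using K2 by (subst ceillog2_ge_iff) auto
      then obtain j where "ceillog2 (2 * K) = 2 + j" using le_Suc_ex by blast
      then have "s = 4 * 2 ^ j" by (simp add: s_def power_add)
      then show ?thesis using s by simp
    qed
    then have "real s \<le> real (4 * (K - 1))" by (simp only: of_nat_le_iff)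
    also have "\<dots> = 4 * (real K - 1)" using K2 by (simp add: of_nat_diff)
    finally have "real s \<le> 4 * (real K - 1)" .
    define y where "y = 1 / (4 * (real K - 1))"
    have y: "0 < y" "y \<le> x" "y \<le> 1 / 4"
      using K2 \<open>real s \<le> 4 * (real K - 1)\<close> s K by (auto simp: y_def x_def field_simps)
    have "1 / (2 * real K) \<le> 1 / 4" using K2 by (simp add: field_simps)
    then have "x \<le> 1 / 4" using x by linarith
    then have "0 \<le> (x - y) * (1 - x - y)" using y by (intro mult_nonneg_nonneg) auto
    then have "y - y\<^sup>2 \<le> x - x\<^sup>2" by (simp add: algebra_simps power2_eq_square)
    moreover have "2 / 9 * (1 / real K) < y - y\<^sup>2"
    proof -
      define t where "t = real K - 1"
      have t: "1 \<le> t" "real K = t + 1" using K2 by (auto simp: t_def)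
      have "32 * t\<^sup>2 < (36 * t - 9) * (t + 1)"
      proof -
        have "1 \<le> t * t" using mult_mono[of 1 t 1 t] t by simp
        then have "9 < t * (t * 4) + t * 27" using t by (simp add: mult.assoc[symmetric])
        then show ?thesis by (simp add: algebra_simps power2_eq_square)
      qed
      then have "2 / (9 * (t + 1)) < (4 * t - 1) / (16 * t\<^sup>2)"
        using t by (simp add: field_simps power2_eq_square)
      also have "\<dots> = y - y\<^sup>2"
        using t by (simp add: y_def t(2) field_simps power2_eq_square)
      finally show ?thesis using t by simp
    qed
    ultimately show ?thesis by linarith
  qed
  then show "4 / 9 * (1 / real K) < eps_tilde (1 / real K)"
    using ln unfolding eq by linarith
qed

section \<open>Asymptotics\<close>

definition fast_dim :: "nat \<Rightarrow> real \<Rightarrow> real \<Rightarrow> nat" where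
  "fast_dim n \<epsilon> \<gamma> = (if n = 1 then 1 else sampler.D n (denom \<epsilon>) (denom \<gamma>))"

definition fast_sample :: "nat \<Rightarrow> real \<Rightarrow> real \<Rightarrow> nat \<Rightarrow> nat \<Rightarrow> nat" where
  "fast_sample n \<epsilon> \<gamma> =
     (if n = 1 then (\<lambda>c u. 0)
      else clamped_noise n (sampler.D n (denom \<epsilon>) (denom \<gamma>)) (sampler.G n (denom \<epsilon>) (denom \<gamma>)))"

definition sample_time :: "nat \<times> real \<times> real \<Rightarrow> real" where
  "sample_time = (\<lambda>(n, \<epsilon>, \<gamma>). if n = 1 then 20 else
     let a = floorlog 2 n; K = denom \<epsilon>; f = sampler.f n K (denom \<gamma>)
     in real (150000 * (a * f * (K * (a + floorlog 2 (denom \<gamma>)) * f))))"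

definition cdf_time :: "nat \<times> real \<times> real \<Rightarrow> real" where
  "cdf_time = (\<lambda>(n, \<epsilon>, \<gamma>). if n = 1 then 20 else
     let K = denom \<epsilon>
     in real (9000 * (K * (floorlog 2 n + floorlog 2 (denom \<gamma>)) * sampler.f n K (denom \<gamma>))))"

text \<open>For \<open>n = 1\<close> the range has size 1 and logarithm 0, so the factor 0 is
  correct; this also avoids the quotient 0/0 that would occur at \<gamma> = 1.\<close>

definition dim_factor :: "nat \<times> real \<times> real \<Rightarrow> real" where
  "dim_factor = (\<lambda>(n, \<epsilon>, \<gamma>). if n = 1 then 0 else log 2 (fast_dim n \<epsilon> \<gamma>) / log 2 (n / \<gamma>))"

lemma denom_inverse: "denom (1 / real k) = k"
  by (simp add: denom_def)

lemma params_cases: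
  assumes "p \<in> params"
  obtains n K gd where "p = (n, 1 / real K, 1 / real gd)" "1 \<le> n" "0 < K" "0 < gd"
  using assms by (auto simp: params_def inv_nats_def)

lemma soft_O_I:
  assumes "\<And>n K gd g'. 1 \<le> n \<Longrightarrow> 0 < K \<Longrightarrow> 0 < gd \<Longrightarrow> g' = g n (1 / real K) (1 / real gd) \<Longrightarrow>
      \<bar>F (n, 1 / real K, 1 / real gd)\<bar> \<le> C * ((1 + \<bar>g'\<bar>) * log 2 (2 + \<bar>g'\<bar>) ^ k)"
  shows "F \<in> soft_O params (\<lambda>(n, \<epsilon>, \<gamma>). g n \<epsilon> \<gamma>)"
  unfolding soft_O_def
proof (intro CollectI exI ballI)
  fix p assume "p \<in> params"
  then obtain n K gd where p: "p = (n, 1 / real K, 1 / real gd)" "1 \<le> n" "0 < K" "0 < gd"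
    by (rule params_cases)
  show "\<bar>F p\<bar> \<le> C * (1 + \<bar>case p of (n, \<epsilon>, \<gamma>) \<Rightarrow> g n \<epsilon> \<gamma>\<bar>) *
      log 2 (2 + \<bar>case p of (n, \<epsilon>, \<gamma>) \<Rightarrow> g n \<epsilon> \<gamma>\<bar>) ^ k"
    using assms[OF p(2-4) refl] unfolding p(1) by (simp only: mult.assoc prod.case)
qed

lemma log_ge_1: "1 \<le> log 2 (2 + \<bar>x :: real\<bar>)"
  by (simp add: le_log_iff)

context sampler
begin

definition "lg = log 2 (real n / (1 / real gd))"

lemma lg: "lg = log 2 n + log 2 gd" "1 \<le> log 2 n" "0 \<le> log 2 gd" "1 \<le> lg"
proof -
  show 1: "lg = log 2 n + log 2 gd" using n gd by (simp add: lg_def log_mult)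
  show 2: "1 \<le> log 2 n" using n by (simp add: le_log_iff)
  show 3: "0 \<le> log 2 gd" using gd by simp
  show "1 \<le> lg" using 1 2 3 by linarith
qed

lemma Kl: "1 \<le> real K * lg"
  using mult_mono[of 1 "real K" 1 lg] K_pos lg by simp

lemma real_sizes:
  "real (floorlog 2 n) \<le> 2 * log 2 n"
  "real (K * (floorlog 2 n + floorlog 2 gd)) \<le> 3 * (K * lg)"
  "real f \<le> 16 * log 2 (2 + K * lg)"
  "log 2 D \<le> 24576 * (K * lg)"
proof -
  have a: "real (floorlog 2 n) \<le> log 2 n + 1" "real (floorlog 2 gd) \<le> log 2 gd + 1"
    using n gd by (auto intro!: floorlog_le_log)
  show "real (floorlog 2 n) \<le> 2 * log 2 n" using a lg by linarith
  have "real (floorlog 2 n + floorlog 2 gd) \<le> 3 * lg" using a lg by simp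
  then have "real K * real (floorlog 2 n + floorlog 2 gd) \<le> real K * (3 * lg)"
    by (intro mult_left_mono) auto
  then show S: "real (K * (floorlog 2 n + floorlog 2 gd)) \<le> 3 * (K * lg)"
    by (simp only: of_nat_mult mult.left_commute)
  have "2 ^ f \<le> 2048 * (len + K)" by (rule f)
  also have "\<dots> \<le> 2048 * (4 * (K * (floorlog 2 n + floorlog 2 gd)))"
    by (intro mult_le_mono2 sizes(3))
  finally have "2 ^ f \<le> 8192 * (K * (floorlog 2 n + floorlog 2 gd))" by simp
  then have "real (2 ^ f) \<le> real (8192 * (K * (floorlog 2 n + floorlog 2 gd)))"
    by (simp only: of_nat_le_iff)
  also have "\<dots> \<le> 8192 * (3 * (K * lg))"
    using S by (simp only: of_nat_mult of_nat_numeral mult_le_cancel_left_pos zero_less_numeral)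
  finally have pf: "real (2 ^ f) \<le> 24576 * (K * lg)" by simp
  have "2 ^ f \<le> 32768 * (2 + K * lg)" using pf Kl by simp
  then have "log 2 (2 ^ f) \<le> log 2 (32768 * (2 + K * lg))"
    using Kl by (subst log_le_cancel_iff) auto
  also have "\<dots> = log 2 (2 ^ 15) + log 2 (2 + K * lg)"
    using Kl by (subst log_mult) auto
  finally have "real f \<le> 15 + log 2 (2 + K * lg)"
    by (simp only: log_pow_cancel zero_less_numeral)
  moreover have "1 \<le> log 2 (2 + K * lg)" using Kl by (simp add: le_log_iff)
  ultimately show "real f \<le> 16 * log 2 (2 + K * lg)" by linarith
  have "wl * ll \<le> 2 ^ f"
    using ll(2) wl(1,3) f_pow by (simp add: mult.commute)
  then have "real (wl * ll) \<le> real (2 ^ f)" by (simp only: of_nat_le_iff)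
  moreover have "log 2 D = real (wl * ll)" by (simp add: D_def log_nat_power)
  ultimately show "log 2 D \<le> 24576 * (K * lg)" using pf by linarith
qed

lemma D_ge_1: "1 \<le> D" by (simp add: D_def)

end

lemma samplerI: "1 \<le> n \<Longrightarrow> n \<noteq> 1 \<Longrightarrow> 0 < K \<Longrightarrow> 0 < gd \<Longrightarrow> sampler n K gd"
  by unfold_locales auto

lemma cdf_time_soft_O: "cdf_time \<in> soft_O params (\<lambda>(n, \<epsilon>, \<gamma>). 1 / \<epsilon> * log 2 (real n / \<gamma>))"
proof (rule soft_O_I[where C = 500000 and k = 1])
  fix n K gd :: nat and g :: real
  assume *: "1 \<le> n" "0 < K" "0 < gd"
    and g_def: "g = 1 / (1 / real K) * log 2 (real n / (1 / real gd))"
  show "\<bar>cdf_time (n, 1 / real K, 1 / real gd)\<bar> \<le> 500000 * ((1 + \<bar>g\<bar>) * log 2 (2 + \<bar>g\<bar>) ^ 1)"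
  proof (cases "n = 1")
    case True
    have "1 * 1 \<le> (1 + \<bar>g\<bar>) * log 2 (2 + \<bar>g\<bar>)" by (intro mult_mono log_ge_1) auto
    moreover have "cdf_time (n, 1 / real K, 1 / real gd) = 20" using True by (simp add: cdf_time_def)
    ultimately show ?thesis unfolding power_one_right by linarith
  next
    case False
    interpret sampler n K gd using * False by (intro samplerI)
    have g: "g = K * lg" by (simp add: g_def lg_def)
    have "real (9000 * (K * (floorlog 2 n + floorlog 2 gd) * f)) =
        9000 * (real (K * (floorlog 2 n + floorlog 2 gd)) * real f)"
      by (simp only: of_nat_mult of_nat_numeral)
    also have "\<dots> \<le> 9000 * (3 * (K * lg) * (16 * log 2 (2 + K * lg)))"
      using Kl by (intro mult_left_mono mult_mono real_sizes) auto
    also have "\<dots> = 432000 * ((K * lg) * log 2 (2 + K * lg))"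
      by simp
    also have "\<dots> \<le> 500000 * ((1 + K * lg) * log 2 (2 + K * lg))"
      using Kl by (intro mult_mono) auto
    finally show ?thesis
      using False Kl by (simp add: cdf_time_def g denom_inverse)
  qed
qed

text \<open>The factor \<open>f\<close> is logarithmic and occurs twice, once in the number of
  evaluations and once in the cost of each; hence the exponent 2. Bounding it by the logarithm of
  the target uses \<open>K * lg <= g\<close>, which rests on log n >= 1.\<close>

lemma sample_time_soft_O:
  "sample_time \<in> soft_O params
     (\<lambda>(n, \<epsilon>, \<gamma>). 1 / \<epsilon> * (log 2 (real n))\<^sup>2 + 1 / \<epsilon> * log 2 (real n) * log 2 (1 / \<gamma>))"
proof (rule soft_O_I[where C = 300000000 and k = 2])
  fix n K gd :: nat and g :: real
  assume *: "1 \<le> n" "0 < K" "0 < gd" and g_def: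
    "g = 1 / (1 / real K) * (log 2 (real n))\<^sup>2 + 1 / (1 / real K) * log 2 (real n) * log 2 (1 / (1 / real gd))"
  show "\<bar>sample_time (n, 1 / real K, 1 / real gd)\<bar> \<le> 300000000 * ((1 + \<bar>g\<bar>) * log 2 (2 + \<bar>g\<bar>) ^ 2)"
  proof (cases "n = 1")
    case True
    have "1 * 1 \<le> (1 + \<bar>g\<bar>) * log 2 (2 + \<bar>g\<bar>) ^ 2"
      by (intro mult_mono one_le_power log_ge_1) auto
    moreover have "sample_time (n, 1 / real K, 1 / real gd) = 20" using True by (simp add: sample_time_def)
    ultimately show ?thesis by linarith
  next
    case False
    interpret sampler n K gd using * False by (intro samplerI)
    have g: "g = log 2 n * (K * lg)"
      by (simp add: g_def lg(1) power2_eq_square algebra_simps)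
    have le: "K * lg \<le> g"
      unfolding g using mult_right_mono[OF lg(2), of "K * lg"] Kl by simp
    have "real f \<le> 16 * log 2 (2 + K * lg)" by (rule real_sizes)
    also have "\<dots> \<le> 16 * log 2 (2 + g)"
      using le Kl by simp
    finally have f': "real f \<le> 16 * log 2 (2 + g)" .
    have g0: "0 \<le> g" using le Kl by linarith
    have L: "0 \<le> log 2 (2 + g)" using log_ge_1[of g] g0 by simp
    have "real (150000 * (floorlog 2 n * f * (K * (floorlog 2 n + floorlog 2 gd) * f))) =
        150000 * (real (floorlog 2 n) * real f * (real (K * (floorlog 2 n + floorlog 2 gd)) * real f))"
      by (simp only: of_nat_mult of_nat_numeral)
    also have "\<dots> \<le> 150000 * ((2 * log 2 n) * (16 * log 2 (2 + g)) * (3 * (K * lg) * (16 * log 2 (2 + g))))"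
      using Kl lg L by (intro mult_left_mono mult_mono real_sizes f') auto
    also have "\<dots> = 230400000 * (g * log 2 (2 + g) ^ 2)"
      by (simp add: g power2_eq_square)
    also have "\<dots> \<le> 300000000 * ((1 + g) * log 2 (2 + g) ^ 2)"
      using g0 by (intro mult_mono) auto
    finally have "real (150000 * (floorlog 2 n * f * (K * (floorlog 2 n + floorlog 2 gd) * f))) \<le>
        300000000 * ((1 + g) * log 2 (2 + g) ^ 2)" .
    moreover have "sample_time (n, 1 / real K, 1 / real gd) =
        real (150000 * (floorlog 2 n * f * (K * (floorlog 2 n + floorlog 2 gd) * f)))"
      using False by (simp only: sample_time_def prod.case if_False denom_inverse Let_def)
    ultimately show ?thesis
      using g0 by (simp only: abs_of_nat abs_of_nonneg)
  qed
qed

text \<open>The logarithm of the range is \<open>wl * ll <= 2 ^ f\<close>, of order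
  \<open>K * lg\<close> even after padding, so the exponent of the logarithmic factor can be
  0.\<close>

lemma dim_factor_soft_O: "dim_factor \<in> soft_O params (\<lambda>(n, \<epsilon>, \<gamma>). 1 / \<epsilon>)"
proof (rule soft_O_I[where C = 24576 and k = 0])
  fix n K gd :: nat and g :: real
  assume *: "1 \<le> n" "0 < K" "0 < gd" and g: "g = 1 / (1 / real K)"
  have "\<bar>dim_factor (n, 1 / real K, 1 / real gd)\<bar> \<le> 24576 * (1 + real K)"
  proof (cases "n = 1")
    case False
    interpret sampler n K gd using * False by (intro samplerI)
    have "0 \<le> log 2 D" using D_ge_1 by simp
    moreover have "log 2 D / lg \<le> 24576 * K"
      using real_sizes(4) lg(4) by (simp add: divide_le_eq mult.assoc)
    moreover have "log 2 (real n * real gd) = lg" by (simp add: lg_def)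
    ultimately show ?thesis
      using False lg(4) by (simp add: dim_factor_def fast_dim_def denom_inverse)
  qed (simp add: dim_factor_def)
  then show "\<bar>dim_factor (n, 1 / real K, 1 / real gd)\<bar> \<le> 24576 * ((1 + \<bar>g\<bar>) * log 2 (2 + \<bar>g\<bar>) ^ 0)"
    by (simp add: g)
qed

lemma unit_outputs:
  assumes w: "0 < w"
  shows "outputs_within w mc P_com (1 # xs) 0 20" "outputs_within w mc Q_com (1 # xs) 1 20"
proof -
  define R where "R = input_registers w (1 # xs)"
  define m where "m = input_memory w (1 # xs)"
  have nw: "num_words w 1 = 1"
    using w Suc_0_less_two_power[of w] by (simp add: num_words_def floorlog_def)
  have one: "1 mod (2::nat) ^ w = 1" using w by simp
  have R: "R 0 = 0" "R 1 = 1"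
    using nw by (simp_all add: R_def input_registers_def)
  have m0: "m 0 = 1"
    using input_memory_at[of 0 w 1 "[]" xs] nw one by (simp add: m_def words_def digit_def)
  obtain R' where R': "ex w test_com (R, m) = (R', m)" "R' 50 = of_bool (m 0 = 1 \<and> R 1 = 1)"
    "\<And>r. r < 10 \<Longrightarrow> R' r = R r"
    using ex_test[where w = w and R = R and m = m] w R by blast
  have "straight test_com" "straight_cost test_com = 5" by (simp_all add: test_com_def)
  then obtain t where t: "t \<le> 5" "run w mc test_com (R, m) t (R', m)"
    using run_ex[of test_com w mc "(R, m)"] R'(1) by auto
  have flag: "R' 50 \<noteq> 0" using R' m0 R by simp
  have "run w mc P_com (R, m) (t + (1 + 1)) (R'(1 := 0 mod 2 ^ w), m)"
    unfolding P_com_def by (intro run.Seq[OF t(2)] run.IfTrue flag run.Const)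
  moreover have "stored_int w m 0 0 = 0" by (simp add: stored_int_def)
  ultimately show "outputs_within w mc P_com (1 # xs) 0 20"
    unfolding outputs_within_def R_def[symmetric] m_def[symmetric] using t(1) R' R
    by (intro exI[of _ "t + (1 + 1)"] exI[of _ "R'(1 := 0 mod 2 ^ w)"] exI[of _ m]) auto
  have "run w mc Q_com (R, m) (t + (1 + 1)) (R', m)"
    unfolding Q_com_def by (intro run.Seq[OF t(2)] run.IfTrue flag run.Skip)
  moreover have "stored_int w m (R' 0) (R' 1) = 1" using R' R m0 by (simp add: stored_int_def)
  ultimately show "outputs_within w mc Q_com (1 # xs) 1 20"
    unfolding outputs_within_def R_def[symmetric] m_def[symmetric] using t(1)
    by (intro exI[of _ "t + (1 + 1)"] exI[of _ R'] exI[of _ m]) auto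
qed

lemma diff_private_counting_const:
  assumes "0 \<le> \<epsilon>"
  shows "diff_private_counting n d \<epsilon> 0 (\<lambda>c u. k)"
proof -
  have "x \<le> exp \<epsilon> * x" if "0 \<le> x" for x :: real
    using assms that mult_right_mono[of 1 "exp \<epsilon>" x] by simp
  then show ?thesis
    by (simp add: diff_private_counting_def diff_private_def)
qed

theorem theorem4p8:
  fixes mulcost :: "nat \<Rightarrow> nat"
  assumes mulcost: "(\<lambda>x. real (mulcost x)) \<in> soft_O UNIV real"
  shows "\<exists>(FastSample :: nat \<Rightarrow> real \<Rightarrow> real \<Rightarrow> nat \<Rightarrow> nat \<Rightarrow> nat)
          (d :: nat \<Rightarrow> real \<Rightarrow> real \<Rightarrow> nat)
          (P :: com) (Q :: com) (\<kappa> :: nat).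
        \<exists>h \<in> soft_O params (\<lambda>(n, \<epsilon>, \<gamma>). 1 / \<epsilon>).
        \<exists>T \<in> soft_O params
               (\<lambda>(n, \<epsilon>, \<gamma>). 1 / \<epsilon> * (log 2 (real n))\<^sup>2 + 1 / \<epsilon> * log 2 (real n) * log 2 (1 / \<gamma>)).
        \<exists>T' \<in> soft_O params (\<lambda>(n, \<epsilon>, \<gamma>). 1 / \<epsilon> * log 2 (real n / \<gamma>)).
        \<kappa> \<ge> 1 \<and>
        (\<forall>(n, \<epsilon>, \<gamma>) \<in> params.
          let M = FastSample n \<epsilon> \<gamma>; D = d n \<epsilon> \<gamma>;
              w = word_length \<kappa> (input_length n \<epsilon> \<gamma> D)
          in
            eps_tilde \<epsilon> \<in> {4 / 9 * \<epsilon> <.. \<epsilon>} \<and>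
            D \<ge> 1 \<and>
            (\<forall>c \<in> {0..n}. \<forall>u \<in> {1..D}. M c u \<in> {0..n}) \<and>
            log 2 (real D) = h (n, \<epsilon>, \<gamma>) * log 2 (real n / \<gamma>) \<and>
            diff_private_counting n D (\<epsilon> / 2) 0 M \<and>
            (\<forall>\<beta> > \<gamma>. accurate n D \<lceil>2 / eps_tilde \<epsilon> * ln (1 / (\<beta> - \<gamma>))\<rceil> \<beta> M) \<and>
            (\<forall>c \<in> {0..n}. \<forall>u \<in> {1..D}.
               outputs_within w mulcost P [n, denom \<epsilon>, denom \<gamma>, c, u] (M c u) (T (n, \<epsilon>, \<gamma>))) \<and>
            (\<forall>z \<in> {0..n}. \<exists>y. real y = scaled_cdf D M z \<and>
               outputs_within w mulcost Q [n, denom \<epsilon>, denom \<gamma>, z] y (T' (n, \<epsilon>, \<gamma>))) \<and>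
            (\<forall>c \<in> {0..n}. mono_on {1..D} (M c)))"
proof -
  have main: "let M = fast_sample n \<epsilon> \<gamma>; D = fast_dim n \<epsilon> \<gamma>; w = word_length 4 (input_length n \<epsilon> \<gamma> D) in
      eps_tilde \<epsilon> \<in> {4 / 9 * \<epsilon> <.. \<epsilon>} \<and>
      D \<ge> 1 \<and>
      (\<forall>c \<in> {0..n}. \<forall>u \<in> {1..D}. M c u \<in> {0..n}) \<and>
      log 2 (real D) = dim_factor (n, \<epsilon>, \<gamma>) * log 2 (real n / \<gamma>) \<and>
      diff_private_counting n D (\<epsilon> / 2) 0 M \<and>
      (\<forall>\<beta> > \<gamma>. accurate n D \<lceil>2 / eps_tilde \<epsilon> * ln (1 / (\<beta> - \<gamma>))\<rceil> \<beta> M) \<and>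
      (\<forall>c \<in> {0..n}. \<forall>u \<in> {1..D}.
         outputs_within w mulcost P_com [n, denom \<epsilon>, denom \<gamma>, c, u] (M c u) (sample_time (n, \<epsilon>, \<gamma>))) \<and>
      (\<forall>z \<in> {0..n}. \<exists>y. real y = scaled_cdf D M z \<and>
         outputs_within w mulcost Q_com [n, denom \<epsilon>, denom \<gamma>, z] y (cdf_time (n, \<epsilon>, \<gamma>))) \<and>
      (\<forall>c \<in> {0..n}. mono_on {1..D} (M c))"
    if "(n, \<epsilon>, \<gamma>) \<in> params" for n \<epsilon> \<gamma>
  proof -
    from that obtain K gd where n: "1 \<le> n" and Keq: "0 < K" "\<epsilon> = 1 / real K" and geq: "0 < gd" "\<gamma> = 1 / real gd"
      by (auto elim: params_cases)
    have den: "denom \<epsilon> = K" "denom \<gamma> = gd" by (simp_all add: Keq geq denom_inverse)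
    have et: "eps_tilde \<epsilon> \<in> {4 / 9 * \<epsilon> <.. \<epsilon>}"
      using eps_tilde_bounds[OF Keq(1)] by (simp add: Keq)
    show ?thesis
    proof (cases "n = 1")
      case True
      have M: "fast_sample n \<epsilon> \<gamma> = (\<lambda>c u. 0)" and D: "fast_dim n \<epsilon> \<gamma> = 1"
        using True by (simp_all add: fast_sample_def fast_dim_def)
      define w where "w = word_length 4 (input_length n \<epsilon> \<gamma> 1)"
      have "0 < w"
        using True by (simp add: w_def word_length_def input_length_def floorlog_def)
      have "accurate n 1 \<lceil>2 / eps_tilde \<epsilon> * ln (1 / (\<beta> - \<gamma>))\<rceil> \<beta> (\<lambda>c u. 0)" if "\<gamma> < \<beta>" for \<beta>
      proof -
        define a where "a = \<lceil>2 / eps_tilde \<epsilon> * ln (1 / (\<beta> - \<gamma>))\<rceil>"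
        have g: "0 < \<gamma>" using geq by simp
        have "1 - \<beta> \<le> measure_pmf.prob (pmf_of_set {1..1::nat}) {u. \<bar>int 0 - int c\<bar> \<le> a}" if "c \<le> 1" for c
        proof (cases "\<beta> < 1")
          case True
          then have "0 < ln (1 / (\<beta> - \<gamma>))" using g \<open>\<gamma> < \<beta>\<close> by simp
          moreover have "0 < \<epsilon>" using Keq by simp
          then have "0 < eps_tilde \<epsilon>" using et by (simp add: Keq)
          ultimately have "0 < 2 / eps_tilde \<epsilon> * ln (1 / (\<beta> - \<gamma>))" by simp
          then have "0 < a" unfolding a_def by simp
          then have "{u :: nat. \<bar>int 0 - int c\<bar> \<le> a} = UNIV" using that by auto
          then show ?thesis using g \<open>\<gamma> < \<beta>\<close> by simp
        next
          case False
          then have "1 - \<beta> \<le> 0" by simp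
          then show ?thesis using measure_nonneg order_trans by blast
        qed
        then show ?thesis
          unfolding accurate_def a_def True by simp
      qed
      moreover have "scaled_cdf 1 (\<lambda>c u. 0) z = 1" for z
        by (simp add: scaled_cdf_def)
      moreover have "outputs_within w mulcost P_com [n, K, gd, c, u] 0 20"
        and "outputs_within w mulcost Q_com [n, K, gd, z] 1 20" for c u z
        using unit_outputs[OF \<open>0 < w\<close>] True by simp_all
      moreover have "sample_time (n, \<epsilon>, \<gamma>) = 20" "cdf_time (n, \<epsilon>, \<gamma>) = 20" "dim_factor (n, \<epsilon>, \<gamma>) = 0"
        using True by (simp_all add: sample_time_def cdf_time_def dim_factor_def)
      moreover have "diff_private_counting n 1 (\<epsilon> / 2) 0 (\<lambda>c u. 0)"
        by (intro diff_private_counting_const) (simp add: Keq)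
      ultimately show ?thesis
        unfolding M D Let_def w_def[symmetric] den using et by (auto simp: mono_on_def intro: exI[of _ 1])
    next
      case False
      interpret sampler n K gd using n False Keq geq by (intro samplerI)
      interpret tails n D G by (rule tails)
      have M: "fast_sample n \<epsilon> \<gamma> = sample" and D: "fast_dim n \<epsilon> \<gamma> = D"
        using False by (simp_all add: fast_sample_def fast_dim_def den)
      have w: "word_length 4 (input_length n \<epsilon> \<gamma> D) = wl"
        by (simp only: input_length_def den input_bits word_length_eq)
      have et': "2 / eps_tilde \<epsilon> = 1 / ln (1 + 1 / sc)"
      proof -
        have "real sc = 2 ^ ceillog2 (2 * K)" by (simp add: sc_def)
        then have "eps_tilde \<epsilon> = 2 * ln (1 + 1 / sc)" using eps_tilde_eq[OF Keq(1)] unfolding Keq(2)[symmetric] by simp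
        then show ?thesis by simp
      qed
      have "log 2 D = dim_factor (n, \<epsilon>, \<gamma>) * log 2 (n / \<gamma>)"
      proof -
        have "dim_factor (n, \<epsilon>, \<gamma>) = log 2 (fast_dim n \<epsilon> \<gamma>) / log 2 (n / \<gamma>)"
          using False by (simp only: dim_factor_def prod.case if_False)
        moreover have "log 2 (n / \<gamma>) = lg" by (simp only: geq lg_def)
        ultimately show ?thesis using lg(4) by (simp only: D) simp
      qed
      moreover have "diff_private_counting n D (\<epsilon> / 2) 0 sample"
        using diff_private_sample by (simp add: Keq)
      moreover have "accurate n D \<lceil>2 / eps_tilde \<epsilon> * ln (1 / (\<beta> - \<gamma>))\<rceil> \<beta> sample" if "\<gamma> < \<beta>" for \<beta>
        using accurate_sample[of \<beta>] that unfolding et' geq by simp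
      moreover have "outputs_within wl mulcost P_com [n, K, gd, c, u] (sample c u) (sample_time (n, \<epsilon>, \<gamma>))"
        if "c \<le> n" "1 \<le> u" "u \<le> D" for c u
      proof (rule outputs_P[OF that])
        have "sample_time (n, \<epsilon>, \<gamma>) = real (150000 * (floorlog 2 n * f * (K * (floorlog 2 n + floorlog 2 gd) * f)))"
          using False by (simp only: sample_time_def prod.case if_False den Let_def)
        then show "real (P_time + 10) \<le> sample_time (n, \<epsilon>, \<gamma>)"
          using sizes(5) by (simp only: of_nat_le_iff)
      qed
      moreover have "\<exists>y. real y = scaled_cdf D sample z \<and>
          outputs_within wl mulcost Q_com [n, K, gd, z] y (cdf_time (n, \<epsilon>, \<gamma>))" if "z \<le> n" for z
      proof (rule outputs_Q[OF that])
        have "cdf_time (n, \<epsilon>, \<gamma>) = real (9000 * (K * (floorlog 2 n + floorlog 2 gd) * f))"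
          using False by (simp only: cdf_time_def prod.case if_False den Let_def)
        then show "real (Q_time + 10) \<le> cdf_time (n, \<epsilon>, \<gamma>)"
          using sizes(4) by (simp only: of_nat_le_iff)
      qed
      moreover have "mono_on {1..D} (sample c)" if "c \<le> n" for c
        using that by (rule mono_clamped_noise)
      ultimately show ?thesis
        unfolding M D Let_def w den using et D_ge_1 by (auto intro: M_le)
    qed
  qed
  show ?thesis
    by (intro exI[of _ fast_sample] exI[of _ fast_dim] exI[of _ P_com] exI[of _ Q_com] exI[of _ 4]
        bexI[OF _ dim_factor_soft_O] bexI[OF _ sample_time_soft_O] bexI[OF _ cdf_time_soft_O])
      (use main in \<open>auto simp only: split_paired_Ball_Sigma prod.case\<close>)
qed

end
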